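(* Let $G$ be a finite group with $|G|>2$. Then $G$ is an extreme $CD1$-group if and only if one of the following holds: (1) $G$ is a $2$-group of central type with $|Z(G)|=2$, in which case $b_k=-a_k$; (2) $G$ is a doubly transitive Frobenius group, in which case $b_k=-1$.
   Context: All groups are finite. Let $\mathrm{Irr}(G)=\{\chi_1,\dots,\chi_k\}$ be the set of complex irreducible characters of $G$, with $\chi_1=1_G$ and $\chi_1(1)=1\le\chi_2(1)\le\dots\le\chi_k(1)$. A group $G$ is a $CD1$-group if $|G|>2$ and two columns of its character table differ by exactly one entry, i.e. there are non-conjugate $a,b\in G$ and an index $j$ with $\chi_j(a)\ne\chi_j(b)$ and $\chi_i(a)=\chi_i(b)$ for all $i\ne j$. For a $CD1$-group it is known that one of the two conjugacy classes is $\{1\}$, that the other one, denoted $b^G$, is uniquely determined, and that the two columns differ exactly in the row of $\chi_k$, whose degree is strictly larger than that of all other irreducible characters. Put $a_k=\chi_k(1)$ and $b_k=\chi_k(b)$. A $CD1$-group is called extreme if $b_k=-1$ or $b_k=-a_k$. A group $G$ is of central type if there is $\chi\in\mathrm{Irr}(G)$ with $[G:Z(G)]=\chi(1)^2$. A Frobenius group $G$ with Frobenius kernel $F$ and Frobenius complement $H$ is called doubly transitive if $|H|=|F|-1$. *)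

theory Defs
  imports "Jordan_Normal_Form.VS_Connect"
begin

section \<open>Complex characters of finite groups\<close>

definition mat_trace :: "'a :: comm_monoid_add mat \<Rightarrow> 'a" where
  "mat_trace A = (\<Sum>i<dim_row A. A $$ (i, i))"

definition matrix_rep :: "('a, 'b) monoid_scheme \<Rightarrow> nat \<Rightarrow> ('a \<Rightarrow> complex mat) \<Rightarrow> bool" where
  "matrix_rep G n \<rho> \<longleftrightarrow> \<rho> \<in> hom G (units_of (ring_mat TYPE(complex) n ()))"

definition irreducible_rep :: "('a, 'b) monoid_scheme \<Rightarrow> nat \<Rightarrow> ('a \<Rightarrow> complex mat) \<Rightarrow> bool" where
  "irreducible_rep G n \<rho> \<longleftrightarrow>
     matrix_rep G n \<rho> \<and> n > 0 \<and>
     (\<forall>W. subspace class_ring W (module_vec TYPE(complex) n) \<and>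
          (\<forall>g\<in>carrier G. \<forall>v\<in>W. \<rho> g *\<^sub>v v \<in> W)
        \<longrightarrow> W = {0\<^sub>v n} \<or> W = carrier_vec n)"

text \<open>
  Characters are \<^const>\<open>undefined\<close> outside the carrier, so that two of them are equal
  precisely if they agree on the group.
\<close>

definition rep_character :: "('a, 'b) monoid_scheme \<Rightarrow> ('a \<Rightarrow> complex mat) \<Rightarrow> 'a \<Rightarrow> complex" where
  "rep_character G \<rho> = (\<lambda>g\<in>carrier G. mat_trace (\<rho> g))"

definition Irr :: "('a, 'b) monoid_scheme \<Rightarrow> ('a \<Rightarrow> complex) set" where
  "Irr G = {rep_character G \<rho> | \<rho>. \<exists>n. irreducible_rep G n \<rho>}"


section \<open>\<open>CD1\<close>-groups\<close>

definition conjugate_in :: "('a, 'b) monoid_scheme \<Rightarrow> 'a \<Rightarrow> 'a \<Rightarrow> bool" where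
  "conjugate_in G a b \<longleftrightarrow> (\<exists>g\<in>carrier G. b = g \<otimes>\<^bsub>G\<^esub> a \<otimes>\<^bsub>G\<^esub> inv\<^bsub>G\<^esub> g)"

text \<open>The columns of \<open>a\<close> and \<open>b\<close> are different columns, and differ in the row \<open>\<chi>\<close> only.\<close>

definition columns_differ_only_at ::
    "('a, 'b) monoid_scheme \<Rightarrow> 'a \<Rightarrow> 'a \<Rightarrow> ('a \<Rightarrow> complex) \<Rightarrow> bool" where
  "columns_differ_only_at G a b \<chi> \<longleftrightarrow>
     a \<in> carrier G \<and> b \<in> carrier G \<and> \<not> conjugate_in G a b \<and>
     \<chi> \<in> Irr G \<and> \<chi> a \<noteq> \<chi> b \<and> (\<forall>\<psi>\<in>Irr G. \<psi> \<noteq> \<chi> \<longrightarrow> \<psi> a = \<psi> b)"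

definition CD1_group :: "('a, 'b) monoid_scheme \<Rightarrow> bool" where
  "CD1_group G \<longleftrightarrow>
     group G \<and> finite (carrier G) \<and> Coset.order G > 2 \<and> (\<exists>a b \<chi>. columns_differ_only_at G a b \<chi>)"

text \<open>
  \<open>\<chi>\<close> may be placed last when the irreducible characters are listed by increasing degree.
  Degrees are positive integers, so comparing real parts compares degrees.
\<close>

definition last_character :: "('a, 'b) monoid_scheme \<Rightarrow> ('a \<Rightarrow> complex) \<Rightarrow> bool" where
  "last_character G \<chi> \<longleftrightarrow>
     \<chi> \<in> Irr G \<and> (\<forall>\<psi>\<in>Irr G. Re (\<psi> \<one>\<^bsub>G\<^esub>) \<le> Re (\<chi> \<one>\<^bsub>G\<^esub>))"

text \<open>
  In a \<open>CD1\<close>-group one of the two columns is that of \<open>\<one>\<close>, the class of \<open>b\<close> is unique, and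
  the two columns differ in the row of the unique character \<open>\<chi>\<^sub>k\<close> of largest degree. The
  following relation says that \<open>\<chi>\<close> is this \<open>\<chi>\<^sub>k\<close> and \<open>b\<close> is an element of this class; then
  \<open>a\<^sub>k = \<chi> \<one>\<close> and \<open>b\<^sub>k = \<chi> b\<close>.
\<close>

definition CD1_data :: "('a, 'b) monoid_scheme \<Rightarrow> ('a \<Rightarrow> complex) \<Rightarrow> 'a \<Rightarrow> bool" where
  "CD1_data G \<chi> b \<longleftrightarrow> last_character G \<chi> \<and> columns_differ_only_at G \<one>\<^bsub>G\<^esub> b \<chi>"

definition extreme_CD1_group :: "('a, 'b) monoid_scheme \<Rightarrow> bool" where
  "extreme_CD1_group G \<longleftrightarrow>
     CD1_group G \<and> (\<exists>\<chi> b. CD1_data G \<chi> b \<and> (\<chi> b = -1 \<or> \<chi> b = - \<chi> \<one>\<^bsub>G\<^esub>))"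


section \<open>Groups of central type and Frobenius groups\<close>

definition group_center :: "('a, 'b) monoid_scheme \<Rightarrow> 'a set" where
  "group_center G = {z \<in> carrier G. \<forall>g\<in>carrier G. z \<otimes>\<^bsub>G\<^esub> g = g \<otimes>\<^bsub>G\<^esub> z}"

definition central_type :: "('a, 'b) monoid_scheme \<Rightarrow> bool" where
  "central_type G \<longleftrightarrow>
     (\<exists>\<chi>\<in>Irr G. of_nat (card (rcosets\<^bsub>G\<^esub> (group_center G))) = (\<chi> \<one>\<^bsub>G\<^esub>)\<^sup>2)"

definition two_group :: "('a, 'b) monoid_scheme \<Rightarrow> bool" where
  "two_group G \<longleftrightarrow> (\<exists>n. Coset.order G = 2 ^ n)"

definition conjugate_set :: "('a, 'b) monoid_scheme \<Rightarrow> 'a \<Rightarrow> 'a set \<Rightarrow> 'a set" where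
  "conjugate_set G g H = (\<lambda>h. g \<otimes>\<^bsub>G\<^esub> h \<otimes>\<^bsub>G\<^esub> inv\<^bsub>G\<^esub> g) ` H"

definition frobenius_complement :: "('a, 'b) monoid_scheme \<Rightarrow> 'a set \<Rightarrow> bool" where
  "frobenius_complement G H \<longleftrightarrow>
     subgroup H G \<and> H \<noteq> {\<one>\<^bsub>G\<^esub>} \<and> H \<noteq> carrier G \<and>
     (\<forall>g\<in>carrier G - H. H \<inter> conjugate_set G g H = {\<one>\<^bsub>G\<^esub>})"

definition frobenius_kernel :: "('a, 'b) monoid_scheme \<Rightarrow> 'a set \<Rightarrow> 'a set" where
  "frobenius_kernel G H =
     insert \<one>\<^bsub>G\<^esub> (carrier G - (\<Union>g\<in>carrier G. conjugate_set G g H))"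

definition doubly_transitive_frobenius :: "('a, 'b) monoid_scheme \<Rightarrow> bool" where
  "doubly_transitive_frobenius G \<longleftrightarrow>
     (\<exists>H. frobenius_complement G H \<and> card H = card (frobenius_kernel G H) - 1)"

end

theory Submission
  imports
    Defs
    "Jordan_Normal_Form.Schur_Decomposition"
    "Jordan_Normal_Form.Spectral_Radius"
    "HOL-Algebra.Sylow"
    "HOL-Algebra.Left_Coset"
    "HOL-Algebra.Multiplicative_Group"
begin

text \<open>
  Let \<open>\<chi>\<close> be the row in which the columns of \<open>1\<close> and \<open>b\<close> differ, and \<open>a = \<chi>(1)\<close>. Both columns have the
  same entries outside that row, so the values \<open>|G|\<close> and \<open>0\<close> of the regular character
  \<open>\<Sum>\<psi>(1)\<psi>(g)\<close> at \<open>1\<close> and \<open>b\<close> give \<open>a (a - \<chi>(b)) = |G|\<close>. Thus \<open>|G| = 2 a\<^sup>2\<close> if \<open>\<chi>(b) = -a\<close>, and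
  \<open>|G| = a (a + 1)\<close> if \<open>\<chi>(b) = -1\<close>. The set \<open>K\<close> of all \<open>g\<close> with \<open>\<psi>(g) = \<psi>(1)\<close> for every \<open>\<psi> \<noteq> \<chi>\<close>
  is a normal subgroup on which \<open>\<chi>\<close> takes the constant value \<open>\<chi>(b)\<close> away from \<open>1\<close>, and by column
  orthogonality any nontrivial element of \<open>K\<close> is conjugated to any other one by exactly
  \<open>|G| - a\<^sup>2 + \<chi>(b)\<^sup>2\<close> elements of \<open>G\<close> (\<open>common_kernel_but_conjugators\<close>).

  Suppose \<open>\<chi>(b) = -a\<close>. Then all of \<open>G\<close> conjugates \<open>b\<close> to each nontrivial element of \<open>K\<close>, that is,
  \<open>b\<close> is central and \<open>K = {1, b}\<close>. The column of an element \<open>z\<close> outside \<open>K\<close> is orthogonal to those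
  of \<open>1\<close> and of \<open>b\<close>; subtracting the two relations leaves \<open>\<chi>(z) = 0\<close>. As irreducible characters do
  not vanish at central elements, \<open>K\<close> is the centre and has index \<open>a\<^sup>2\<close>. For a Sylow subgroup \<open>P\<close>
  at an odd prime, \<open>\<chi>\<close> vanishes on \<open>P\<close> off \<open>1\<close>; hence \<open>a / |P|\<close> is the multiplicity of the trivial
  character in the restriction, \<open>|P|\<^sup>2\<close> divides \<open>|G|\<close>, and \<open>P = 1\<close>. Conversely, a central involution
  \<open>z\<close> has \<open>\<psi>(z) = \<plusminus>\<psi>(1)\<close>, and the vanishing of \<open>\<Sum>\<psi>(1)\<psi>(z)\<close> says that the rows of either
  sign contribute \<open>|G| / 2\<close> to \<open>\<Sum>\<psi>(1)\<^sup>2 = |G|\<close>. If \<open>\<chi>(1)\<^sup>2 = |G| / 2\<close>, then \<open>\<chi>\<close> exhausts the rows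
  of its sign; that sign is negative, because the trivial character is positive.

  Suppose \<open>\<chi>(b) = -1\<close>. Then \<open>a + 1\<close> elements conjugate \<open>b\<close> to a given nontrivial element of \<open>K\<close>, so
  \<open>|K| = a + 1\<close>. A count of commuting pairs shows that \<open>K\<close> is abelian
  (\<open>conjugate_nontrivial_imp_commutative\<close>), so that it is the centralizer of each of its nontrivial
  elements. Its index \<open>a\<close> is prime to its order, whence a complement exists
  (\<open>abelian_normal_complement\<close>), and this is a Frobenius complement of order \<open>a = |K| - 1\<close>.
  Conversely, in a doubly transitive Frobenius group with complement \<open>H\<close> the permutation character on
  the cosets of \<open>H\<close> has norm \<open>2\<close> and so equals \<open>1 + \<chi>\<close> with \<open>\<chi>\<close> irreducible, \<open>\<chi>(1) = |H|\<close>, and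
  \<open>\<chi>(b) = -1\<close> for nontrivial \<open>b\<close> in the kernel. The relation \<open>a (a - \<chi>(b)) = |G|\<close> then turns into
  \<open>\<Sum>\<psi>(1)(\<psi>(1) - \<psi>(b)) = 0\<close> over the rows \<open>\<psi> \<noteq> \<chi>\<close>, and since \<open>|\<psi>(b)| \<le> \<psi>(1)\<close> every term is
  zero (\<open>common_kernel_butI\<close>).

  The values in both cases do not depend on the choice of \<open>\<chi>\<close> and \<open>b\<close>: the degree \<open>a\<close> is the
  largest one, and \<open>a (a - \<chi>(b)) = |G|\<close> determines \<open>\<chi>(b)\<close>.

  The character theory is developed from matrices. The main steps are the decomposition of the trace
  of a representation into irreducible characters (\<open>matrix_rep_trace_decomp\<close>), Schur's lemma with
  the orthogonality of matrix coefficients, and the average of \<open>\<psi>(x c y c\<^sup>-\<^sup>1)\<close> over \<open>c\<close>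
  (\<open>character_conjugation_average\<close>). Applied to the regular representation these give column
  orthogonality; the average also shows that characters are nonzero at central elements and that
  \<open>{g. \<psi>(g) = \<psi>(1)}\<close> is closed under products.
\<close>

(* frees the symbol for left cosets *)
no_notation subset_mset (infix \<open><#\<close> 50)

section \<open>Compressing matrices to subspaces\<close>

lemma subspace_vec_iff:
  fixes W :: "'a::field vec set"
  shows "VectorSpace.subspace class_ring W (module_vec TYPE('a) n) \<longleftrightarrow>
    W \<subseteq> carrier_vec n \<and> 0\<^sub>v n \<in> W \<and> (\<forall>v\<in>W. \<forall>w\<in>W. v + w \<in> W) \<and> (\<forall>c. \<forall>v\<in>W. c \<cdot>\<^sub>v v \<in> W)"
proof -
  interpret vec_space "TYPE('a)" n .
  have "vectorspace class_ring (module_vec TYPE('a) n)" ..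
  moreover have "Module.module class_ring (module_vec TYPE('a) n)" ..
  ultimately show ?thesis
    unfolding VectorSpace.subspace_def submodule_def by (auto simp: module_vec_simps)
qed

lemma mat_trace_carrier: "A \<in> carrier_mat n m \<Longrightarrow> mat_trace A = (\<Sum>i<n. A $$ (i, i))"
  by (simp add: mat_trace_def)

lemma index_mult_mat_sum:
  "A \<in> carrier_mat n m \<Longrightarrow> B \<in> carrier_mat m k \<Longrightarrow> i < n \<Longrightarrow> j < k \<Longrightarrow>
     (A * B) $$ (i, j) = (\<Sum>p<m. A $$ (i, p) * B $$ (p, j))"
  by (auto simp: scalar_prod_def lessThan_atLeast0 intro!: sum.cong)

lemma mat_trace_mult_comm:
  fixes A B :: "'a::comm_semiring_0 mat"
  assumes A: "A \<in> carrier_mat n m" and B: "B \<in> carrier_mat m n"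
  shows "mat_trace (A * B) = mat_trace (B * A)"
proof -
  have "mat_trace (A * B) = (\<Sum>i<n. \<Sum>p<m. A $$ (i, p) * B $$ (p, i))"
    using A B by (simp add: mat_trace_carrier[of _ n n] index_mult_mat_sum[OF A B] del: index_mult_mat)
  also have "\<dots> = (\<Sum>p<m. \<Sum>i<n. B $$ (p, i) * A $$ (i, p))"
    by (subst sum.swap) (simp add: mult.commute)
  also have "\<dots> = mat_trace (B * A)"
    using A B by (simp add: mat_trace_carrier[of _ m m] index_mult_mat_sum[OF B A] del: index_mult_mat)
  finally show ?thesis .
qed

lemma mat_trace_add:
  "A \<in> carrier_mat n n \<Longrightarrow> B \<in> carrier_mat n n \<Longrightarrow> mat_trace (A + B) = mat_trace A + mat_trace B"
  by (simp add: mat_trace_carrier[of _ n n] sum.distrib)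

lemma mat_trace_one: "mat_trace (1\<^sub>m n) = (of_nat n :: 'a::semiring_1)"
  by (simp add: mat_trace_carrier[of _ n n])

lemma mat_eqI_mult_vec:
  fixes A B :: "'a::field mat"
  assumes A: "A \<in> carrier_mat n m" and B: "B \<in> carrier_mat n m"
    and eq: "\<And>v. v \<in> carrier_vec m \<Longrightarrow> A *\<^sub>v v = B *\<^sub>v v"
  shows "A = B"
proof (rule eq_matI)
  fix i j assume ij: "i < dim_row B" "j < dim_col B"
  have "(A *\<^sub>v unit_vec m j) $ i = (B *\<^sub>v unit_vec m j) $ i" by (simp add: eq)
  then show "A $$ (i, j) = B $$ (i, j)" using A B ij by simp
qed (use A B in auto)

lemma mult_mat_zero_vec:
  "A \<in> carrier_mat n m \<Longrightarrow> A *\<^sub>v 0\<^sub>v m = (0\<^sub>v n :: 'a::semiring_0 vec)"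
  by (intro eq_vecI) auto

text \<open>
  The columns of \<open>L\<close> form a basis of a part of \<open>W\<close>, and \<open>R\<close> reads off coordinates with respect to it.
  Keeping the left inverse \<open>R\<close> along with the basis replaces arguments about linear independence by
  matrix identities: \<open>L R\<close> is a projection, and its trace is the number \<open>k\<close> of basis vectors.
\<close>
definition subspace_frame :: "nat \<Rightarrow> nat \<Rightarrow> 'a::field vec set \<Rightarrow> 'a mat \<Rightarrow> 'a mat \<Rightarrow> bool" where
  "subspace_frame n k W L R \<longleftrightarrow> L \<in> carrier_mat n k \<and> R \<in> carrier_mat k n \<and> R * L = 1\<^sub>m k \<and>
     (\<forall>v\<in>carrier_vec k. L *\<^sub>v v \<in> W)"

text \<open>
  If \<open>k > n\<close>, padding \<open>L\<close> with zero rows makes it a singular square matrix, so \<open>L\<close> kills a nonzero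
  vector, which the left inverse forbids. This bounds the size of a frame.
\<close>
lemma left_invertible_dim_le:
  fixes L R :: "'a::field mat"
  assumes L: "L \<in> carrier_mat n k" and R: "R \<in> carrier_mat k n" and RL: "R * L = 1\<^sub>m k"
  shows "k \<le> n"
proof (rule ccontr)
  assume "\<not> k \<le> n"
  then have nk: "n < k" by simp
  define A where "A = mat k k (\<lambda>(i, j). if i < n then L $$ (i, j) else 0)"
  have A: "A \<in> carrier_mat k k" by (simp add: A_def)
  have "transpose_mat A *\<^sub>v unit_vec k (k - 1) = 0\<^sub>v k"
    using nk by (intro eq_vecI) (auto simp: A_def)
  moreover have "unit_vec k (k - 1) \<noteq> (0\<^sub>v k :: 'a vec)" using nk by simp
  ultimately have "det (transpose_mat A) = 0"
    using det_0_iff_vec_prod_zero_field[of "transpose_mat A" k] A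
    by (metis transpose_carrier_mat unit_vec_carrier)
  then have "det A = 0" using det_transpose[OF A] by simp
  then obtain v where v: "v \<in> carrier_vec k" "v \<noteq> 0\<^sub>v k" "A *\<^sub>v v = 0\<^sub>v k"
    using det_0_iff_vec_prod_zero_field[OF A] by blast
  have "L *\<^sub>v v = 0\<^sub>v n"
  proof (rule eq_vecI)
    fix i assume i: "i < dim_vec (0\<^sub>v n :: 'a vec)"
    have "row L i = row A i" using i nk L by (intro eq_vecI) (auto simp: A_def)
    then have "(L *\<^sub>v v) $ i = (A *\<^sub>v v) $ i" using i nk L A by simp
    then show "(L *\<^sub>v v) $ i = 0\<^sub>v n $ i" using i nk v by simp
  qed (use L in auto)
  then have "R *\<^sub>v (L *\<^sub>v v) = 0\<^sub>v k" using R by auto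
  moreover have "R *\<^sub>v (L *\<^sub>v v) = v"
    using RL assoc_mult_mat_vec[OF R L v(1)] v(1) by simp
  ultimately show False using v by simp
qed

text \<open>
  A vector \<open>w\<close> of \<open>W\<close> that the projection \<open>L R\<close> moves leaves the nonzero remainder \<open>u = w - L R w\<close>,
  which is annihilated by \<open>R\<close> and can serve as an additional column.
\<close>
lemma subspace_frame_extend:
  fixes W :: "'a::field vec set"
  assumes W: "VectorSpace.subspace class_ring W (module_vec TYPE('a) n)"
    and fr: "subspace_frame n k W L R" and w: "w \<in> W" and ne: "L *\<^sub>v (R *\<^sub>v w) \<noteq> w"
  shows "\<exists>L' R'. subspace_frame n (Suc k) W L' R'"
proof -
  note Wd = W[unfolded subspace_vec_iff]
  have L: "L \<in> carrier_mat n k" and R: "R \<in> carrier_mat k n" and RL: "R * L = 1\<^sub>m k"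
    and LW: "\<And>v. v \<in> carrier_vec k \<Longrightarrow> L *\<^sub>v v \<in> W"
    using fr by (auto simp: subspace_frame_def)
  have wc: "w \<in> carrier_vec n" using w Wd by auto
  define u where "u = w + (-1) \<cdot>\<^sub>v (L *\<^sub>v (R *\<^sub>v w))"
  have Rw: "R *\<^sub>v w \<in> carrier_vec k" and LRw: "L *\<^sub>v (R *\<^sub>v w) \<in> carrier_vec n" using R L wc by auto
  have uW: "u \<in> W" unfolding u_def using w LW[OF Rw] Wd by blast
  have uc: "u \<in> carrier_vec n" using uW Wd by auto
  have RLv: "R *\<^sub>v (L *\<^sub>v v) = v" if "v \<in> carrier_vec k" for v
    using RL assoc_mult_mat_vec[OF R L that] that by simp
  have Ru: "R *\<^sub>v u = 0\<^sub>v k"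
  proof -
    have "R *\<^sub>v u = R *\<^sub>v w + (-1) \<cdot>\<^sub>v (R *\<^sub>v (L *\<^sub>v (R *\<^sub>v w)))"
      unfolding u_def using R wc LRw by (simp add: mult_add_distrib_mat_vec[OF R wc] mult_mat_vec[OF R])
    also have "\<dots> = 0\<^sub>v k" unfolding RLv[OF Rw] using R by (intro eq_vecI) auto
    finally show ?thesis .
  qed
  have "u \<noteq> 0\<^sub>v n"
  proof
    assume u0: "u = 0\<^sub>v n"
    have "L *\<^sub>v (R *\<^sub>v w) = w"
    proof (rule eq_vecI)
      fix i assume i: "i < dim_vec w"
      then have "u $ i = 0" using u0 wc by simp
      then show "(L *\<^sub>v (R *\<^sub>v w)) $ i = w $ i" unfolding u_def using i wc L by simp
    qed (use L wc in auto)
    then show False using ne by simp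
  qed
  then obtain i where i: "i < n" "u $ i \<noteq> 0" using uc by (metis carrier_vecD eq_vecI index_zero_vec)
  \<comment> \<open>the \<open>i\<close>-th row of \<open>1 - L R\<close> kills the columns of \<open>L\<close> and takes the value \<open>u $ i\<close> at \<open>u\<close>\<close>
  define M where "M = 1\<^sub>m n - L * R"
  have M: "M \<in> carrier_mat n n" unfolding M_def using L R by (intro minus_carrier_mat) auto
  have MtL: "M * L = 0\<^sub>m n k"
  proof -
    have "M * L = 1\<^sub>m n * L - (L * R) * L" unfolding M_def
      by (rule minus_mult_distrib_mat[of _ n n _ _ k]) (use L R in auto)
    also have "(L * R) * L = L" using assoc_mult_mat[OF L R L] RL L by simp
    finally show ?thesis using L by simp
  qed
  have Mu: "M *\<^sub>v u = u"
  proof -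
    have "M *\<^sub>v u = 1\<^sub>m n *\<^sub>v u - (L * R) *\<^sub>v u" unfolding M_def
      by (rule minus_mult_distrib_mat_vec[of _ n n]) (use L R uc in auto)
    also have "(L * R) *\<^sub>v u = 0\<^sub>v n" using L R uc Ru by (simp add: mult_mat_zero_vec)
    finally show ?thesis using uc by simp
  qed
  \<comment> \<open>append \<open>u\<close> to the columns of \<open>L\<close> and that row, scaled, to the rows of \<open>R\<close>\<close>
  define L' where "L' = mat n (Suc k) (\<lambda>(p, j). if j < k then L $$ (p, j) else u $ p)"
  define R' where "R' = mat (Suc k) n (\<lambda>(j, p). if j < k then R $$ (j, p) else M $$ (i, p) / u $ i)"
  have L': "L' \<in> carrier_mat n (Suc k)" and R': "R' \<in> carrier_mat (Suc k) n"
    by (simp_all add: L'_def R'_def)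
  have Mui: "(\<Sum>p<n. M $$ (i, p) * u $ p) = u $ i"
    using arg_cong[OF Mu, of "\<lambda>v. v $ i"] M uc i
    by (simp add: scalar_prod_def lessThan_atLeast0)
  have Rui: "(\<Sum>p<n. R $$ (j, p) * u $ p) = 0" if "j < k" for j
    using arg_cong[OF Ru, of "\<lambda>v. v $ j"] R uc that
    by (simp add: scalar_prod_def lessThan_atLeast0)
  have MLi: "(\<Sum>p<n. M $$ (i, p) * L $$ (p, j)) = 0" if "j < k" for j
    using index_mult_mat_sum[OF M L i(1) that] that i by (simp add: MtL)
  have RLi: "(\<Sum>p<n. R $$ (l, p) * L $$ (p, j)) = (if l = j then 1 else 0)" if "l < k" "j < k" for l j
    using index_mult_mat_sum[OF R L that] that by (simp add: RL)
  have "R' * L' = 1\<^sub>m (Suc k)"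
  proof (rule eq_matI)
    fix l j assume "l < dim_row (1\<^sub>m (Suc k))" "j < dim_col (1\<^sub>m (Suc k))"
    then have lj: "l < Suc k" "j < Suc k" by auto
    have "(R' * L') $$ (l, j) = (\<Sum>p<n. R' $$ (l, p) * L' $$ (p, j))"
      by (rule index_mult_mat_sum[OF R' L' lj])
    also have "\<dots> = (\<Sum>p<n. (if l < k then R $$ (l, p) else M $$ (i, p) / u $ i) * (if j < k then L $$ (p, j) else u $ p))"
      using lj by (intro sum.cong) (auto simp: R'_def L'_def)
    also have "\<dots> = (if l = j then 1 else 0)"
      using lj i Mui Rui MLi RLi
      by (auto simp: sum_divide_distrib[symmetric] less_Suc_eq)
    finally show "(R' * L') $$ (l, j) = 1\<^sub>m (Suc k) $$ (l, j)" using lj by simp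
  qed (use L' R' in auto)
  moreover have "L' *\<^sub>v v \<in> W" if v: "v \<in> carrier_vec (Suc k)" for v
  proof -
    define v' where "v' = vec k (\<lambda>j. v $ j)"
    have v': "v' \<in> carrier_vec k" by (simp add: v'_def)
    have "L' *\<^sub>v v = L *\<^sub>v v' + v $ k \<cdot>\<^sub>v u"
    proof (rule eq_vecI)
      fix p assume "p < dim_vec (L *\<^sub>v v' + v $ k \<cdot>\<^sub>v u)"
      then have p: "p < n" using uc by simp
      have "(L' *\<^sub>v v) $ p = (\<Sum>j<Suc k. L' $$ (p, j) * v $ j)"
        using p L' v by (simp add: scalar_prod_def lessThan_atLeast0 del: sum.op_ivl_Suc)
      also have "\<dots> = (\<Sum>j<k. L $$ (p, j) * v' $ j) + u $ p * v $ k"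
        using p by (auto simp: L'_def v'_def intro!: sum.cong)
      also have "(\<Sum>j<k. L $$ (p, j) * v' $ j) = (L *\<^sub>v v') $ p"
        using p L v' by (simp add: scalar_prod_def lessThan_atLeast0)
      finally show "(L' *\<^sub>v v) $ p = (L *\<^sub>v v' + v $ k \<cdot>\<^sub>v u) $ p"
        using p uc L by (simp add: mult.commute)
    qed (use L L' uc in auto)
    moreover have "L *\<^sub>v v' + v $ k \<cdot>\<^sub>v u \<in> W" using LW[OF v'] uW Wd by blast
    ultimately show ?thesis by simp
  qed
  ultimately show ?thesis using L' R' by (auto simp: subspace_frame_def)
qed

text \<open>A largest frame of a subspace covers it, since otherwise it could be extended.\<close>

lemma subspace_frame_exists:
  fixes W :: "'a::field vec set"
  assumes W: "VectorSpace.subspace class_ring W (module_vec TYPE('a) n)"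
  obtains k L R where "subspace_frame n k W L R" and "\<And>w. w \<in> W \<Longrightarrow> L *\<^sub>v (R *\<^sub>v w) = w"
proof -
  let ?P = "\<lambda>k. \<exists>L R. subspace_frame n k W L R"
  have bd: "\<And>k. ?P k \<Longrightarrow> k \<le> n"
    using left_invertible_dim_le by (metis subspace_frame_def)
  have zero_mult_vec: "0\<^sub>m n 0 *\<^sub>v v = (0\<^sub>v n :: 'a vec)" if "v \<in> carrier_vec 0" for v
    using that by (intro eq_vecI) (auto simp: scalar_prod_def)
  have "?P 0"
  proof (intro exI)
    show "subspace_frame n 0 W (0\<^sub>m n 0) (0\<^sub>m 0 n)"
      using W zero_mult_vec by (auto simp: subspace_frame_def subspace_vec_iff)
  qed
  then have "?P (Greatest ?P)" by (rule GreatestI_nat) (use bd in blast)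
  then obtain L R where fr: "subspace_frame n (Greatest ?P) W L R" by blast
  have "L *\<^sub>v (R *\<^sub>v w) = w" if "w \<in> W" for w
  proof (rule ccontr)
    assume "L *\<^sub>v (R *\<^sub>v w) \<noteq> w"
    from subspace_frame_extend[OF W fr that this] have "?P (Suc (Greatest ?P))" .
    then have "Suc (Greatest ?P) \<le> Greatest ?P" by (rule Greatest_le_nat) (use bd in blast)
    then show False by simp
  qed
  with fr that show ?thesis by blast
qed

section \<open>Matrix representations\<close>

locale finite_group = group G for G :: "('a, 'b) monoid_scheme" (structure) +
  assumes finite_carrier [simp, intro]: "finite (carrier G)"
begin

text \<open>
  The inverse of \<open>\<rho> g\<close> is \<open>\<rho> (inv g)\<close>, so a multiplicative map that respects the identity takes
  invertible values.
\<close>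
lemma matrix_rep_iff:
  "matrix_rep G n \<rho> \<longleftrightarrow> (\<forall>g\<in>carrier G. \<rho> g \<in> carrier_mat n n) \<and>
     (\<forall>g\<in>carrier G. \<forall>h\<in>carrier G. \<rho> (g \<otimes> h) = \<rho> g * \<rho> h) \<and> \<rho> \<one> = 1\<^sub>m n" (is "?l \<longleftrightarrow> ?r")
proof
  assume l: ?l
  let ?M = "ring_mat TYPE(complex) n ()"
  interpret M: Ring.ring ?M by (rule ring_mat)
  interpret h: group_hom G "units_of ?M" \<rho>
    using l M.units_group by (simp add: matrix_rep_def group_hom_def group_hom_axioms_def is_group)
  have "\<rho> g \<in> carrier_mat n n" if "g \<in> carrier G" for g
    using h.hom_closed[OF that] M.Units_closed by (auto simp: units_of_carrier ring_mat_simps)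
  moreover have "\<rho> (g \<otimes> h) = \<rho> g * \<rho> h" if "g \<in> carrier G" "h \<in> carrier G" for g h
    using h.hom_mult[OF that] by (simp add: units_of_mult ring_mat_simps)
  moreover have "\<rho> \<one> = 1\<^sub>m n" using h.hom_one by (simp add: units_of_one ring_mat_simps)
  ultimately show ?r by blast
next
  assume r: ?r
  let ?M = "ring_mat TYPE(complex) n ()"
  have "\<rho> g \<in> carrier (units_of ?M)" if g: "g \<in> carrier G" for g
  proof -
    have "\<rho> (inv g) * \<rho> g = 1\<^sub>m n" "\<rho> g * \<rho> (inv g) = 1\<^sub>m n"
      using r g by (metis inv_closed l_inv, metis inv_closed r_inv)
    then show ?thesis using r g inv_closed[OF g]
      by (auto simp: units_of_carrier Units_def ring_mat_simps)
  qed
  then show ?l using r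
    by (auto simp: matrix_rep_def hom_def units_of_mult ring_mat_simps)
qed

lemma matrix_repD:
  assumes "matrix_rep G n \<rho>"
  shows "g \<in> carrier G \<Longrightarrow> \<rho> g \<in> carrier_mat n n"
    and "g \<in> carrier G \<Longrightarrow> h \<in> carrier G \<Longrightarrow> \<rho> (g \<otimes> h) = \<rho> g * \<rho> h"
    and "\<rho> \<one> = 1\<^sub>m n"
  using assms by (auto simp: matrix_rep_iff)

text \<open>
  The compressed map \<open>R \<rho> L\<close> is multiplicative as soon as the projection \<open>L R\<close> may be dropped between
  two factors, which is what the last premise says. It is applied twice: to an invariant subspace, and to
  a complement of one, where the compression is the representation on the quotient.
\<close>
lemma matrix_rep_compress:
  assumes rep: "matrix_rep G n \<rho>"
    and L: "L \<in> carrier_mat n k" and R: "R \<in> carrier_mat k n" and RL: "R * L = 1\<^sub>m k"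
    and skip: "\<And>g h v. g \<in> carrier G \<Longrightarrow> h \<in> carrier G \<Longrightarrow> v \<in> carrier_vec k \<Longrightarrow>
      R *\<^sub>v (\<rho> g *\<^sub>v (L *\<^sub>v (R *\<^sub>v (\<rho> h *\<^sub>v (L *\<^sub>v v))))) = R *\<^sub>v (\<rho> g *\<^sub>v (\<rho> h *\<^sub>v (L *\<^sub>v v)))"
  shows "matrix_rep G k (\<lambda>g. R * \<rho> g * L)"
    and "\<And>g. g \<in> carrier G \<Longrightarrow> mat_trace (R * \<rho> g * L) = mat_trace (\<rho> g * (L * R))"
proof -
  note rc = matrix_repD(1)[OF rep]
  have comp: "(R * \<rho> g * L) *\<^sub>v v = R *\<^sub>v (\<rho> g *\<^sub>v (L *\<^sub>v v))" if g: "g \<in> carrier G" and v: "v \<in> carrier_vec k" for g v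
  proof -
    have Lv: "L *\<^sub>v v \<in> carrier_vec n" using L v by auto
    have "(R * \<rho> g * L) *\<^sub>v v = (R * \<rho> g) *\<^sub>v (L *\<^sub>v v)"
      using R rc[OF g] L v by (intro assoc_mult_mat_vec) auto
    also have "\<dots> = R *\<^sub>v (\<rho> g *\<^sub>v (L *\<^sub>v v))" by (rule assoc_mult_mat_vec[OF R rc[OF g] Lv])
    finally show ?thesis .
  qed
  have car: "R * \<rho> g * L \<in> carrier_mat k k" if g: "g \<in> carrier G" for g
    using R rc[OF g] L by auto
  show "matrix_rep G k (\<lambda>g. R * \<rho> g * L)" unfolding matrix_rep_iff
  proof (intro conjI ballI)
    fix g h assume g: "g \<in> carrier G" and h: "h \<in> carrier G"
    have gh: "g \<otimes> h \<in> carrier G" using g h by simp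
    show "R * \<rho> (g \<otimes> h) * L = R * \<rho> g * L * (R * \<rho> h * L)"
    proof (rule mat_eqI_mult_vec)
      fix v :: "complex vec" assume v: "v \<in> carrier_vec k"
      have Lv: "L *\<^sub>v v \<in> carrier_vec n" using L v by auto
      have Pv: "(R * \<rho> h * L) *\<^sub>v v \<in> carrier_vec k" using car[OF h] v by auto
      have "(R * \<rho> g * L * (R * \<rho> h * L)) *\<^sub>v v = (R * \<rho> g * L) *\<^sub>v ((R * \<rho> h * L) *\<^sub>v v)"
        by (rule assoc_mult_mat_vec[OF car[OF g] car[OF h] v])
      also have "\<dots> = R *\<^sub>v (\<rho> g *\<^sub>v (\<rho> h *\<^sub>v (L *\<^sub>v v)))"
        unfolding comp[OF g Pv] unfolding comp[OF h v] by (rule skip[OF g h v])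
      also have "\<dots> = R *\<^sub>v ((\<rho> g * \<rho> h) *\<^sub>v (L *\<^sub>v v))"
        by (simp only: assoc_mult_mat_vec[OF rc[OF g] rc[OF h] Lv])
      also have "\<dots> = (R * \<rho> (g \<otimes> h) * L) *\<^sub>v v"
        by (simp only: comp[OF gh v, unfolded matrix_repD(2)[OF rep g h]] matrix_repD(2)[OF rep g h])
      finally show "(R * \<rho> (g \<otimes> h) * L) *\<^sub>v v = (R * \<rho> g * L * (R * \<rho> h * L)) *\<^sub>v v" ..
    qed (use car[OF gh] mult_carrier_mat[OF car[OF g] car[OF h]] in auto)
  next
    show "R * \<rho> \<one> * L = 1\<^sub>m k" using matrix_repD(3)[OF rep] R RL by simp
  qed (rule car)
  show "mat_trace (R * \<rho> g * L) = mat_trace (\<rho> g * (L * R))" if g: "g \<in> carrier G" for g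
  proof -
    have "mat_trace (R * \<rho> g * L) = mat_trace (R * (\<rho> g * L))"
      by (simp add: assoc_mult_mat[OF R rc[OF g] L])
    also have "\<dots> = mat_trace ((\<rho> g * L) * R)"
      by (rule mat_trace_mult_comm[OF R]) (use rc[OF g] L in auto)
    finally show ?thesis by (simp add: assoc_mult_mat[OF rc[OF g] L R])
  qed
qed

definition invariant_subspace :: "nat \<Rightarrow> ('a \<Rightarrow> complex mat) \<Rightarrow> complex vec set \<Rightarrow> bool" where
  "invariant_subspace n \<rho> W \<longleftrightarrow> VectorSpace.subspace class_ring W (module_vec TYPE(complex) n) \<and>
     (\<forall>g\<in>carrier G. \<forall>v\<in>W. \<rho> g *\<^sub>v v \<in> W)"

lemma irreducible_rep_iff:
  "irreducible_rep G n \<rho> \<longleftrightarrow> matrix_rep G n \<rho> \<and> n > 0 \<and>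
     (\<forall>W. invariant_subspace n \<rho> W \<longrightarrow> W = {0\<^sub>v n} \<or> W = carrier_vec n)"
  by (auto simp: irreducible_rep_def invariant_subspace_def)

text \<open>
  Let \<open>L R\<close> be a projection onto \<open>W\<close>, and \<open>F = 1 - L R\<close> with image \<open>U\<close>. The space \<open>U\<close> is a complement
  of \<open>W\<close> that \<open>\<rho>\<close> may move, but \<open>F\<close> kills \<open>W\<close> and \<open>\<rho>\<close> preserves \<open>W\<close>; so compressing to \<open>U\<close> by
  means of \<open>F\<close> yields the quotient representation. The traces add up because the two projections do.
\<close>
lemma matrix_rep_split:
  assumes rep: "matrix_rep G n \<rho>" and W: "invariant_subspace n \<rho> W"
    and W0: "W \<noteq> {0\<^sub>v n}" and W1: "W \<noteq> carrier_vec n"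
  obtains k \<sigma> m \<tau> where "k < n" "m < n" "matrix_rep G k \<sigma>" "matrix_rep G m \<tau>"
    "\<And>g. g \<in> carrier G \<Longrightarrow> mat_trace (\<rho> g) = mat_trace (\<sigma> g) + mat_trace (\<tau> g)"
proof -
  note rc = matrix_repD(1)[OF rep]
  have sub: "VectorSpace.subspace class_ring W (module_vec TYPE(complex) n)"
    and inv: "\<And>g v. g \<in> carrier G \<Longrightarrow> v \<in> W \<Longrightarrow> \<rho> g *\<^sub>v v \<in> W"
    using W by (auto simp: invariant_subspace_def)
  have Wc: "\<And>v. v \<in> W \<Longrightarrow> v \<in> carrier_vec n" using sub by (auto simp: subspace_vec_iff)
  obtain k L R where fr: "subspace_frame n k W L R" and cov: "\<And>w. w \<in> W \<Longrightarrow> L *\<^sub>v (R *\<^sub>v w) = w"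
    using subspace_frame_exists[OF sub] by blast
  have L: "L \<in> carrier_mat n k" and R: "R \<in> carrier_mat k n" and RL: "R * L = 1\<^sub>m k"
    and LW: "\<And>v. v \<in> carrier_vec k \<Longrightarrow> L *\<^sub>v v \<in> W"
    using fr by (auto simp: subspace_frame_def)
  define F where "F = 1\<^sub>m n - L * R"
  have E: "L * R \<in> carrier_mat n n" using L R by auto
  have F: "F \<in> carrier_mat n n" unfolding F_def using E by (intro minus_carrier_mat)
  have Fv: "F *\<^sub>v v = v - L *\<^sub>v (R *\<^sub>v v)" if v: "v \<in> carrier_vec n" for v
    unfolding F_def using minus_mult_distrib_mat_vec[OF one_carrier_mat E v] v
    by (simp add: assoc_mult_mat_vec[OF L R v])
  have FW: "F *\<^sub>v w = 0\<^sub>v n" if "w \<in> W" for w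
    using Fv[OF Wc[OF that]] cov[OF that] Wc[OF that] by simp
  define U where "U = {v \<in> carrier_vec n. L *\<^sub>v (R *\<^sub>v v) = 0\<^sub>v n}"
  have Uiff: "v \<in> U \<longleftrightarrow> v \<in> carrier_vec n \<and> (L * R) *\<^sub>v v = 0\<^sub>v n" for v
    using assoc_mult_mat_vec[OF L R] by (auto simp: U_def)
  have Usub: "VectorSpace.subspace class_ring U (module_vec TYPE(complex) n)"
    unfolding subspace_vec_iff Ball_def Uiff using E
    by (auto simp: Uiff mult_mat_zero_vec[OF E] mult_add_distrib_mat_vec[OF E] mult_mat_vec[OF E])
  have FU: "F *\<^sub>v v \<in> U" if v: "v \<in> carrier_vec n" for v
  proof -
    have LRv: "L *\<^sub>v (R *\<^sub>v v) \<in> W" using LW R v by auto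
    then have c: "L *\<^sub>v (R *\<^sub>v v) \<in> carrier_vec n" by (rule Wc)
    have "(L * R) *\<^sub>v (v - L *\<^sub>v (R *\<^sub>v v)) = (L * R) *\<^sub>v v - (L * R) *\<^sub>v (L *\<^sub>v (R *\<^sub>v v))"
      by (rule mult_minus_distrib_mat_vec[OF E v c])
    also have "\<dots> = 0\<^sub>v n"
      using cov[OF LRv] c by (simp add: assoc_mult_mat_vec[OF L R v] assoc_mult_mat_vec[OF L R c])
    finally show ?thesis using F v c by (simp add: Uiff Fv)
  qed
  have UF: "F *\<^sub>v u = u" if "u \<in> U" for u
    using that Fv[of u] by (auto simp: U_def)
  obtain m L' R' where fr': "subspace_frame n m U L' R'" and cov': "\<And>w. w \<in> U \<Longrightarrow> L' *\<^sub>v (R' *\<^sub>v w) = w"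
    using subspace_frame_exists[OF Usub] by blast
  have L': "L' \<in> carrier_mat n m" and R': "R' \<in> carrier_mat m n" and RL': "R' * L' = 1\<^sub>m m"
    and LU: "\<And>v. v \<in> carrier_vec m \<Longrightarrow> L' *\<^sub>v v \<in> U"
    using fr' by (auto simp: subspace_frame_def)
  have Uc: "\<And>v. v \<in> U \<Longrightarrow> v \<in> carrier_vec n" by (auto simp: U_def)
  have R'F: "R' * F \<in> carrier_mat m n" using R' F by auto
  have R'Fv: "(R' * F) *\<^sub>v v = R' *\<^sub>v (F *\<^sub>v v)" if "v \<in> carrier_vec n" for v
    by (rule assoc_mult_mat_vec[OF R' F that])
  have R'FL': "R' * F * L' = 1\<^sub>m m"
  proof (rule mat_eqI_mult_vec)
    fix v :: "complex vec" assume v: "v \<in> carrier_vec m"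
    have "(R' * F * L') *\<^sub>v v = (R' * F) *\<^sub>v (L' *\<^sub>v v)" by (rule assoc_mult_mat_vec[OF R'F L' v])
    also have "\<dots> = R' *\<^sub>v (L' *\<^sub>v v)" by (simp only: R'Fv[OF Uc[OF LU[OF v]]] UF[OF LU[OF v]])
    also have "\<dots> = (R' * L') *\<^sub>v v" by (rule assoc_mult_mat_vec[OF R' L' v, symmetric])
    finally show "(R' * F * L') *\<^sub>v v = 1\<^sub>m m *\<^sub>v v" by (simp only: RL')
  qed (use R'F L' in auto)
  have L'R'F: "L' * (R' * F) = F"
  proof (rule mat_eqI_mult_vec)
    fix v :: "complex vec" assume v: "v \<in> carrier_vec n"
    have "(L' * (R' * F)) *\<^sub>v v = L' *\<^sub>v ((R' * F) *\<^sub>v v)" by (rule assoc_mult_mat_vec[OF L' R'F v])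
    also have "\<dots> = F *\<^sub>v v" by (simp only: R'Fv[OF v] cov'[OF FU[OF v]])
    finally show "(L' * (R' * F)) *\<^sub>v v = F *\<^sub>v v" .
  qed (use L' R'F F in auto)
  have rep1: "matrix_rep G k (\<lambda>g. R * \<rho> g * L)"
    and tr1: "\<And>g. g \<in> carrier G \<Longrightarrow> mat_trace (R * \<rho> g * L) = mat_trace (\<rho> g * (L * R))"
    using matrix_rep_compress[OF rep L R RL] cov inv LW by auto
  have skip: "(R' * F) *\<^sub>v (\<rho> g *\<^sub>v (L' *\<^sub>v ((R' * F) *\<^sub>v y))) = (R' * F) *\<^sub>v (\<rho> g *\<^sub>v y)"
    if g: "g \<in> carrier G" and y: "y \<in> carrier_vec n" for g y
  proof -
    have c: "L *\<^sub>v (R *\<^sub>v y) \<in> W" using LW R y by auto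
    have gy: "\<rho> g *\<^sub>v y \<in> carrier_vec n" and gc: "\<rho> g *\<^sub>v (L *\<^sub>v (R *\<^sub>v y)) \<in> W"
      using rc[OF g] y inv[OF g c] by auto
    have "L' *\<^sub>v ((R' * F) *\<^sub>v y) = F *\<^sub>v y" by (simp only: R'Fv[OF y] cov'[OF FU[OF y]])
    then have "\<rho> g *\<^sub>v (L' *\<^sub>v ((R' * F) *\<^sub>v y)) = \<rho> g *\<^sub>v y - \<rho> g *\<^sub>v (L *\<^sub>v (R *\<^sub>v y))"
      using mult_minus_distrib_mat_vec[OF rc[OF g] y Wc[OF c]] Fv[OF y] by simp
    also have "(R' * F) *\<^sub>v \<dots> = (R' * F) *\<^sub>v (\<rho> g *\<^sub>v y) - (R' * F) *\<^sub>v (\<rho> g *\<^sub>v (L *\<^sub>v (R *\<^sub>v y)))"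
      by (rule mult_minus_distrib_mat_vec[OF R'F gy Wc[OF gc]])
    also have "(R' * F) *\<^sub>v (\<rho> g *\<^sub>v (L *\<^sub>v (R *\<^sub>v y))) = 0\<^sub>v m"
      by (simp only: R'Fv[OF Wc[OF gc]] FW[OF gc] mult_mat_zero_vec[OF R'])
    finally show ?thesis using R'F gy by simp
  qed
  have L'c: "L' *\<^sub>v v \<in> carrier_vec n" if "v \<in> carrier_vec m" for v using L' that by auto
  have rep2: "matrix_rep G m (\<lambda>g. (R' * F) * \<rho> g * L')"
    and tr2: "\<And>g. g \<in> carrier G \<Longrightarrow> mat_trace ((R' * F) * \<rho> g * L') = mat_trace (\<rho> g * F)"
    using matrix_rep_compress[OF rep L' R'F R'FL' skip[OF _ mult_mat_vec_carrier[OF rc L'c]]]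
    unfolding L'R'F by blast+
  have EF: "L * R + F = 1\<^sub>m n" unfolding F_def using L R by (intro eq_matI) auto
  have tr: "mat_trace (\<rho> g) = mat_trace (R * \<rho> g * L) + mat_trace ((R' * F) * \<rho> g * L')"
    if g: "g \<in> carrier G" for g
  proof -
    have "mat_trace (\<rho> g) = mat_trace (\<rho> g * (L * R + F))" using rc[OF g] by (simp add: EF)
    also have "\<dots> = mat_trace (\<rho> g * (L * R)) + mat_trace (\<rho> g * F)"
      unfolding mult_add_distrib_mat[OF rc[OF g] E F]
      by (rule mat_trace_add) (use rc[OF g] E F in auto)
    finally show ?thesis using tr1 tr2 g by simp
  qed
  have "of_nat n = (of_nat k + of_nat m :: complex)"
    using tr[OF one_closed] matrix_repD(3)[OF rep] matrix_repD(3)[OF rep1] matrix_repD(3)[OF rep2]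
    by (simp add: mat_trace_one)
  then have nkm: "n = k + m" by (metis of_nat_add of_nat_eq_iff)
  have "k \<noteq> 0"
  proof
    assume "k = 0"
    then have "L *\<^sub>v (R *\<^sub>v w) = 0\<^sub>v n" for w
      using L R by (intro eq_vecI) (auto simp: scalar_prod_def)
    then have "w = 0\<^sub>v n" if "w \<in> W" for w using cov[OF that] by simp
    then show False using W0 sub by (auto simp: subspace_vec_iff)
  qed
  moreover have "m \<noteq> 0"
  proof
    assume m: "m = 0"
    have "v \<in> W" if v: "v \<in> carrier_vec n" for v
    proof -
      have "L' *\<^sub>v (R' *\<^sub>v (F *\<^sub>v v)) = 0\<^sub>v n"
        using L' R' m by (intro eq_vecI) (auto simp: scalar_prod_def)
      then have 0: "v - L *\<^sub>v (R *\<^sub>v v) = 0\<^sub>v n" using cov'[OF FU[OF v]] Fv[OF v] by simp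
      have c: "L *\<^sub>v (R *\<^sub>v v) \<in> W" using LW R v by auto
      have "v $ i = (L *\<^sub>v (R *\<^sub>v v)) $ i" if "i < n" for i
        using arg_cong[OF 0, of "\<lambda>v. v $ i"] that v L by simp
      then have "v = L *\<^sub>v (R *\<^sub>v v)" using v L by (intro eq_vecI) auto
      then show ?thesis using c by simp
    qed
    then show False using W1 Wc by auto
  qed
  ultimately have "k < n" "m < n" using nkm by auto
  from that[OF this rep1 rep2 tr] show ?thesis .
qed

theorem matrix_rep_trace_decomp:
  assumes "matrix_rep G n \<rho>"
  shows "\<exists>\<psi>s. set \<psi>s \<subseteq> Irr G \<and> (\<forall>g\<in>carrier G. mat_trace (\<rho> g) = (\<Sum>\<psi>\<leftarrow>\<psi>s. \<psi> g))"
  using assms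
proof (induction n arbitrary: \<rho> rule: less_induct)
  case (less n)
  consider "n = 0" | "irreducible_rep G n \<rho>"
    | W where "invariant_subspace n \<rho> W" "W \<noteq> {0\<^sub>v n}" "W \<noteq> carrier_vec n"
    using less.prems by (auto simp: irreducible_rep_iff)
  then show ?case
  proof cases
    case 1
    then have "mat_trace (\<rho> g) = 0" if "g \<in> carrier G" for g
      using matrix_repD(1)[OF less.prems that] by (simp add: mat_trace_def)
    then show ?thesis by (intro exI[of _ "[]"]) auto
  next
    case 2
    then have "rep_character G \<rho> \<in> Irr G" by (auto simp: Irr_def)
    then show ?thesis by (intro exI[of _ "[rep_character G \<rho>]"]) (auto simp: rep_character_def)
  next
    case 3
    obtain k \<sigma> m \<tau> where "k < n" "m < n" "matrix_rep G k \<sigma>" "matrix_rep G m \<tau>"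
      and tr: "\<And>g. g \<in> carrier G \<Longrightarrow> mat_trace (\<rho> g) = mat_trace (\<sigma> g) + mat_trace (\<tau> g)"
      using matrix_rep_split[OF less.prems 3] by metis
    with less.IH obtain xs ys where "set xs \<subseteq> Irr G" "set ys \<subseteq> Irr G"
      "\<forall>g\<in>carrier G. mat_trace (\<sigma> g) = (\<Sum>\<psi>\<leftarrow>xs. \<psi> g)" "\<forall>g\<in>carrier G. mat_trace (\<tau> g) = (\<Sum>\<psi>\<leftarrow>ys. \<psi> g)"
      by meson
    then show ?thesis using tr by (intro exI[of _ "xs @ ys"]) auto
  qed
qed

section \<open>Schur's lemma and orthogonality\<close>

text \<open>
  The kernel and the image of \<open>X\<close> are invariant, so a nonzero \<open>X\<close> is invertible and conjugates
  \<open>\<sigma>\<close> to \<open>\<rho>\<close>. The conclusion speaks of traces because these are what tells irreducible characters apart.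
\<close>
lemma schur_intertwiner:
  assumes \<rho>: "irreducible_rep G n \<rho>" and \<sigma>: "irreducible_rep G m \<sigma>"
    and X: "X \<in> carrier_mat n m" and comm: "\<And>g. g \<in> carrier G \<Longrightarrow> \<rho> g * X = X * \<sigma> g"
    and nz: "X \<noteq> 0\<^sub>m n m" and g: "g \<in> carrier G"
  shows "mat_trace (\<rho> g) = mat_trace (\<sigma> g)"
proof -
  have rep: "matrix_rep G n \<rho>" "matrix_rep G m \<sigma>" using \<rho> \<sigma> by (auto simp: irreducible_rep_iff)
  note rc = matrix_repD(1)[OF rep(1)] and sc = matrix_repD(1)[OF rep(2)]
  have commv: "X *\<^sub>v (\<sigma> g *\<^sub>v v) = \<rho> g *\<^sub>v (X *\<^sub>v v)" if g: "g \<in> carrier G" and v: "v \<in> carrier_vec m" for g v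
    using assoc_mult_mat_vec[OF rc[OF g] X v] assoc_mult_mat_vec[OF X sc[OF g] v] comm[OF g] by simp
  define K where "K = {v \<in> carrier_vec m. X *\<^sub>v v = 0\<^sub>v n}"
  have K: "invariant_subspace m \<sigma> K"
    unfolding invariant_subspace_def subspace_vec_iff K_def using X sc
    by (auto simp: mult_mat_zero_vec[OF X] mult_add_distrib_mat_vec[OF X] mult_mat_vec[OF X] commv
        mult_mat_zero_vec[OF rc] intro!: mult_mat_vec_carrier[OF sc])
  define I where "I = (\<lambda>v. X *\<^sub>v v) ` carrier_vec m"
  have "invariant_subspace n \<rho> I"
    unfolding invariant_subspace_def subspace_vec_iff
  proof (intro conjI ballI allI)
    show "I \<subseteq> carrier_vec n" using X by (auto simp: I_def)
    show "0\<^sub>v n \<in> I" unfolding I_def using mult_mat_zero_vec[OF X] by (metis imageI zero_carrier_vec)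
    show "v + w \<in> I" if "v \<in> I" "w \<in> I" for v w
      using that unfolding I_def by (smt (verit, best) X add_carrier_vec image_iff mult_add_distrib_mat_vec)
    show "c \<cdot>\<^sub>v v \<in> I" if "v \<in> I" for c v
      using that unfolding I_def by (smt (verit, best) X smult_carrier_vec image_iff mult_mat_vec)
    show "\<rho> g *\<^sub>v v \<in> I" if "g \<in> carrier G" "v \<in> I" for g v
      using that unfolding I_def by (auto simp: commv[symmetric] intro!: imageI mult_mat_vec_carrier[OF sc])
  qed
  then have I: "I = {0\<^sub>v n} \<or> I = carrier_vec n" using \<rho> by (auto simp: irreducible_rep_iff)
  have all0: "X = 0\<^sub>m n m" if "\<And>v. v \<in> carrier_vec m \<Longrightarrow> X *\<^sub>v v = 0\<^sub>v n"
    by (rule mat_eqI_mult_vec[OF X zero_carrier_mat])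
      (use that in \<open>auto simp: scalar_prod_def intro!: eq_vecI\<close>)
  have "K \<noteq> carrier_vec m" using all0 nz by (auto simp: K_def)
  then have K0: "K = {0\<^sub>v m}" using K \<sigma> by (auto simp: irreducible_rep_iff)
  have "I \<noteq> {0\<^sub>v n}" using all0 nz by (auto simp: I_def)
  then have "I = carrier_vec n" using I by simp
  then have "\<forall>i. \<exists>v. v \<in> carrier_vec m \<and> X *\<^sub>v v = unit_vec n i"
    unfolding I_def by (smt (verit, best) image_iff unit_vec_carrier)
  then obtain f where f: "\<And>i. f i \<in> carrier_vec m" "\<And>i. X *\<^sub>v f i = unit_vec n i" by metis
  define Y where "Y = mat m n (\<lambda>(p, i). f i $ p)"
  have Y: "Y \<in> carrier_mat m n" by (simp add: Y_def)
  have XY: "X * Y = 1\<^sub>m n"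
  proof (rule eq_matI)
    fix j i assume "j < dim_row (1\<^sub>m n)" "i < dim_col (1\<^sub>m n)"
    then have ji: "j < n" "i < n" by auto
    have "col Y i = f i" using ji f(1)[of i] by (intro eq_vecI) (auto simp: Y_def)
    then have "(X * Y) $$ (j, i) = (X *\<^sub>v f i) $ j" using ji X Y by simp
    then show "(X * Y) $$ (j, i) = 1\<^sub>m n $$ (j, i)" using ji by (simp add: f(2))
  qed (use X Y in auto)
  have YX: "Y * X = 1\<^sub>m m"
  proof (rule mat_eqI_mult_vec)
    fix v :: "complex vec" assume v: "v \<in> carrier_vec m"
    have Xv: "X *\<^sub>v v \<in> carrier_vec n" using X v by auto
    have YXv: "Y *\<^sub>v (X *\<^sub>v v) \<in> carrier_vec m" using Y Xv by auto
    have "X *\<^sub>v (Y *\<^sub>v (X *\<^sub>v v)) = X *\<^sub>v v"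
      using assoc_mult_mat_vec[OF X Y Xv] XY Xv by simp
    then have "Y *\<^sub>v (X *\<^sub>v v) - v \<in> K"
      using mult_minus_distrib_mat_vec[OF X YXv v] X YXv v Xv by (auto simp: K_def)
    then have 0: "Y *\<^sub>v (X *\<^sub>v v) - v = 0\<^sub>v m" using K0 by simp
    have "Y *\<^sub>v (X *\<^sub>v v) = v"
    proof (rule eq_vecI)
      fix i assume "i < dim_vec v"
      then show "(Y *\<^sub>v (X *\<^sub>v v)) $ i = v $ i" using arg_cong[OF 0, of "\<lambda>v. v $ i"] v Y by simp
    qed (use v Y in auto)
    then show "(Y * X) *\<^sub>v v = 1\<^sub>m m *\<^sub>v v" using assoc_mult_mat_vec[OF Y X v] v by simp
  qed (use X Y in auto)
  have sY: "\<sigma> g * Y \<in> carrier_mat m n" using sc[OF g] Y by auto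
  have "mat_trace (\<rho> g) = mat_trace (\<rho> g * (X * Y))" using rc[OF g] by (simp add: XY)
  also have "\<rho> g * (X * Y) = X * (\<sigma> g * Y)"
    using assoc_mult_mat[OF rc[OF g] X Y] comm[OF g] assoc_mult_mat[OF X sc[OF g] Y] by simp
  also have "mat_trace (X * (\<sigma> g * Y)) = mat_trace (\<sigma> g * Y * X)"
    by (rule mat_trace_mult_comm[OF X sY])
  also have "\<dots> = mat_trace (\<sigma> g)" using assoc_mult_mat[OF sc[OF g] Y X] YX sc[OF g] by simp
  finally show ?thesis .
qed

text \<open>
  The eigenspace of \<open>X\<close> for any of its eigenvalues is a nonzero invariant subspace.
\<close>
lemma schur_scalar:
  assumes \<rho>: "irreducible_rep G n \<rho>" and X: "X \<in> carrier_mat n n"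
    and comm: "\<And>g. g \<in> carrier G \<Longrightarrow> \<rho> g * X = X * \<rho> g"
  obtains c where "X = c \<cdot>\<^sub>m 1\<^sub>m n"
proof -
  have rep: "matrix_rep G n \<rho>" and n: "n > 0" using \<rho> by (auto simp: irreducible_rep_iff)
  note rc = matrix_repD(1)[OF rep]
  have commv: "X *\<^sub>v (\<rho> g *\<^sub>v v) = \<rho> g *\<^sub>v (X *\<^sub>v v)" if g: "g \<in> carrier G" and v: "v \<in> carrier_vec n" for g v
    using assoc_mult_mat_vec[OF rc[OF g] X v] assoc_mult_mat_vec[OF X rc[OF g] v] comm[OF g] by simp
  from spectrum_non_empty[OF X n] obtain c v where ev: "eigenvector X v c"
    by (auto simp: spectrum_def eigenvalue_def)
  define W where "W = {v \<in> carrier_vec n. X *\<^sub>v v = c \<cdot>\<^sub>v v}"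
  have "invariant_subspace n \<rho> W"
    unfolding invariant_subspace_def subspace_vec_iff W_def using X rc
    by (auto simp: mult_mat_zero_vec[OF X] mult_add_distrib_mat_vec[OF X] mult_mat_vec[OF X] commv
        mult_mat_vec[OF rc] smult_add_distrib_vec smult_smult_assoc mult.commute
        intro!: mult_mat_vec_carrier[OF rc])
  moreover have "W \<noteq> {0\<^sub>v n}" using ev X by (auto simp: W_def eigenvector_def)
  ultimately have "W = carrier_vec n" using \<rho> by (auto simp: irreducible_rep_iff)
  then have Wv: "X *\<^sub>v v = c \<cdot>\<^sub>v v" if "v \<in> carrier_vec n" for v using that by (auto simp: W_def)
  have "X = c \<cdot>\<^sub>m 1\<^sub>m n"
  proof (rule mat_eqI_mult_vec[OF X])
    fix v :: "complex vec" assume v: "v \<in> carrier_vec n"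
    have "(c \<cdot>\<^sub>m 1\<^sub>m n) *\<^sub>v v = c \<cdot>\<^sub>v v"
      using v by (intro eq_vecI) (auto simp: row_smult smult_scalar_prod_distrib[of _ n])
    then show "X *\<^sub>v v = (c \<cdot>\<^sub>m 1\<^sub>m n) *\<^sub>v v" using Wv[OF v] by simp
  qed auto
  then show ?thesis by (rule that)
qed

lemma sum_translate_left:
  assumes "h \<in> carrier G" shows "(\<Sum>g\<in>carrier G. f (h \<otimes> g)) = (\<Sum>g\<in>carrier G. f g)"
  using assms by (intro sum.reindex_bij_witness[of _ "\<lambda>g. inv h \<otimes> g" "\<lambda>g. h \<otimes> g"]) (auto simp: m_assoc[symmetric])

lemma matrix_rep_index_mult:
  assumes "matrix_rep G n \<rho>" "g \<in> carrier G" "h \<in> carrier G" "i < n" "j < n"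
  shows "\<rho> (g \<otimes> h) $$ (i, j) = (\<Sum>p<n. \<rho> g $$ (i, p) * \<rho> h $$ (p, j))"
  unfolding matrix_repD(2)[OF assms(1-3)]
  by (rule index_mult_mat_sum) (use matrix_repD(1)[OF assms(1)] assms in auto)

text \<open>
  The matrix \<open>A\<close> is the average \<open>\<Sum>\<rho>(g) E \<sigma>(g\<^sup>-\<^sup>1)\<close> of the matrix unit \<open>E\<close> with entry \<open>1\<close> at
  \<open>(k, l)\<close>; translating the summation variable by \<open>h\<close> moves \<open>\<rho>(h)\<close> to the other side.
\<close>
lemma coefficient_average_intertwines:
  assumes \<rho>: "matrix_rep G n \<rho>" and \<sigma>: "matrix_rep G m \<sigma>" and k: "k < n" and l: "l < m"
    and h: "h \<in> carrier G"
  defines "A \<equiv> mat n m (\<lambda>(i, j). \<Sum>g\<in>carrier G. \<rho> g $$ (i, k) * \<sigma> (inv g) $$ (l, j))"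
  shows "\<rho> h * A = A * \<sigma> h"
proof (rule eq_matI)
  have A: "A \<in> carrier_mat n m" by (simp add: A_def)
  note rh = matrix_repD(1)[OF \<rho> h] and sh = matrix_repD(1)[OF \<sigma> h]
  fix i j assume "i < dim_row (A * \<sigma> h)" "j < dim_col (A * \<sigma> h)"
  then have ij: "i < n" "j < m" using A sh by auto
  have "(\<rho> h * A) $$ (i, j) = (\<Sum>p<n. \<Sum>g\<in>carrier G. \<rho> h $$ (i, p) * \<rho> g $$ (p, k) * \<sigma> (inv g) $$ (l, j))"
    unfolding index_mult_mat_sum[OF rh A ij] using ij
    by (intro sum.cong) (auto simp: A_def sum_distrib_left mult.assoc)
  also have "\<dots> = (\<Sum>g\<in>carrier G. \<rho> (h \<otimes> g) $$ (i, k) * \<sigma> (inv (h \<otimes> g) \<otimes> h) $$ (l, j))"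
    using ij k h by (subst sum.swap, intro sum.cong)
      (auto simp: matrix_rep_index_mult[OF \<rho>] sum_distrib_right inv_mult_group m_assoc)
  also have "\<dots> = (\<Sum>g\<in>carrier G. \<rho> g $$ (i, k) * \<sigma> (inv g \<otimes> h) $$ (l, j))"
    by (rule sum_translate_left[OF h, where f = "\<lambda>g. \<rho> g $$ (i, k) * \<sigma> (inv g \<otimes> h) $$ (l, j)"])
  also have "\<dots> = (\<Sum>p<m. \<Sum>g\<in>carrier G. \<rho> g $$ (i, k) * \<sigma> (inv g) $$ (l, p) * \<sigma> h $$ (p, j))"
    using ij l h by (subst sum.swap, intro sum.cong)
      (auto simp: matrix_rep_index_mult[OF \<sigma>] sum_distrib_left mult.assoc)
  also have "\<dots> = (A * \<sigma> h) $$ (i, j)"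
    unfolding index_mult_mat_sum[OF A sh ij] using ij
    by (intro sum.cong) (auto simp: A_def sum_distrib_right)
  finally show "(\<rho> h * A) $$ (i, j) = (A * \<sigma> h) $$ (i, j)" .
qed (use matrix_repD(1)[OF \<rho> h] matrix_repD(1)[OF \<sigma> h] in \<open>auto simp: A_def\<close>)

lemma coefficient_orthogonality_distinct:
  assumes \<rho>: "irreducible_rep G n \<rho>" and \<sigma>: "irreducible_rep G m \<sigma>"
    and ne: "rep_character G \<rho> \<noteq> rep_character G \<sigma>" and ij: "i < n" "k < n" "l < m" "j < m"
  shows "(\<Sum>g\<in>carrier G. \<rho> g $$ (i, k) * \<sigma> (inv g) $$ (l, j)) = 0"
proof -
  have rep: "matrix_rep G n \<rho>" "matrix_rep G m \<sigma>" using \<rho> \<sigma> by (auto simp: irreducible_rep_iff)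
  define A where "A = mat n m (\<lambda>(i, j). \<Sum>g\<in>carrier G. \<rho> g $$ (i, k) * \<sigma> (inv g) $$ (l, j))"
  have "A = 0\<^sub>m n m"
  proof (rule ccontr)
    assume "A \<noteq> 0\<^sub>m n m"
    then have "mat_trace (\<rho> g) = mat_trace (\<sigma> g)" if "g \<in> carrier G" for g
      using schur_intertwiner[OF \<rho> \<sigma> _ _ _ that, of A] coefficient_average_intertwines[OF rep ij(2,3)]
      by (auto simp: A_def)
    then show False using ne unfolding rep_character_def by (metis restrict_ext)
  qed
  then show ?thesis using ij by (auto simp: A_def dest!: arg_cong[of _ _ "\<lambda>A. A $$ (i, j)"])
qed

text \<open>
  The averaged matrix unit is a scalar matrix by Schur's lemma, and its trace
  \<open>\<Sum>(\<rho>(g\<^sup>-\<^sup>1) \<rho>(g))\<^sub>l\<^sub>k\<close> determines the scalar.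
\<close>
lemma coefficient_orthogonality_same:
  assumes \<rho>: "irreducible_rep G n \<rho>" and ij: "i < n" "k < n" "l < n" "j < n"
  shows "(\<Sum>g\<in>carrier G. \<rho> g $$ (i, k) * \<rho> (inv g) $$ (l, j)) =
     (if i = j \<and> k = l then of_nat (Coset.order G) / of_nat n else 0)"
proof -
  have rep: "matrix_rep G n \<rho>" and n: "n > 0" using \<rho> by (auto simp: irreducible_rep_iff)
  define A where "A = mat n n (\<lambda>(i, j). \<Sum>g\<in>carrier G. \<rho> g $$ (i, k) * \<rho> (inv g) $$ (l, j))"
  have A: "A \<in> carrier_mat n n" by (simp add: A_def)
  obtain c where c: "A = c \<cdot>\<^sub>m 1\<^sub>m n"
    using schur_scalar[OF \<rho> A] coefficient_average_intertwines[OF rep rep ij(2,3)] by (auto simp: A_def)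
  have "of_nat n * c = mat_trace A" unfolding mat_trace_carrier[OF A] by (simp add: c)
  also have "\<dots> = (\<Sum>p<n. \<Sum>g\<in>carrier G. \<rho> g $$ (p, k) * \<rho> (inv g) $$ (l, p))"
    unfolding mat_trace_carrier[OF A] by (simp add: A_def)
  also have "\<dots> = (\<Sum>g\<in>carrier G. \<rho> \<one> $$ (l, k))"
  proof (subst sum.swap, rule sum.cong[OF refl])
    fix g assume g: "g \<in> carrier G"
    show "(\<Sum>p<n. \<rho> g $$ (p, k) * \<rho> (inv g) $$ (l, p)) = \<rho> \<one> $$ (l, k)"
      using matrix_rep_index_mult[OF rep inv_closed[OF g] g ij(3,2)] g by (simp add: mult.commute)
  qed
  also have "\<dots> = of_nat (Coset.order G) * (if k = l then 1 else 0)"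
    using ij matrix_repD(3)[OF rep] by (simp add: Coset.order_def)
  finally have "c = (if k = l then of_nat (Coset.order G) / of_nat n else 0)"
    using n by (auto simp: field_simps split: if_splits)
  moreover have "(\<Sum>g\<in>carrier G. \<rho> g $$ (i, k) * \<rho> (inv g) $$ (l, j)) = A $$ (i, j)"
    using ij by (simp add: A_def)
  ultimately show ?thesis using ij by (simp add: c)
qed

section \<open>Irreducible characters\<close>

lemma Irr_obtain_rep:
  assumes "\<psi> \<in> Irr G"
  obtains n \<rho> where "irreducible_rep G n \<rho>" "matrix_rep G n \<rho>" "\<psi> = rep_character G \<rho>" "n > 0" "\<psi> \<one> = of_nat n"
    "\<And>g. g \<in> carrier G \<Longrightarrow> \<psi> g = (\<Sum>i<n. \<rho> g $$ (i, i))"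
proof -
  obtain n \<rho> where \<rho>: "irreducible_rep G n \<rho>" "\<psi> = rep_character G \<rho>"
    using assms by (auto simp: Irr_def)
  have rep: "matrix_rep G n \<rho>" "n > 0" using \<rho> by (auto simp: irreducible_rep_iff)
  have "\<psi> \<one> = of_nat n" using matrix_repD(3)[OF rep(1)] by (simp add: \<rho> rep_character_def mat_trace_one)
  moreover have "\<psi> g = (\<Sum>i<n. \<rho> g $$ (i, i))" if "g \<in> carrier G" for g
    using matrix_repD(1)[OF rep(1) that] that by (simp add: \<rho> rep_character_def mat_trace_carrier)
  ultimately show ?thesis using that \<rho> rep by blast
qed

lemma Irr_degree:
  assumes "\<psi> \<in> Irr G" obtains n :: nat where "n > 0" "\<psi> \<one> = of_nat n"
  using Irr_obtain_rep[OF assms] by metis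

theorem row_orthogonality:
  assumes \<psi>: "\<psi> \<in> Irr G" and \<phi>: "\<phi> \<in> Irr G"
  shows "(\<Sum>g\<in>carrier G. \<psi> g * \<phi> (inv g)) = (if \<psi> = \<phi> then of_nat (Coset.order G) else 0)"
proof (cases "\<psi> = \<phi>")
  case True
  obtain n \<rho> where \<rho>: "irreducible_rep G n \<rho>" "n > 0" "\<And>g. g \<in> carrier G \<Longrightarrow> \<psi> g = (\<Sum>i<n. \<rho> g $$ (i, i))"
    using Irr_obtain_rep[OF \<psi>] by metis
  have "(\<Sum>g\<in>carrier G. \<psi> g * \<psi> (inv g)) = (\<Sum>g\<in>carrier G. \<Sum>i<n. \<Sum>j<n. \<rho> g $$ (i, i) * \<rho> (inv g) $$ (j, j))"
    by (intro sum.cong) (auto simp: \<rho>(3) sum_product)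
  also have "\<dots> = (\<Sum>i<n. \<Sum>j<n. \<Sum>g\<in>carrier G. \<rho> g $$ (i, i) * \<rho> (inv g) $$ (j, j))"
    by (subst sum.swap) (intro sum.cong[OF refl], rule sum.swap)
  also have "\<dots> = (\<Sum>i<n. \<Sum>j<n. if i = j then of_nat (Coset.order G) / of_nat n else 0)"
    by (intro sum.cong) (auto simp: coefficient_orthogonality_same[OF \<rho>(1)])
  also have "\<dots> = of_nat (Coset.order G)" using \<rho>(2) by simp
  finally show ?thesis using True by simp
next
  case False
  obtain n \<rho> where \<rho>: "irreducible_rep G n \<rho>" "\<psi> = rep_character G \<rho>" "\<And>g. g \<in> carrier G \<Longrightarrow> \<psi> g = (\<Sum>i<n. \<rho> g $$ (i, i))"
    using Irr_obtain_rep[OF \<psi>] by metis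
  obtain m \<sigma> where \<sigma>: "irreducible_rep G m \<sigma>" "\<phi> = rep_character G \<sigma>" "\<And>g. g \<in> carrier G \<Longrightarrow> \<phi> g = (\<Sum>i<m. \<sigma> g $$ (i, i))"
    using Irr_obtain_rep[OF \<phi>] by metis
  have "(\<Sum>g\<in>carrier G. \<psi> g * \<phi> (inv g)) = (\<Sum>g\<in>carrier G. \<Sum>i<n. \<Sum>j<m. \<rho> g $$ (i, i) * \<sigma> (inv g) $$ (j, j))"
    by (intro sum.cong) (auto simp: \<rho>(3) \<sigma>(3) sum_product)
  also have "\<dots> = (\<Sum>i<n. \<Sum>j<m. \<Sum>g\<in>carrier G. \<rho> g $$ (i, i) * \<sigma> (inv g) $$ (j, j))"
    by (subst sum.swap) (intro sum.cong[OF refl], rule sum.swap)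
  also have "\<dots> = 0"
    using False coefficient_orthogonality_distinct[OF \<rho>(1) \<sigma>(1)] by (simp add: \<rho>(2) \<sigma>(2))
  finally show ?thesis using False by simp
qed

lemma character_mult_commute:
  assumes \<psi>: "\<psi> \<in> Irr G" and xy: "x \<in> carrier G" "y \<in> carrier G"
  shows "\<psi> (x \<otimes> y) = \<psi> (y \<otimes> x)"
proof -
  obtain n \<rho> where rep: "matrix_rep G n \<rho>" and \<psi>: "\<psi> = rep_character G \<rho>"
    using Irr_obtain_rep[OF \<psi>] by metis
  show ?thesis
    using mat_trace_mult_comm[OF matrix_repD(1)[OF rep xy(1)] matrix_repD(1)[OF rep xy(2)]] xy
    by (simp add: \<psi> rep_character_def matrix_repD(2)[OF rep])
qed

lemma character_conjugate:
  assumes \<psi>: "\<psi> \<in> Irr G" and xy: "x \<in> carrier G" "y \<in> carrier G"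
  shows "\<psi> (x \<otimes> y \<otimes> inv x) = \<psi> y"
  using character_mult_commute[OF \<psi>, of "x \<otimes> y" "inv x"] xy by (simp add: m_assoc[symmetric])

lemma sum_inner_four:
  fixes f :: "_ \<Rightarrow> _ \<Rightarrow> _ \<Rightarrow> _ \<Rightarrow> _ \<Rightarrow> 'c::comm_monoid_add"
  shows "(\<Sum>c\<in>C. \<Sum>p\<in>P. \<Sum>i\<in>I. \<Sum>l\<in>L. \<Sum>k\<in>K. f c p i l k) =
    (\<Sum>p\<in>P. \<Sum>i\<in>I. \<Sum>l\<in>L. \<Sum>k\<in>K. \<Sum>c\<in>C. f c p i l k)"
proof -
  have step: "(\<Sum>c\<in>C. \<Sum>p\<in>P. g c p) = (\<Sum>p\<in>P. h p)"
    if "\<And>p. p \<in> P \<Longrightarrow> (\<Sum>c\<in>C. g c p) = h p" for P and g :: "_ \<Rightarrow> _ \<Rightarrow> 'c" and h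
    using that by (subst sum.swap) simp
  show ?thesis by (rule step, rule step, rule step, rule step, rule refl)
qed

text \<open>
  The sum of \<open>\<rho>(c y c\<^sup>-\<^sup>1)\<close> over \<open>c\<close> is the scalar matrix \<open>|G| \<psi>(y) / \<psi>(1)\<close>. Written out in entries,
  this is the orthogonality of matrix coefficients.
\<close>
theorem character_conjugation_average:
  assumes \<psi>: "\<psi> \<in> Irr G" and xy: "x \<in> carrier G" "y \<in> carrier G"
  shows "\<psi> \<one> * (\<Sum>c\<in>carrier G. \<psi> (x \<otimes> (c \<otimes> y \<otimes> inv c))) = of_nat (Coset.order G) * \<psi> x * \<psi> y"
proof -
  obtain n \<rho> where \<rho>: "irreducible_rep G n \<rho>" and rep: "matrix_rep G n \<rho>" and "\<psi> = rep_character G \<rho>"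
    and n: "n > 0" and d: "\<psi> \<one> = of_nat n"
    and tr: "\<And>g. g \<in> carrier G \<Longrightarrow> \<psi> g = (\<Sum>i<n. \<rho> g $$ (i, i))"
    by (rule Irr_obtain_rep[OF \<psi>], rule that)
  define q :: complex where "q = of_nat (Coset.order G) / of_nat n"
  have "\<psi> (x \<otimes> (c \<otimes> y \<otimes> inv c)) =
      (\<Sum>p<n. \<Sum>i<n. \<Sum>l<n. \<Sum>k<n. \<rho> x $$ (p, i) * \<rho> y $$ (k, l) * (\<rho> c $$ (i, k) * \<rho> (inv c) $$ (l, p)))"
    if c: "c \<in> carrier G" for c
  proof -
    have "\<rho> (c \<otimes> y \<otimes> inv c) $$ (i, p) = (\<Sum>l<n. \<Sum>k<n. \<rho> c $$ (i, k) * \<rho> y $$ (k, l) * \<rho> (inv c) $$ (l, p))"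
      if "i < n" "p < n" for i p
      using that c xy by (simp add: matrix_rep_index_mult[OF rep] sum_distrib_right)
    then have "\<psi> (x \<otimes> (c \<otimes> y \<otimes> inv c)) =
      (\<Sum>p<n. \<Sum>i<n. \<rho> x $$ (p, i) * (\<Sum>l<n. \<Sum>k<n. \<rho> c $$ (i, k) * \<rho> y $$ (k, l) * \<rho> (inv c) $$ (l, p)))"
      using c xy by (simp add: tr matrix_rep_index_mult[OF rep, of x])
    then show ?thesis by (simp add: sum_distrib_left mult_ac)
  qed
  then have "(\<Sum>c\<in>carrier G. \<psi> (x \<otimes> (c \<otimes> y \<otimes> inv c))) =
      (\<Sum>c\<in>carrier G. \<Sum>p<n. \<Sum>i<n. \<Sum>l<n. \<Sum>k<n. \<rho> x $$ (p, i) * \<rho> y $$ (k, l) * (\<rho> c $$ (i, k) * \<rho> (inv c) $$ (l, p)))"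
    by simp
  also have "\<dots> = (\<Sum>p<n. \<Sum>i<n. \<Sum>l<n. \<Sum>k<n. \<rho> x $$ (p, i) * \<rho> y $$ (k, l) *
       (\<Sum>c\<in>carrier G. \<rho> c $$ (i, k) * \<rho> (inv c) $$ (l, p)))"
    unfolding sum_distrib_left by (rule sum_inner_four)
  also have "\<dots> = (\<Sum>p<n. \<Sum>i<n. \<Sum>l<n. \<Sum>k<n. \<rho> x $$ (p, i) * \<rho> y $$ (k, l) * (if i = p \<and> k = l then q else 0))"
    by (intro sum.cong refl) (auto simp: coefficient_orthogonality_same[OF \<rho>] q_def)
  also have "\<dots> = (\<Sum>p<n. \<Sum>i<n. if i = p then \<Sum>l<n. \<rho> x $$ (p, i) * \<rho> y $$ (l, l) * q else 0)"
    by (intro sum.cong refl) (auto simp: if_distrib cong: if_cong)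
  also have "\<dots> = (\<Sum>p<n. \<Sum>l<n. \<rho> x $$ (p, p) * \<rho> y $$ (l, l)) * q"
    by (simp add: sum_distrib_right)
  also have "\<dots> = \<psi> x * \<psi> y * q" using xy by (simp add: tr sum_product)
  finally show ?thesis using n by (simp add: d q_def)
qed

lemma root_of_unity_norm: "(z::complex) ^ k = 1 \<Longrightarrow> k > 0 \<Longrightarrow> norm z = 1"
  by (metis power_eq_1_iff zero_less_iff_neq_zero)

text \<open>
  In triangular form the trace is a sum of \<open>\<psi>(1)\<close> eigenvalues, and these are roots of unity because
  \<open>g\<close> has finite order.
\<close>
theorem character_norm_le_degree:
  assumes \<psi>: "\<psi> \<in> Irr G" and g: "g \<in> carrier G"
  shows "norm (\<psi> g) \<le> Re (\<psi> \<one>)"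
proof -
  obtain n \<rho> where rep: "matrix_rep G n \<rho>" and \<psi>: "\<psi> = rep_character G \<rho>" and d: "\<psi> \<one> = of_nat n"
    using Irr_obtain_rep[OF \<psi>] by metis
  let ?A = "\<rho> g"
  have A: "?A \<in> carrier_mat n n" using matrix_repD(1)[OF rep g] .
  obtain es where es: "char_poly ?A = (\<Prod>a\<leftarrow>es. [:- a, 1:])" "length es = n"
    using char_poly_factorized[OF A] by blast
  obtain B P Q where s: "schur_decomposition ?A es = (B, P, Q)" by (metis prod_cases3)
  then have sim: "similar_mat_wit ?A B P Q" and diag: "diag_mat B = es"
    using schur_decomposition[OF A es(1)] by auto
  note w = similar_mat_witD2[OF A sim]
  have "mat_trace ?A = mat_trace (P * (B * Q))" using w by (simp add: assoc_mult_mat[OF w(6,5,7)])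
  also have "\<dots> = mat_trace (B * Q * P)" by (rule mat_trace_mult_comm[OF w(6)]) (use w in auto)
  also have "B * Q * P = B" using w by (simp add: assoc_mult_mat[OF w(5,7,6)])
  also have "mat_trace B = sum_list es"
    using w(5) by (simp add: diag[symmetric] diag_mat_def mat_trace_def sum_list_sum_nth lessThan_atLeast0)
  finally have "\<psi> g = sum_list es" using g by (simp add: \<psi> rep_character_def)
  moreover have "norm e = 1" if e: "e \<in> set es" for e
  proof -
    have "eigenvalue ?A e" unfolding eigenvalue_root_char_poly[OF A] es(1)
      using e by (auto simp: poly_prod_list prod_list_zero_iff)
    then obtain v where v: "v \<in> carrier_vec n" "v \<noteq> 0\<^sub>v n" "?A *\<^sub>v v = e \<cdot>\<^sub>v v"
      using A by (auto simp: eigenvalue_def eigenvector_def)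
    have pow: "\<rho> (g [^] k) *\<^sub>v v = e ^ k \<cdot>\<^sub>v v" for k :: nat
    proof (induction k)
      case 0
      then show ?case using matrix_repD(3)[OF rep] v by simp
    next
      case (Suc k)
      have gk: "g [^] k \<in> carrier G" using g by simp
      have "\<rho> (g [^] Suc k) *\<^sub>v v = \<rho> (g [^] k) *\<^sub>v (?A *\<^sub>v v)"
        using matrix_repD(2)[OF rep gk g] assoc_mult_mat_vec[OF matrix_repD(1)[OF rep gk] A v(1)] by simp
      also have "\<dots> = e \<cdot>\<^sub>v (\<rho> (g [^] k) *\<^sub>v v)"
        unfolding v(3) by (rule mult_mat_vec[OF matrix_repD(1)[OF rep gk] v(1)])
      finally show ?case by (simp add: Suc.IH smult_smult_assoc)
    qed
    have "g [^] Coset.order G = \<one>" using g by (rule pow_order_eq_1)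
    then have "v = e ^ Coset.order G \<cdot>\<^sub>v v" using pow[of "Coset.order G"] matrix_repD(3)[OF rep] v by simp
    moreover obtain i where "i < n" "v $ i \<noteq> 0" using v by (metis carrier_vecD eq_vecI index_zero_vec)
    ultimately have "e ^ Coset.order G = 1"
      using v(1) by (metis index_smult_vec(1) carrier_vecD mult_cancel_right1)
    then show ?thesis by (rule root_of_unity_norm) (simp add: order_gt_0_iff_finite)
  qed
  moreover have "norm (sum_list xs) \<le> length xs" if "\<And>e. e \<in> set xs \<Longrightarrow> norm e = 1" for xs :: "complex list"
    using that
  proof (induction xs)
    case (Cons a xs)
    then show ?case using norm_triangle_ineq[of a "sum_list xs"] by force
  qed simp
  ultimately show ?thesis using d es(2) by fastforce
qed

lemma trivial_character_Irr: "(\<lambda>g\<in>carrier G. 1) \<in> Irr G"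
proof -
  have "irreducible_rep G 1 (\<lambda>g. 1\<^sub>m 1)" unfolding irreducible_rep_iff
  proof (intro conjI allI impI)
    show "matrix_rep G 1 (\<lambda>g. 1\<^sub>m 1)" by (simp add: matrix_rep_iff)
    fix W assume "invariant_subspace 1 (\<lambda>g. 1\<^sub>m 1) W"
    then have W: "W \<subseteq> carrier_vec 1" "0\<^sub>v 1 \<in> W" "\<And>c v. v \<in> W \<Longrightarrow> c \<cdot>\<^sub>v v \<in> W"
      unfolding invariant_subspace_def subspace_vec_iff by auto
    show "W = {0\<^sub>v 1} \<or> W = carrier_vec 1"
    proof (cases "W \<subseteq> {0\<^sub>v 1}")
      case False
      then obtain v where v: "v \<in> W" "v \<noteq> 0\<^sub>v 1" by auto
      have vc: "v \<in> carrier_vec 1" using v W by auto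
      have v0: "v $ 0 \<noteq> 0"
      proof
        assume "v $ 0 = 0"
        then have "v = 0\<^sub>v 1" using vc by (intro eq_vecI) auto
        then show False using v by simp
      qed
      have "u \<in> W" if u: "u \<in> carrier_vec 1" for u
      proof -
        have "u = (u $ 0 / v $ 0) \<cdot>\<^sub>v v" using u vc v0 by (intro eq_vecI) auto
        then show ?thesis using W(3)[OF v(1)] by metis
      qed
      then show ?thesis using W by auto
    qed (use W in auto)
  qed auto
  moreover have "rep_character G (\<lambda>g. 1\<^sub>m 1) = (\<lambda>g\<in>carrier G. 1)"
    by (simp add: rep_character_def mat_trace_one)
  ultimately show ?thesis unfolding Irr_def by (metis (mono_tags, lifting) mem_Collect_eq)
qed

lemma sum_list_eq_sum_count_list:
  "(\<Sum>x\<leftarrow>xs. f x) = (\<Sum>x\<in>set xs. of_nat (count_list xs x) * f x :: 'c::comm_semiring_1)"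
proof (induction xs)
  case (Cons a xs)
  have "(\<Sum>x\<in>set (a # xs). of_nat (count_list (a # xs) x) * f x) =
      (\<Sum>x\<in>insert a (set xs). of_nat (count_list xs x) * f x + (if x = a then f x else 0))"
    by (intro sum.cong) (auto simp: algebra_simps)
  also have "\<dots> = (\<Sum>x\<in>insert a (set xs). of_nat (count_list xs x) * f x) + f a"
    by (simp add: sum.distrib)
  also have "(\<Sum>x\<in>insert a (set xs). of_nat (count_list xs x) * f x) = (\<Sum>x\<in>set xs. of_nat (count_list xs x) * f x)"
    by (cases "a \<in> set xs") (auto simp: insert_absorb)
  finally show ?case using Cons by (simp add: add.commute)
qed simp

text \<open>
  A list of irreducible characters stands for their sum; the inner product with \<open>\<phi>\<close> counts how often
  \<open>\<phi>\<close> occurs in it.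
\<close>
lemma sum_list_character_inner:
  assumes "set \<psi>s \<subseteq> Irr G" and \<phi>: "\<phi> \<in> Irr G"
  shows "(\<Sum>g\<in>carrier G. (\<Sum>\<psi>\<leftarrow>\<psi>s. \<psi> g) * \<phi> (inv g)) = of_nat (count_list \<psi>s \<phi> * Coset.order G)"
  using assms(1)
proof (induction \<psi>s)
  case (Cons \<psi> \<psi>s)
  then show ?case using row_orthogonality[of \<psi> \<phi>] \<phi>
    by (auto simp: distrib_right sum.distrib)
qed simp

text \<open>
  The mean value of a character is the multiplicity of the trivial character in it. Its
  integrality drives the Sylow argument and the count of commuting pairs below.
\<close>
lemma matrix_rep_trace_mean:
  assumes "matrix_rep G n \<rho>"
  obtains m :: nat where "(\<Sum>g\<in>carrier G. mat_trace (\<rho> g)) = of_nat (m * Coset.order G)"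
proof -
  obtain \<psi>s where \<psi>s: "set \<psi>s \<subseteq> Irr G" "\<forall>g\<in>carrier G. mat_trace (\<rho> g) = (\<Sum>\<psi>\<leftarrow>\<psi>s. \<psi> g)"
    using matrix_rep_trace_decomp[OF assms] by blast
  have "(\<Sum>g\<in>carrier G. mat_trace (\<rho> g)) = (\<Sum>g\<in>carrier G. (\<Sum>\<psi>\<leftarrow>\<psi>s. \<psi> g) * (\<lambda>g\<in>carrier G. 1) (inv g))"
    using \<psi>s by (intro sum.cong) auto
  then show ?thesis
    unfolding sum_list_character_inner[OF \<psi>s(1) trivial_character_Irr] by (rule that)
qed

section \<open>Permutation characters and column orthogonality\<close>

lemma permutation_rep:
  assumes X: "finite X" and closed: "\<And>g x. g \<in> carrier G \<Longrightarrow> x \<in> X \<Longrightarrow> act g x \<in> X"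
    and one: "\<And>x. x \<in> X \<Longrightarrow> act \<one> x = x"
    and mult: "\<And>g h x. g \<in> carrier G \<Longrightarrow> h \<in> carrier G \<Longrightarrow> x \<in> X \<Longrightarrow> act (g \<otimes> h) x = act g (act h x)"
  obtains n \<rho> where "matrix_rep G n \<rho>"
    "\<And>g. g \<in> carrier G \<Longrightarrow> mat_trace (\<rho> g) = of_nat (card {x\<in>X. act g x = x})"
proof -
  obtain e where e: "bij_betw e {..<card X} X"
    using X by (metis ex_bij_betw_nat_finite lessThan_atLeast0)
  have eX: "e i \<in> X" if "i < card X" for i using e that by (auto simp: bij_betw_def)
  have inj: "e i = e j \<longleftrightarrow> i = j" if "i < card X" "j < card X" for i j
    using e that by (auto simp: bij_betw_def inj_on_def)
  define \<rho> where "\<rho> g = mat (card X) (card X) (\<lambda>(i, j). if act g (e j) = e i then 1 else 0 :: complex)" for g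
  have rc: "\<rho> g \<in> carrier_mat (card X) (card X)" for g by (simp add: \<rho>_def)
  have "matrix_rep G (card X) \<rho>" unfolding matrix_rep_iff
  proof (intro conjI ballI rc)
    fix g h assume g: "g \<in> carrier G" and h: "h \<in> carrier G"
    show "\<rho> (g \<otimes> h) = \<rho> g * \<rho> h"
    proof (rule eq_matI)
      fix i j assume "i < dim_row (\<rho> g * \<rho> h)" "j < dim_col (\<rho> g * \<rho> h)"
      then have ij: "i < card X" "j < card X" using rc[of g] rc[of h] by auto
      obtain p where p: "p < card X" "act h (e j) = e p"
        using e closed[OF h eX[OF ij(2)]] by (auto simp: bij_betw_def)
      have "(\<rho> g * \<rho> h) $$ (i, j) = (\<Sum>q<card X. if q = p then (if act g (e q) = e i then 1 else 0) else 0)"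
        unfolding index_mult_mat_sum[OF rc rc ij] using ij p inj by (intro sum.cong) (auto simp: \<rho>_def)
      also have "\<dots> = \<rho> (g \<otimes> h) $$ (i, j)" using ij p mult[OF g h eX[OF ij(2)]] by (simp add: \<rho>_def)
      finally show "\<rho> (g \<otimes> h) $$ (i, j) = (\<rho> g * \<rho> h) $$ (i, j)" ..
    qed (use rc[of g] rc[of h] in \<open>auto simp: \<rho>_def\<close>)
  next
    show "\<rho> \<one> = 1\<^sub>m (card X)" by (rule eq_matI) (auto simp: \<rho>_def one eX inj)
  qed
  moreover have "mat_trace (\<rho> g) = of_nat (card {x\<in>X. act g x = x})" if g: "g \<in> carrier G" for g
  proof -
    have "mat_trace (\<rho> g) = (\<Sum>i<card X. if act g (e i) = e i then 1 else 0)"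
      unfolding mat_trace_carrier[OF rc] by (intro sum.cong) (auto simp: \<rho>_def)
    also have "\<dots> = (\<Sum>x\<in>X. if act g x = x then 1 else 0)"
      by (rule sum.reindex_bij_betw[OF e])
    also have "\<dots> = of_nat (card {x\<in>X. act g x = x})"
      using X by (simp add: sum.If_cases Int_def)
    finally show ?thesis .
  qed
  ultimately show ?thesis by (rule that)
qed

text \<open>
  The regular representation has trace \<open>|G|\<close> at \<open>1\<close> and \<open>0\<close> elsewhere, so its inner product with
  \<open>\<phi>\<close> is \<open>|G| \<phi>(1)\<close>. Hence every irreducible character occurs in its decomposition, with its degree as
  multiplicity; in particular there are finitely many.
\<close>
lemma Irr_finite: "finite (Irr G)" (is ?fin)
  and regular_character: "g \<in> carrier G \<Longrightarrow>
    (\<Sum>\<psi>\<in>Irr G. \<psi> \<one> * \<psi> g) = (if g = \<one> then of_nat (Coset.order G) else 0)" (is "_ \<Longrightarrow> ?sum g")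
proof -
  obtain n \<rho> where rep: "matrix_rep G n \<rho>"
    and tr: "\<And>g. g \<in> carrier G \<Longrightarrow> mat_trace (\<rho> g) = of_nat (card {x\<in>carrier G. g \<otimes> x = x})"
    by (rule permutation_rep[of "carrier G" "\<lambda>g x. g \<otimes> x"]) (auto simp: m_assoc)
  have fix_reg: "card {x\<in>carrier G. g \<otimes> x = x} = (if g = \<one> then Coset.order G else 0)" if g: "g \<in> carrier G" for g
  proof (cases "g = \<one>")
    case True
    then have "{x\<in>carrier G. g \<otimes> x = x} = carrier G" by auto
    then show ?thesis using True by (simp add: Coset.order_def)
  next
    case False
    then have "{x\<in>carrier G. g \<otimes> x = x} = {}" using g by auto
    then show ?thesis using False by simp
  qed
  obtain \<psi>s where \<psi>s: "set \<psi>s \<subseteq> Irr G" "\<And>g. g \<in> carrier G \<Longrightarrow> mat_trace (\<rho> g) = (\<Sum>\<psi>\<leftarrow>\<psi>s. \<psi> g)"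
    using matrix_rep_trace_decomp[OF rep] by blast
  have o: "Coset.order G > 0" by (simp add: order_gt_0_iff_finite)
  have count: "of_nat (count_list \<psi>s \<phi>) = \<phi> \<one>" if \<phi>: "\<phi> \<in> Irr G" for \<phi>
  proof -
    have "of_nat (count_list \<psi>s \<phi> * Coset.order G) = (\<Sum>g\<in>carrier G. (\<Sum>\<psi>\<leftarrow>\<psi>s. \<psi> g) * \<phi> (inv g))"
      by (rule sum_list_character_inner[OF \<psi>s(1) \<phi>, symmetric])
    also have "\<dots> = (\<Sum>g\<in>carrier G. if g = \<one> then of_nat (Coset.order G) * \<phi> \<one> else 0)"
      by (intro sum.cong) (auto simp: \<psi>s(2)[symmetric] tr fix_reg)
    also have "\<dots> = of_nat (Coset.order G) * \<phi> \<one>" by simp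
    finally show ?thesis using o by simp
  qed
  have Irr: "Irr G = set \<psi>s"
  proof
    show "Irr G \<subseteq> set \<psi>s"
    proof
      fix \<phi> assume \<phi>: "\<phi> \<in> Irr G"
      then have "\<phi> \<one> \<noteq> 0" by (metis Irr_degree of_nat_eq_0_iff less_numeral_extra(3))
      then show "\<phi> \<in> set \<psi>s" using count[OF \<phi>] by (metis count_list_0_iff of_nat_0)
    qed
  qed (rule \<psi>s)
  then show ?fin by simp
  show "?sum g" if g: "g \<in> carrier G"
  proof -
    have "(\<Sum>\<psi>\<in>Irr G. \<psi> \<one> * \<psi> g) = (\<Sum>\<psi>\<in>set \<psi>s. of_nat (count_list \<psi>s \<psi>) * \<psi> g)"
      unfolding Irr by (intro sum.cong) (auto simp: count Irr)
    also have "\<dots> = (\<Sum>\<psi>\<leftarrow>\<psi>s. \<psi> g)" by (rule sum_list_eq_sum_count_list[symmetric])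
    also have "\<dots> = (if g = \<one> then of_nat (Coset.order G) else 0)"
      using g by (simp add: \<psi>s(2)[symmetric] tr fix_reg)
    finally show ?thesis .
  qed
qed

text \<open>
  Evaluate the regular character at \<open>x c y\<^sup>-\<^sup>1 c\<^sup>-\<^sup>1\<close>, which is \<open>1\<close> precisely if \<open>x = c y c\<^sup>-\<^sup>1\<close>, and
  sum over \<open>c\<close>; each row contributes \<open>|G| \<psi>(x) \<psi>(y\<^sup>-\<^sup>1)\<close> by \<open>character_conjugation_average\<close>.
\<close>
theorem column_orthogonality:
  assumes x: "x \<in> carrier G" and y: "y \<in> carrier G"
  shows "(\<Sum>\<psi>\<in>Irr G. \<psi> x * \<psi> (inv y)) = of_nat (card {c\<in>carrier G. x = c \<otimes> y \<otimes> inv c})"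
proof -
  have o: "Coset.order G > 0" by (simp add: order_gt_0_iff_finite)
  have eq1: "x \<otimes> (c \<otimes> inv y \<otimes> inv c) = \<one> \<longleftrightarrow> x = c \<otimes> y \<otimes> inv c" if c: "c \<in> carrier G" for c
  proof -
    have "c \<otimes> inv y \<otimes> inv c = inv (c \<otimes> y \<otimes> inv c)" using c y by (simp add: inv_mult_group m_assoc)
    then show ?thesis using c x y by (metis inv_closed inv_equality inv_inv m_closed r_inv)
  qed
  have "of_nat (Coset.order G) * (\<Sum>\<psi>\<in>Irr G. \<psi> x * \<psi> (inv y)) =
      (\<Sum>\<psi>\<in>Irr G. \<psi> \<one> * (\<Sum>c\<in>carrier G. \<psi> (x \<otimes> (c \<otimes> inv y \<otimes> inv c))))"
    unfolding sum_distrib_left[of "of_nat (Coset.order G)"]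
    using character_conjugation_average[OF _ x inv_closed[OF y]] by (intro sum.cong) (simp_all only: mult.assoc)
  also have "\<dots> = (\<Sum>c\<in>carrier G. \<Sum>\<psi>\<in>Irr G. \<psi> \<one> * \<psi> (x \<otimes> (c \<otimes> inv y \<otimes> inv c)))"
    unfolding sum_distrib_left by (rule sum.swap)
  also have "\<dots> = (\<Sum>c\<in>carrier G. if x = c \<otimes> y \<otimes> inv c then of_nat (Coset.order G) else 0)"
    using x y by (intro sum.cong) (auto simp: regular_character eq1)
  also have "\<dots> = of_nat (Coset.order G) * of_nat (card {c\<in>carrier G. x = c \<otimes> y \<otimes> inv c})"
    by (simp add: sum.If_cases Int_def)
  finally show ?thesis using o by simp
qed

section \<open>Two columns that differ in one row\<close>

lemma finite_submonoid_subgroup: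
  assumes S: "S \<subseteq> carrier G" "\<one> \<in> S" and closed: "\<And>x y. x \<in> S \<Longrightarrow> y \<in> S \<Longrightarrow> x \<otimes> y \<in> S"
  shows "subgroup S G"
proof
  fix x assume x: "x \<in> S"
  then have xc: "x \<in> carrier G" using S by auto
  have pow: "x [^] k \<in> S" for k :: nat by (induction k) (auto simp: S closed x)
  have o: "Coset.order G > 0" by (simp add: order_gt_0_iff_finite)
  have "x [^] (Coset.order G - 1) \<otimes> x = \<one>"
    using xc o pow_order_eq_1[OF xc] by (metis Suc_pred' nat_pow_Suc)
  then have "inv x = x [^] (Coset.order G - 1)" using xc by (simp add: inv_equality)
  then show "inv x \<in> S" using pow by simp
qed (use assms in auto)

lemma group_center_subgroup: "subgroup (group_center G) G"
proof (rule finite_submonoid_subgroup)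
  fix z w assume z: "z \<in> group_center G" and w: "w \<in> group_center G"
  have zc: "z \<in> carrier G" and wc: "w \<in> carrier G" using z w by (auto simp: group_center_def)
  have "z \<otimes> w \<otimes> g = g \<otimes> (z \<otimes> w)" if g: "g \<in> carrier G" for g
  proof -
    have zg: "z \<otimes> g = g \<otimes> z" and wg: "w \<otimes> g = g \<otimes> w" using z w g by (auto simp: group_center_def)
    have "z \<otimes> w \<otimes> g = (z \<otimes> g) \<otimes> w" unfolding m_assoc[OF zc wc g] wg using zc wc g by (simp add: m_assoc)
    then show ?thesis unfolding zg using zc wc g by (simp add: m_assoc)
  qed
  then show "z \<otimes> w \<in> group_center G" using zc wc by (simp add: group_center_def)
qed (auto simp: group_center_def)

lemma character_eq_degreeI:
  assumes \<psi>: "\<psi> \<in> Irr G" and g: "g \<in> carrier G" and re: "Re (\<psi> g) \<ge> Re (\<psi> \<one>)"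
  shows "\<psi> g = \<psi> \<one>"
proof -
  obtain n :: nat where n: "\<psi> \<one> = of_nat n" using Irr_degree[OF \<psi>] by metis
  have nrm: "norm (\<psi> g) \<le> n" using character_norm_le_degree[OF \<psi> g] n by simp
  have Re: "Re (\<psi> g) = n" using complex_Re_le_cmod[of "\<psi> g"] nrm re n by simp
  have "(Re (\<psi> g))\<^sup>2 + (Im (\<psi> g))\<^sup>2 \<le> (real n)\<^sup>2"
    using nrm unfolding cmod_power2[symmetric] by (intro power_mono) auto
  then have "Im (\<psi> g) = 0" using Re by simp
  then show ?thesis using Re n by (simp add: complex_eq_iff)
qed

text \<open>
  The values \<open>\<psi>(x c y c\<^sup>-\<^sup>1)\<close> have real parts at most \<open>\<psi>(1)\<close> and average \<open>\<psi>(x) \<psi>(y) / \<psi>(1) = \<psi>(1)\<close>,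
  so all of them equal \<open>\<psi>(1)\<close>; \<open>c = 1\<close> is the claim.
\<close>
lemma character_kernel_mult:
  assumes \<psi>: "\<psi> \<in> Irr G" and x: "x \<in> carrier G" "\<psi> x = \<psi> \<one>" and y: "y \<in> carrier G" "\<psi> y = \<psi> \<one>"
  shows "\<psi> (x \<otimes> y) = \<psi> \<one>"
proof -
  obtain n :: nat where n: "n > 0" "\<psi> \<one> = of_nat n" using Irr_degree[OF \<psi>] by metis
  let ?f = "\<lambda>c. Re (\<psi> \<one>) - Re (\<psi> (x \<otimes> (c \<otimes> y \<otimes> inv c)))"
  have "(\<Sum>c\<in>carrier G. \<psi> (x \<otimes> (c \<otimes> y \<otimes> inv c))) = of_nat (Coset.order G) * \<psi> \<one>"
    using character_conjugation_average[OF \<psi> x(1) y(1)] n by (simp add: x y)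
  from arg_cong[OF this, of Re] have "(\<Sum>c\<in>carrier G. ?f c) = 0"
    using n by (simp add: sum_subtractf Coset.order_def)
  moreover have nn: "?f c \<ge> 0" if "c \<in> carrier G" for c
  proof -
    have "x \<otimes> (c \<otimes> y \<otimes> inv c) \<in> carrier G" using that x y by simp
    then show ?thesis using character_norm_le_degree[OF \<psi>] complex_Re_le_cmod
      by (metis diff_ge_0_iff_ge order_trans)
  qed
  ultimately have "?f \<one> = 0"
    using sum_nonneg_eq_0_iff[OF finite_carrier, of ?f] one_closed by blast
  then show ?thesis using x y by (intro character_eq_degreeI[OF \<psi>]) auto
qed

text \<open>
  The intersection of the kernels of all irreducible characters other than \<open>\<chi>\<close>. An element of it has
  the column of \<open>1\<close>, up to the row of \<open>\<chi>\<close>.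
\<close>
definition common_kernel_but :: "('a \<Rightarrow> complex) \<Rightarrow> 'a set" where
  "common_kernel_but \<chi> = {g \<in> carrier G. \<forall>\<psi>\<in>Irr G. \<psi> \<noteq> \<chi> \<longrightarrow> \<psi> g = \<psi> \<one>}"

lemma common_kernel_butD:
  assumes "g \<in> common_kernel_but \<chi>"
  shows "g \<in> carrier G" and "\<psi> \<in> Irr G - {\<chi>} \<Longrightarrow> \<psi> g = \<psi> \<one>"
  using assms by (auto simp: common_kernel_but_def)

lemma common_kernel_but_subgroup: "subgroup (common_kernel_but \<chi>) G"
  by (rule finite_submonoid_subgroup) (auto simp: common_kernel_but_def character_kernel_mult)

lemma common_kernel_but_conj:
  "x \<in> common_kernel_but \<chi> \<Longrightarrow> c \<in> carrier G \<Longrightarrow> c \<otimes> x \<otimes> inv c \<in> common_kernel_but \<chi>"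
  by (auto simp: common_kernel_but_def character_conjugate)

lemma columns_differ_only_at_one_iff:
  "columns_differ_only_at G \<one> b \<chi> \<longleftrightarrow> \<chi> \<in> Irr G \<and> b \<in> common_kernel_but \<chi> \<and> b \<noteq> \<one> \<and> \<chi> b \<noteq> \<chi> \<one>"
proof -
  have "conjugate_in G \<one> b \<longleftrightarrow> b = \<one>" by (auto simp: conjugate_in_def)
  then show ?thesis by (auto simp: columns_differ_only_at_def common_kernel_but_def eq_commute)
qed

lemma sum_Irr_remove:
  assumes "\<chi> \<in> Irr G"
  shows "(\<Sum>\<psi>\<in>Irr G. f \<psi>) = f \<chi> + (\<Sum>\<psi>\<in>Irr G - {\<chi>}. f \<psi>)"
  using Irr_finite assms by (rule sum.remove)

lemma sum_square_degrees_but: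
  assumes "\<chi> \<in> Irr G"
  shows "(\<Sum>\<psi>\<in>Irr G - {\<chi>}. \<psi> \<one> * \<psi> \<one>) = of_nat (Coset.order G) - \<chi> \<one> * \<chi> \<one>"
  using regular_character[OF one_closed] sum_Irr_remove[OF assms, of "\<lambda>\<psi>. \<psi> \<one> * \<psi> \<one>"]
  by (simp add: eq_diff_eq add.commute)

text \<open>
  Compare the values of the regular character at \<open>1\<close> and at \<open>g\<close>.
\<close>
lemma common_kernel_but_value:
  assumes \<chi>: "\<chi> \<in> Irr G" and g: "g \<in> common_kernel_but \<chi>" "g \<noteq> \<one>"
  shows "\<chi> \<one> * (\<chi> \<one> - \<chi> g) = of_nat (Coset.order G)"
proof -
  have "(\<Sum>\<psi>\<in>Irr G - {\<chi>}. \<psi> \<one> * \<psi> g) = (\<Sum>\<psi>\<in>Irr G - {\<chi>}. \<psi> \<one> * \<psi> \<one>)"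
    by (simp add: common_kernel_butD(2)[OF g(1)])
  then have "\<chi> \<one> * \<chi> g + (of_nat (Coset.order G) - \<chi> \<one> * \<chi> \<one>) = 0"
    using regular_character[of g] sum_Irr_remove[OF \<chi>, of "\<lambda>\<psi>. \<psi> \<one> * \<psi> g"] sum_square_degrees_but[OF \<chi>] g
    by (auto simp: common_kernel_but_def)
  then show ?thesis by (simp add: algebra_simps)
qed

text \<open>
  By \<open>common_kernel_but_value\<close>, \<open>\<chi>\<close> takes the same value at \<open>b\<close>, \<open>x\<close> and \<open>y\<^sup>-\<^sup>1\<close>. The right-hand side
  is therefore the product of the columns of \<open>x\<close> and \<open>y\<^sup>-\<^sup>1\<close>.
\<close>
lemma common_kernel_but_conjugators:
  assumes \<chi>: "\<chi> \<in> Irr G" and b: "b \<in> common_kernel_but \<chi>" "b \<noteq> \<one>"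
    and x: "x \<in> common_kernel_but \<chi>" "x \<noteq> \<one>" and y: "y \<in> common_kernel_but \<chi>" "y \<noteq> \<one>"
  shows "of_nat (card {c\<in>carrier G. x = c \<otimes> y \<otimes> inv c}) = of_nat (Coset.order G) - \<chi> \<one> * \<chi> \<one> + \<chi> b * \<chi> b"
proof -
  interpret K: subgroup "common_kernel_but \<chi>" G by (rule common_kernel_but_subgroup)
  obtain n :: nat where n: "n > 0" "\<chi> \<one> = of_nat n" using Irr_degree[OF \<chi>] by metis
  have \<chi>b: "\<chi> g = \<chi> b" if "g \<in> common_kernel_but \<chi>" "g \<noteq> \<one>" for g
  proof -
    have "\<chi> \<one> * (\<chi> \<one> - \<chi> g) = \<chi> \<one> * (\<chi> \<one> - \<chi> b)"
      using common_kernel_but_value[OF \<chi> that] common_kernel_but_value[OF \<chi> b] by simp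
    then show ?thesis using n by simp
  qed
  have xc: "x \<in> carrier G" and yc: "y \<in> carrier G" using x y by auto
  have iy: "inv y \<in> common_kernel_but \<chi>" "inv y \<noteq> \<one>" using y yc by (auto simp: inv_eq_1_iff)
  have "(\<Sum>\<psi>\<in>Irr G - {\<chi>}. \<psi> x * \<psi> (inv y)) = (\<Sum>\<psi>\<in>Irr G - {\<chi>}. \<psi> \<one> * \<psi> \<one>)"
    by (simp add: common_kernel_butD(2)[OF x(1)] common_kernel_butD(2)[OF iy(1)])
  then have "(\<Sum>\<psi>\<in>Irr G. \<psi> x * \<psi> (inv y)) = \<chi> b * \<chi> b + (of_nat (Coset.order G) - \<chi> \<one> * \<chi> \<one>)"
    unfolding sum_Irr_remove[OF \<chi>] sum_square_degrees_but[OF \<chi>] \<chi>b[OF x] \<chi>b[OF iy] by simp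
  then show ?thesis unfolding column_orthogonality[OF xc yc] by simp
qed

lemma last_character_degree_unique:
  assumes "last_character G \<chi>" "last_character G \<chi>'" shows "\<chi> \<one> = \<chi>' \<one>"
proof -
  obtain n m :: nat where "\<chi> \<one> = of_nat n" "\<chi>' \<one> = of_nat m"
    using assms Irr_degree by (metis last_character_def)
  moreover have "Re (\<chi> \<one>) = Re (\<chi>' \<one>)" using assms by (auto simp: last_character_def intro: antisym)
  ultimately show ?thesis by simp
qed

text \<open>
  The degree is the largest one, and \<open>common_kernel_but_value\<close> recovers \<open>\<chi>(b)\<close> from it and \<open>|G|\<close>.
\<close>
lemma CD1_data_value_unique:
  assumes "CD1_data G \<chi> b" "CD1_data G \<chi>' b'" shows "\<chi>' \<one> = \<chi> \<one>" and "\<chi>' b' = \<chi> b"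
proof -
  show d: "\<chi>' \<one> = \<chi> \<one>" using last_character_degree_unique assms by (auto simp: CD1_data_def)
  have \<chi>: "\<chi> \<in> Irr G" using assms by (auto simp: CD1_data_def columns_differ_only_at_one_iff)
  have "\<chi> \<one> * (\<chi> \<one> - \<chi> b) = \<chi> \<one> * (\<chi> \<one> - \<chi>' b')"
    using assms common_kernel_but_value d by (metis CD1_data_def columns_differ_only_at_one_iff)
  moreover have "\<chi> \<one> \<noteq> 0" using Irr_degree[OF \<chi>] by (metis of_nat_eq_0_iff less_numeral_extra(3))
  ultimately show "\<chi>' b' = \<chi> b" by simp
qed

section \<open>Central type\<close>

text \<open>
  Since \<open>|G| - \<chi>(1)\<^sup>2 + \<chi>(b)\<^sup>2 = |G|\<close>, every group element conjugates every nontrivial element of the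
  common kernel to every other one. For the last claim, compare the products of the column of \<open>z\<close> with
  those of \<open>1\<close> and of \<open>b\<close>.
\<close>
lemma minus_degree_kernel:
  assumes \<chi>: "\<chi> \<in> Irr G" and b: "b \<in> common_kernel_but \<chi>" "b \<noteq> \<one>" and bm: "\<chi> b = - \<chi> \<one>"
  shows "c \<in> carrier G \<Longrightarrow> c \<otimes> b \<otimes> inv c = b" and "inv b = b"
    and "z \<in> carrier G \<Longrightarrow> z \<noteq> \<one> \<Longrightarrow> z \<noteq> b \<Longrightarrow> \<chi> z = 0"
proof -
  interpret K: subgroup "common_kernel_but \<chi>" G by (rule common_kernel_but_subgroup)
  obtain n :: nat where n: "n > 0" "\<chi> \<one> = of_nat n" using Irr_degree[OF \<chi>] by metis
  have bc: "b \<in> carrier G" using b by auto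
  have all: "x = c \<otimes> y \<otimes> inv c"
    if xy: "x \<in> common_kernel_but \<chi>" "x \<noteq> \<one>" "y \<in> common_kernel_but \<chi>" "y \<noteq> \<one>" and c: "c \<in> carrier G" for x y c
  proof -
    have "of_nat (card {c\<in>carrier G. x = c \<otimes> y \<otimes> inv c}) = (of_nat (card (carrier G)) :: complex)"
      using common_kernel_but_conjugators[OF \<chi> b xy] bm by (simp add: Coset.order_def)
    then have "card {c\<in>carrier G. x = c \<otimes> y \<otimes> inv c} = card (carrier G)" by (simp only: of_nat_eq_iff)
    then have "{c\<in>carrier G. x = c \<otimes> y \<otimes> inv c} = carrier G"
      by (intro card_subset_eq) auto
    then show ?thesis using c by blast
  qed
  show cb: "c \<otimes> b \<otimes> inv c = b" if "c \<in> carrier G" for c using all[OF b b that] by simp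
  show ib: "inv b = b"
    using all[OF K.m_inv_closed[OF b(1)] _ b one_closed] b bc by (auto simp: inv_eq_1_iff)
  show "\<chi> z = 0" if z: "z \<in> carrier G" "z \<noteq> \<one>" "z \<noteq> b"
  proof -
    have "{c\<in>carrier G. z = c \<otimes> b \<otimes> inv c} = {}" using cb z by auto
    then have "(\<Sum>\<psi>\<in>Irr G. \<psi> z * \<psi> b) = 0"
      using column_orthogonality[OF z(1) bc] ib by simp
    moreover have "(\<Sum>\<psi>\<in>Irr G. \<psi> z * \<psi> \<one>) = 0"
      using regular_character[OF z(1)] z by (simp add: mult.commute)
    moreover have "(\<Sum>\<psi>\<in>Irr G - {\<chi>}. \<psi> z * \<psi> b) = (\<Sum>\<psi>\<in>Irr G - {\<chi>}. \<psi> z * \<psi> \<one>)"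
      by (simp add: common_kernel_butD(2)[OF b(1)])
    ultimately have "\<chi> z * \<chi> b + (\<Sum>\<psi>\<in>Irr G - {\<chi>}. \<psi> z * \<psi> \<one>) =
        \<chi> z * \<chi> \<one> + (\<Sum>\<psi>\<in>Irr G - {\<chi>}. \<psi> z * \<psi> \<one>)"
      unfolding sum_Irr_remove[OF \<chi>] by simp
    then have "\<chi> z * \<chi> b = \<chi> z * \<chi> \<one>" by (rule add_right_imp_eq)
    then show ?thesis using bm n by simp
  qed
qed

lemma restrict_matrix_rep:
  assumes "matrix_rep G n \<rho>" "subgroup P G"
  shows "matrix_rep (G\<lparr>carrier := P\<rparr>) n \<rho>"
proof -
  interpret H: group "G\<lparr>carrier := P\<rparr>" by (rule subgroup.subgroup_is_group[OF assms(2) is_group])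
  interpret H: finite_group "G\<lparr>carrier := P\<rparr>"
    by unfold_locales (use assms(2) finite_subset[OF subgroup.subset finite_carrier] in auto)
  show ?thesis
    unfolding H.matrix_rep_iff using assms subgroup.mem_carrier by (fastforce simp: matrix_rep_iff)
qed

lemma power_of_two_if:
  assumes "n > 0" and "\<And>p. prime p \<Longrightarrow> p dvd n \<Longrightarrow> p = 2" shows "\<exists>k. (n::nat) = 2 ^ k"
proof -
  obtain m where m: "n = 2 ^ multiplicity 2 n * m" "\<not> 2 dvd m"
    using multiplicity_decompose'[of n 2] assms(1) by auto
  have "m = 1"
  proof (rule ccontr)
    assume "m \<noteq> 1"
    then obtain p where p: "prime p" "p dvd m" by (metis prime_factor_nat)
    then have "p = 2" using assms(2) m(1) by (metis dvd_mult)
    then show False using p m by simp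
  qed
  then show ?thesis using m by auto
qed

text \<open>
  The element \<open>b\<close> has order \<open>2\<close>, so it lies in no subgroup \<open>P\<close> of odd order. Hence the sum of \<open>\<chi>\<close> over
  a Sylow subgroup \<open>P\<close> at an odd prime is \<open>n = \<chi>(1)\<close>, a multiple of \<open>|P|\<close>; then \<open>|P|\<^sup>2\<close> divides
  \<open>|G| = 2 n\<^sup>2\<close>.
\<close>
theorem minus_degree_imp_central_type:
  assumes \<chi>: "\<chi> \<in> Irr G" and b: "b \<in> common_kernel_but \<chi>" "b \<noteq> \<one>" and bm: "\<chi> b = - \<chi> \<one>"
  shows "two_group G" and "central_type G" and "card (group_center G) = 2"
proof -
  obtain n \<rho> where rep: "matrix_rep G n \<rho>" and n: "n > 0" "\<chi> \<one> = of_nat n" and \<chi>\<rho>: "\<chi> = rep_character G \<rho>"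
    using Irr_obtain_rep[OF \<chi>] by metis
  note facts = minus_degree_kernel[OF \<chi> b bm]
  have bc: "b \<in> carrier G" using b by (auto simp: common_kernel_but_def)
  have "of_nat (Coset.order G) = (of_nat n * (of_nat n + of_nat n) :: complex)"
    unfolding common_kernel_but_value[OF \<chi> b, symmetric] by (simp add: bm n(2))
  also have "\<dots> = of_nat (2 * n\<^sup>2)" by (simp add: power2_eq_square algebra_simps)
  finally have "of_nat (Coset.order G) = (of_nat (2 * n\<^sup>2) :: complex)" .
  then have ord: "Coset.order G = 2 * n\<^sup>2" by (simp only: of_nat_eq_iff)
  have bcomm: "b \<otimes> g = g \<otimes> b" if g: "g \<in> carrier G" for g
  proof -
    have "b \<otimes> g = (g \<otimes> b \<otimes> inv g) \<otimes> g" by (simp only: facts(1)[OF g])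
    also have "\<dots> = g \<otimes> b" using g bc by (simp add: m_assoc)
    finally show ?thesis .
  qed
  have "group_center G = {\<one>, b}"
  proof
    show "{\<one>, b} \<subseteq> group_center G" using bc bcomm by (auto simp: group_center_def)
    show "group_center G \<subseteq> {\<one>, b}"
    proof
      fix z assume z: "z \<in> group_center G"
      then have zc: "z \<in> carrier G" by (simp add: group_center_def)
      have "z \<otimes> (c \<otimes> inv z \<otimes> inv c) = \<one>" if c: "c \<in> carrier G" for c
      proof -
        have zcm: "z \<otimes> c = c \<otimes> z" using z c by (simp add: group_center_def)
        have "z \<otimes> (c \<otimes> inv z \<otimes> inv c) = z \<otimes> c \<otimes> inv z \<otimes> inv c" using zc c by (simp add: m_assoc)
        also have "\<dots> = \<one>" unfolding zcm using zc c by (simp add: m_assoc)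
        finally show ?thesis .
      qed
      then have "\<chi> \<one> * (of_nat (Coset.order G) * \<chi> \<one>) = of_nat (Coset.order G) * \<chi> z * \<chi> (inv z)"
        using character_conjugation_average[OF \<chi> zc inv_closed[OF zc]] by (simp add: Coset.order_def)
      then have "\<chi> z \<noteq> 0" using n ord by auto
      then show "z \<in> {\<one>, b}" using facts(3)[OF zc] by auto
    qed
  qed
  then show Z: "card (group_center G) = 2" using b(2) by auto
  note Zsub = group_center_subgroup
  have "card (rcosets (group_center G)) * 2 = Coset.order G" using lagrange[OF Zsub] Z by simp
  then have "of_nat (card (rcosets (group_center G))) = (\<chi> \<one>)\<^sup>2" using ord n by simp
  then show "central_type G" using \<chi> by (auto simp: central_type_def)
  have only2: "p = 2" if p: "prime p" "p dvd Coset.order G" for p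
  proof (rule ccontr)
    assume p2: "p \<noteq> 2"
    have "Coset.order G \<noteq> 0" by (simp add: order_gt_0_iff_finite)
    moreover have "\<not> is_unit p" using p(1) by (simp add: prime_nat_iff)
    ultimately obtain m e where m: "Coset.order G = p ^ e * m" "\<not> p dvd m"
      using multiplicity_decompose' by blast
    have e: "e > 0" using p(2) m by (cases "e = 0") simp_all
    obtain P where P: "subgroup P G" "card P = p ^ e"
      using sylow_thm[OF p(1) is_group m(1) finite_carrier] by blast
    interpret P: subgroup P G by (rule P)
    have "odd (card P)" using prime_ge_2_nat[OF p(1)] prime_odd_nat[OF p(1)] p2 P(2) by simp
    interpret HP: group "G\<lparr>carrier := P\<rparr>" by (rule P.subgroup_is_group[OF is_group])
    interpret HP: finite_group "G\<lparr>carrier := P\<rparr>"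
      by unfold_locales (use finite_subset[OF P.subset finite_carrier] in auto)
    have bP: "b \<notin> P"
    proof
      assume bP: "b \<in> P"
      have "b [^] card P = \<one>"
        using HP.pow_order_eq_1[of b] bP by (simp add: Coset.order_def nat_pow_consistent[symmetric])
      moreover obtain k where "card P = 2 * k + 1" using \<open>odd (card P)\<close> by (rule oddE)
      moreover have "b \<otimes> b = \<one>" using l_inv[OF bc] facts(2) by simp
      then have "b [^] (2::nat) = \<one>" using bc by (simp add: numeral_2_eq_2)
      then have "b [^] (2 * k) = \<one>" using bc by (metis nat_pow_one nat_pow_pow)
      ultimately show False using bc b by simp
    qed
    have rP: "matrix_rep (G\<lparr>carrier := P\<rparr>) n \<rho>" by (rule restrict_matrix_rep[OF rep P(1)])
    obtain l where l: "(\<Sum>g\<in>P. mat_trace (\<rho> g)) = of_nat (l * card P)"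
      using HP.matrix_rep_trace_mean[OF rP] by (auto simp: Coset.order_def)
    have "(\<Sum>g\<in>P. mat_trace (\<rho> g)) = (\<Sum>g\<in>P. if g = \<one> then of_nat n else 0)"
    proof (rule sum.cong[OF refl])
      fix g assume g: "g \<in> P"
      then have "mat_trace (\<rho> g) = \<chi> g" by (simp add: \<chi>\<rho> rep_character_def)
      then show "mat_trace (\<rho> g) = (if g = \<one> then of_nat n else 0)"
        using facts(3)[of g] g bP n by auto
    qed
    also have "\<dots> = of_nat n" using finite_subset[OF P.subset finite_carrier] by simp
    finally have "n = l * p ^ e" using l P by (metis of_nat_eq_iff)
    then have "p ^ e * m = p ^ e * (p ^ e * (2 * l\<^sup>2))"
      using ord unfolding m(1) by (simp add: power2_eq_square ac_simps)
    then have "m = p ^ e * (2 * l\<^sup>2)" using p by (simp add: prime_gt_0_nat)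
    then show False using m(2) e by (metis dvd_mult2 dvd_power)
  qed
  show "two_group G"
    unfolding two_group_def
    by (rule power_of_two_if[OF _ only2]) (simp add: order_gt_0_iff_finite)
qed

lemma sum_attained_imp_singleton:
  fixes f :: "'c \<Rightarrow> nat"
  assumes "finite S" "x \<in> S" "sum f S = f x" "\<And>y. y \<in> S \<Longrightarrow> f y > 0"
  shows "S = {x}"
proof -
  have "sum f (S - {x}) = 0" using assms sum.remove[of S x f] by simp
  then have "S - {x} = {}" using assms by (metis DiffD1 all_not_in_conv finite_Diff less_numeral_extra(3) sum_eq_0_iff)
  then show ?thesis using assms by auto
qed

text \<open>
  The central involution \<open>z\<close> acts by \<open>\<plusminus>1\<close> in each irreducible representation. The rows with \<open>+\<close> and
  those with \<open>-\<close> have the same square sum of degrees, namely \<open>\<chi>(1)\<^sup>2\<close>; so the part that contains \<open>\<chi>\<close>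
  consists of \<open>\<chi>\<close> alone.
\<close>
theorem central_type_imp_CD1:
  assumes ct: "central_type G" and Z: "card (group_center G) = 2" and o: "Coset.order G > 2"
  shows "\<exists>\<chi> b. CD1_data G \<chi> b \<and> \<chi> b = - \<chi> \<one>"
proof -
  obtain \<chi> where \<chi>: "\<chi> \<in> Irr G" and index: "of_nat (card (rcosets (group_center G))) = (\<chi> \<one>)\<^sup>2"
    using ct by (auto simp: central_type_def)
  define d where "d \<psi> = (SOME n. \<psi> \<one> = of_nat n)" for \<psi> :: "'a \<Rightarrow> complex"
  have d: "\<psi> \<one> = of_nat (d \<psi>)" "d \<psi> > 0" if \<psi>: "\<psi> \<in> Irr G" for \<psi>
  proof -
    obtain n where n: "n > 0" "\<psi> \<one> = of_nat n" using Irr_degree[OF \<psi>] by metis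
    then have "d \<psi> = n" by (auto simp: d_def)
    with n show "\<psi> \<one> = of_nat (d \<psi>)" "d \<psi> > 0" by auto
  qed
  note Zsub = group_center_subgroup
  have "of_nat (card (rcosets (group_center G))) = (of_nat ((d \<chi>)\<^sup>2) :: complex)"
    using index d(1)[OF \<chi>] by simp
  then have "card (rcosets (group_center G)) = (d \<chi>)\<^sup>2" by (simp only: of_nat_eq_iff)
  then have ord: "Coset.order G = 2 * (d \<chi>)\<^sup>2" using lagrange[OF Zsub] Z by simp
  obtain z where z: "group_center G = {\<one>, z}" "z \<noteq> \<one>"
  proof -
    obtain u v where uv: "group_center G = {u, v}" "u \<noteq> v" using Z by (auto simp: card_2_iff)
    have "\<one> \<in> {u, v}" using subgroup.one_closed[OF Zsub] uv(1) by simp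
    then show ?thesis using that[of u] that[of v] uv by auto
  qed
  have zZ: "z \<in> group_center G" using z by simp
  then have zc: "z \<in> carrier G" and zcomm: "\<And>g. g \<in> carrier G \<Longrightarrow> z \<otimes> g = g \<otimes> z"
    by (auto simp: group_center_def)
  have zz: "z \<otimes> z = \<one>"
  proof -
    have "z \<otimes> z \<in> {\<one>, z}" using subgroup.m_closed[OF Zsub zZ zZ] z by simp
    then show ?thesis using z(2) zc by auto
  qed
  have pm: "\<psi> z = \<psi> \<one> \<or> \<psi> z = - \<psi> \<one>" if \<psi>: "\<psi> \<in> Irr G" for \<psi>
  proof -
    have "z \<otimes> (c \<otimes> z \<otimes> inv c) = \<one>" if c: "c \<in> carrier G" for c
    proof -
      have "c \<otimes> z \<otimes> inv c = z" unfolding zcomm[OF c, symmetric] using zc c by (simp add: m_assoc)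
      then show ?thesis using zz by simp
    qed
    then have "\<psi> \<one> * (of_nat (Coset.order G) * \<psi> \<one>) = of_nat (Coset.order G) * \<psi> z * \<psi> z"
      using character_conjugation_average[OF \<psi> zc zc] by (simp add: Coset.order_def)
    then have "\<psi> \<one> * \<psi> \<one> = \<psi> z * \<psi> z" using o by (simp add: mult.left_commute)
    then show ?thesis by (metis square_eq_iff)
  qed
  define A where "A = {\<psi>\<in>Irr G. \<psi> z = \<psi> \<one>}"
  define B where "B = {\<psi>\<in>Irr G. \<psi> z \<noteq> \<psi> \<one>}"
  let ?s = "\<lambda>S. \<Sum>\<psi>\<in>S. (d \<psi>)\<^sup>2"
  have AB: "Irr G = A \<union> B" "A \<inter> B = {}" "finite A" "finite B"
    using Irr_finite by (auto simp: A_def B_def)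
  have dA: "\<psi> \<one> * \<psi> z = of_nat ((d \<psi>)\<^sup>2)" if "\<psi> \<in> A" for \<psi>
    using that d(1)[of \<psi>] by (simp add: A_def power2_eq_square)
  have dB: "\<psi> \<one> * \<psi> z = - of_nat ((d \<psi>)\<^sup>2)" if "\<psi> \<in> B" for \<psi>
    using that d(1)[of \<psi>] pm[of \<psi>] by (auto simp: B_def power2_eq_square)
  have sA: "(\<Sum>\<psi>\<in>A. \<psi> \<one> * \<psi> z) = of_nat (?s A)" and sB: "(\<Sum>\<psi>\<in>B. \<psi> \<one> * \<psi> z) = - of_nat (?s B)"
    by (simp_all add: dA dB sum_negf)
  have sAB': "(\<Sum>\<psi>\<in>A \<union> B. \<psi> \<one> * \<psi> \<one>) = of_nat (\<Sum>\<psi>\<in>A \<union> B. (d \<psi>)\<^sup>2)"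
    unfolding AB(1)[symmetric] by (simp add: d(1) power2_eq_square)
  have "of_nat (?s A) + - of_nat (?s B) = (0 :: complex)"
    using regular_character[OF zc] z(2) sum.union_disjoint[OF AB(3,4,2), of "\<lambda>\<psi>. \<psi> \<one> * \<psi> z"]
    unfolding AB(1) sA sB by simp
  then have sAB: "?s A = ?s B" by (metis add_uminus_conv_diff eq_iff_diff_eq_0 of_nat_eq_iff)
  have "of_nat (?s A + ?s B) = (of_nat (Coset.order G) :: complex)"
    using regular_character[OF one_closed]
    unfolding AB(1) sAB' sum.union_disjoint[OF AB(3,4,2)] by simp
  then have "?s A + ?s B = Coset.order G" by (simp only: of_nat_eq_iff)
  then have s: "?s A = (d \<chi>)\<^sup>2" "?s B = (d \<chi>)\<^sup>2" using sAB ord by linarith+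
  have pos: "(d \<psi>)\<^sup>2 > 0" if "\<psi> \<in> A \<union> B" for \<psi>
    using that d(2)[of \<psi>] unfolding AB(1)[symmetric] by (metis zero_less_power)
  have "\<chi> \<notin> A"
  proof
    assume "\<chi> \<in> A"
    then have "A = {\<chi>}"
      by (rule sum_attained_imp_singleton[OF AB(3) _ s(1)]) (rule pos, simp)
    moreover have "(\<lambda>g\<in>carrier G. 1) \<in> A" using trivial_character_Irr zc by (simp add: A_def)
    ultimately have "\<chi> = (\<lambda>g\<in>carrier G. 1)" by auto
    then have "\<chi> \<one> = 1" by simp
    then have "d \<chi> = 1" using d(1)[OF \<chi>] by simp
    then show False using ord o by simp
  qed
  then have \<chi>B: "\<chi> \<in> B" using \<chi> AB by auto
  then have "B = {\<chi>}"
    by (rule sum_attained_imp_singleton[OF AB(4) _ s(2)]) (rule pos, simp)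
  then have "z \<in> common_kernel_but \<chi>" using zc by (auto simp: common_kernel_but_def B_def)
  moreover have \<chi>z: "\<chi> z \<noteq> \<chi> \<one>" "\<chi> z = - \<chi> \<one>" using \<chi>B pm[OF \<chi>] by (auto simp: B_def)
  moreover have "last_character G \<chi>" unfolding last_character_def
  proof (intro conjI ballI \<chi>)
    fix \<psi> assume \<psi>: "\<psi> \<in> Irr G"
    then have "(d \<psi>)\<^sup>2 \<le> (d \<chi>)\<^sup>2"
      using s member_le_sum[of \<psi> A "\<lambda>\<psi>. (d \<psi>)\<^sup>2"] member_le_sum[of \<psi> B "\<lambda>\<psi>. (d \<psi>)\<^sup>2"] AB by auto
    then have "d \<psi> \<le> d \<chi>" by (simp add: power2_nat_le_eq_le)
    then show "Re (\<psi> \<one>) \<le> Re (\<chi> \<one>)" using d(1)[OF \<psi>] d(1)[OF \<chi>] by simp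
  qed
  ultimately show ?thesis
    using \<chi> z(2) by (intro exI[of _ \<chi>] exI[of _ z]) (auto simp: CD1_data_def columns_differ_only_at_one_iff)
qed

section \<open>Normal subgroups whose nontrivial elements are conjugate\<close>

lemma subgroup_finite_group: "subgroup K G \<Longrightarrow> finite_group (G\<lparr>carrier := K\<rparr>)"
  unfolding finite_group_def finite_group_axioms_def
  using subgroup.subgroup_is_group[OF _ is_group] finite_subset[OF subgroup.subset finite_carrier] by auto

lemma conjugate_conjugate:
  "g \<in> carrier G \<Longrightarrow> h \<in> carrier G \<Longrightarrow> x \<in> carrier G \<Longrightarrow>
     g \<otimes> (h \<otimes> x \<otimes> inv h) \<otimes> inv g = (g \<otimes> h) \<otimes> x \<otimes> inv (g \<otimes> h)"
  by (simp add: inv_mult_group m_assoc)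

lemma inv_cancel_left [simp]:
  assumes "g \<in> carrier G" "x \<in> carrier G"
  shows "inv g \<otimes> (g \<otimes> x) = x" and "g \<otimes> (inv g \<otimes> x) = x"
  using assms by (simp_all add: m_assoc[symmetric])

lemma conjugate_mult:
  assumes "g \<in> carrier G" "x \<in> carrier G" "y \<in> carrier G"
  shows "(g \<otimes> x \<otimes> inv g) \<otimes> (g \<otimes> y \<otimes> inv g) = g \<otimes> (x \<otimes> y) \<otimes> inv g"
  using assms by (simp add: m_assoc)

lemma conjugate_eq_iff:
  assumes "g \<in> carrier G" "x \<in> carrier G"
  shows "g \<otimes> x \<otimes> inv g = x \<longleftrightarrow> g \<otimes> x = x \<otimes> g"
proof
  assume "g \<otimes> x \<otimes> inv g = x"
  then have "(g \<otimes> x \<otimes> inv g) \<otimes> g = x \<otimes> g" by simp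
  then show "g \<otimes> x = x \<otimes> g" using assms by (simp add: m_assoc)
next
  assume "g \<otimes> x = x \<otimes> g"
  then show "g \<otimes> x \<otimes> inv g = x" using assms by (simp add: m_assoc)
qed

text \<open>
  The centralizers in \<open>K\<close> of the nontrivial elements all have the same order \<open>c\<close>. The permutation
  character of \<open>K\<close> on itself by conjugation has the mean \<open>(|K| + (|K| - 1) c) / |K|\<close>, an integer. Thus
  \<open>|K|\<close> divides \<open>c\<close>.
\<close>
theorem conjugate_nontrivial_imp_commutative:
  assumes K: "subgroup K G"
    and normal: "\<And>g x. g \<in> carrier G \<Longrightarrow> x \<in> K \<Longrightarrow> g \<otimes> x \<otimes> inv g \<in> K"
    and trans: "\<And>x y. x \<in> K - {\<one>} \<Longrightarrow> y \<in> K - {\<one>} \<Longrightarrow> \<exists>g\<in>carrier G. y = g \<otimes> x \<otimes> inv g"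
    and xy: "x \<in> K" "y \<in> K"
  shows "x \<otimes> y = y \<otimes> x"
proof (cases "x = \<one>")
  case True
  then show ?thesis using xy subgroup.mem_carrier[OF K] by simp
next
  case x1: False
  interpret K: subgroup K G by (rule K)
  interpret GK: finite_group "G\<lparr>carrier := K\<rparr>" by (rule subgroup_finite_group[OF K])
  have finK: "finite K" using finite_subset[OF K.subset finite_carrier] .
  let ?C = "\<lambda>k. {u \<in> K. k \<otimes> u \<otimes> inv k = u}"
  obtain n \<rho> where rep: "matrix_rep (G\<lparr>carrier := K\<rparr>) n \<rho>"
    and tr: "\<And>k. k \<in> K \<Longrightarrow> mat_trace (\<rho> k) = of_nat (card (?C k))"
    using GK.permutation_rep[of K "\<lambda>k u. k \<otimes> u \<otimes> inv k"] finK
    by (auto simp: conjugate_conjugate)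
  obtain m where m: "(\<Sum>k\<in>K. mat_trace (\<rho> k)) = of_nat (m * card K)"
    using GK.matrix_rep_trace_mean[OF rep] by (auto simp: Coset.order_def)
  have "of_nat (\<Sum>k\<in>K. card (?C k)) = (of_nat (m * card K) :: complex)"
    unfolding m[symmetric] of_nat_sum by (rule sum.cong) (simp_all add: tr)
  then have total: "(\<Sum>k\<in>K. card (?C k)) = m * card K" by (simp only: of_nat_eq_iff)
  have le: "card (?C k) \<le> card (?C (g \<otimes> k \<otimes> inv g))" if k: "k \<in> K" and g: "g \<in> carrier G" for k g
  proof (rule card_inj_on_le[of "\<lambda>u. g \<otimes> u \<otimes> inv g"])
    show "inj_on (\<lambda>u. g \<otimes> u \<otimes> inv g) (?C k)"
      using g by (auto simp: inj_on_def)
    show "(\<lambda>u. g \<otimes> u \<otimes> inv g) ` ?C k \<subseteq> ?C (g \<otimes> k \<otimes> inv g)"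
    proof
      fix w assume "w \<in> (\<lambda>u. g \<otimes> u \<otimes> inv g) ` ?C k"
      then obtain u where u: "u \<in> K" "k \<otimes> u \<otimes> inv k = u" "w = g \<otimes> u \<otimes> inv g" by auto
      have kc: "k \<in> carrier G" and uc: "u \<in> carrier G" using k u by auto
      have comm: "k \<otimes> u = u \<otimes> k" using conjugate_eq_iff[OF kc uc] u(2) by simp
      have "(g \<otimes> k \<otimes> inv g) \<otimes> w = w \<otimes> (g \<otimes> k \<otimes> inv g)"
        unfolding u(3) conjugate_mult[OF g kc uc] conjugate_mult[OF g uc kc] comm ..
      moreover have "g \<otimes> k \<otimes> inv g \<in> carrier G" "w \<in> carrier G" using g kc uc u by auto
      ultimately show "w \<in> ?C (g \<otimes> k \<otimes> inv g)"
        using normal[OF g u(1)] u(3) conjugate_eq_iff[of "g \<otimes> k \<otimes> inv g" w] by simp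
    qed
    show "finite (?C (g \<otimes> k \<otimes> inv g))" using finK by simp
  qed
  have same: "card (?C k) = card (?C x)" if k: "k \<in> K - {\<one>}" for k
  proof -
    have x: "x \<in> K - {\<one>}" using xy x1 by simp
    obtain g where "g \<in> carrier G" "k = g \<otimes> x \<otimes> inv g" using trans[OF x k] by blast
    then have "card (?C x) \<le> card (?C k)" using le[OF xy(1)] by simp
    moreover obtain h where "h \<in> carrier G" "x = h \<otimes> k \<otimes> inv h" using trans[OF k x] by blast
    then have "card (?C k) \<le> card (?C x)" using le[of k h] k by simp
    ultimately show ?thesis by simp
  qed
  have "?C \<one> = K" using K.subset by auto
  then have "m * card K = card K + (\<Sum>k\<in>K - {\<one>}. card (?C x))"
    unfolding total[symmetric] using sum.remove[OF finK K.one_closed, of "\<lambda>k. card (?C k)"] same by simp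
  also have "(\<Sum>k\<in>K - {\<one>}. card (?C x)) = (card K - 1) * card (?C x)"
    using K.one_closed finK by simp
  finally have eq: "m * card K = card K + (card K - 1) * card (?C x)" .
  have pos: "card K > 0" using K.one_closed finK card_gt_0_iff by blast
  have "card K dvd card K + (card K - 1) * card (?C x)" unfolding eq[symmetric] by simp
  then have "card K dvd (card K - 1) * card (?C x)" by simp
  moreover have "coprime (card K) (card K - 1)" using pos by (rule coprime_diff_one_right_nat)
  ultimately have "card K dvd card (?C x)" using coprime_dvd_mult_right_iff by blast
  moreover have "x \<in> ?C x" using xy K.subset by (auto simp: conjugate_eq_iff)
  then have "card (?C x) > 0" using finK by (auto simp: card_gt_0_iff)
  ultimately have "card K \<le> card (?C x)" by (rule dvd_imp_le)
  then have "?C x = K" using finK by (intro card_seteq) auto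
  then have "x \<otimes> y \<otimes> inv x = y" using xy by auto
  then show ?thesis using xy conjugate_eq_iff by auto
qed

section \<open>Complements of abelian normal subgroups\<close>

text \<open>
  Schur's theorem. Let \<open>T\<close> be a transversal, \<open>t y\<close> the representative of \<open>K y\<close>, and \<open>D g\<close> the product of
  the elements \<open>g x (t (g x))\<^sup>-\<^sup>1\<close> of \<open>K\<close> over \<open>x \<in> T\<close>. Then \<open>D\<close> is a crossed homomorphism, and on
  \<open>K\<close> it is the power map with exponent the index of \<open>K\<close>, a bijection. The complement is its kernel:
  it meets \<open>K\<close> trivially as the power map is injective, and it meets each coset of \<open>K\<close> as the map is
  surjective.
\<close>
theorem abelian_normal_complement:
  assumes K: "subgroup K G"
    and normal: "\<And>g x. g \<in> carrier G \<Longrightarrow> x \<in> K \<Longrightarrow> g \<otimes> x \<otimes> inv g \<in> K"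
    and comm: "\<And>x y. x \<in> K \<Longrightarrow> y \<in> K \<Longrightarrow> x \<otimes> y = y \<otimes> x"
    and coprime: "coprime (card K) (card (rcosets K))"
  shows "\<exists>H. subgroup H G \<and> H \<inter> K = {\<one>} \<and> (\<forall>g\<in>carrier G. \<exists>k\<in>K. k \<otimes> g \<in> H)"
proof -
  interpret K: subgroup K G by (rule K)
  interpret GK: finite_group "G\<lparr>carrier := K\<rparr>" by (rule subgroup_finite_group[OF K])
  interpret A: comm_group "G\<lparr>carrier := K\<rparr>"
    by (rule GK.group_comm_groupI) (simp add: comm)
  define t where "t y = (SOME z. z \<in> K #> y)" for y
  have t: "t y \<in> K #> y" if "y \<in> carrier G" for y
    unfolding t_def using rcos_self[OF that K] by (rule someI)
  have tc: "t y \<in> carrier G" if "y \<in> carrier G" for y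
    using t[OF that] r_coset_subset_G[OF K.subset that] by auto
  have same_coset: "K #> t y = K #> y" if "y \<in> carrier G" for y
    using repr_independence[OF t[OF that] that K] by simp
  have t_eq_iff: "t y = t z \<longleftrightarrow> y \<otimes> inv z \<in> K" if yz: "y \<in> carrier G" "z \<in> carrier G" for y z
  proof
    assume "t y = t z"
    then have "K #> y = K #> z" using same_coset yz by metis
    then have "y \<in> K #> z" using rcos_self[OF yz(1) K] by simp
    then show "y \<otimes> inv z \<in> K" using yz by (auto simp: r_coset_def m_assoc)
  next
    assume "y \<otimes> inv z \<in> K"
    then have "y \<in> K #> z" using yz by (auto simp: r_coset_def m_assoc intro!: bexI[of _ "y \<otimes> inv z"])
    then show "t y = t z" using repr_independence[OF _ yz(2) K] by (simp add: t_def)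
  qed
  have yt: "y \<otimes> inv (t y) \<in> K" if "y \<in> carrier G" for y
    using t_eq_iff[OF that tc[OF that]] same_coset[OF that] by (simp add: t_def)
  define T where "T = t ` carrier G"
  have Tc: "T \<subseteq> carrier G" using tc by (auto simp: T_def)
  have tT: "t y \<in> T" if "y \<in> carrier G" for y using that by (simp add: T_def)
  have tid: "t x = x" if "x \<in> T" for x
    using that same_coset by (auto simp: T_def t_def)
  have finT: "finite T" by (simp add: T_def)
  have "bij_betw (\<lambda>x. K #> x) T (rcosets K)"
  proof (rule bij_betwI')
    fix x y assume xy: "x \<in> T" "y \<in> T"
    show "(K #> x = K #> y) = (x = y)" using tid[OF xy(1)] tid[OF xy(2)] by (metis t_def)
  next
    show "K #> x \<in> rcosets K" if "x \<in> T" for x using that Tc K.subset by (auto intro: rcosetsI)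
  next
    fix C assume "C \<in> rcosets K"
    then obtain y where "y \<in> carrier G" "C = K #> y" by (auto simp: RCOSETS_def)
    then show "\<exists>x\<in>T. C = K #> x" using same_coset tT by metis
  qed
  then have cardT: "card T = card (rcosets K)" by (rule bij_betw_same_card)

  let ?M = "G\<lparr>carrier := K\<rparr>"
  define e where "e g x = g \<otimes> x \<otimes> inv (t (g \<otimes> x))" for g x
  have eK: "e g x \<in> K" if "g \<in> carrier G" "x \<in> T" for g x
    unfolding e_def using yt[of "g \<otimes> x"] that Tc by auto
  define D where "D g = finprod ?M (e g) T" for g
  have DK: "D g \<in> K" if "g \<in> carrier G" for g
    using A.finprod_closed[of "e g" T] eK[OF that] by (auto simp: D_def)
  have cocycle: "D (g \<otimes> h) = (g \<otimes> D h \<otimes> inv g) \<otimes> D g" if g: "g \<in> carrier G" and h: "h \<in> carrier G" for g h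
  proof -
    let ?s = "\<lambda>x. t (h \<otimes> x)"
    have s: "?s x \<in> T" if "x \<in> T" for x using that Tc h tT by auto
    \<comment> \<open>\<open>g h x\<close> and \<open>g (t (h x))\<close> lie in the same coset, so the two representatives agree\<close>
    have split: "e (g \<otimes> h) x = (g \<otimes> e h x \<otimes> inv g) \<otimes> e g (?s x)" if x: "x \<in> T" for x
    proof -
      have xc: "x \<in> carrier G" using x Tc by auto
      have hx: "h \<otimes> x \<in> carrier G" and ghx: "g \<otimes> h \<otimes> x \<in> carrier G" and sx: "?s x \<in> carrier G"
        using g h xc tc by auto
      have "(g \<otimes> h \<otimes> x) \<otimes> inv (g \<otimes> ?s x) = g \<otimes> (h \<otimes> x \<otimes> inv (?s x)) \<otimes> inv g"
        using g h xc sx by (simp add: inv_mult_group m_assoc)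
      then have "(g \<otimes> h \<otimes> x) \<otimes> inv (g \<otimes> ?s x) \<in> K" using normal[OF g yt[OF hx]] by simp
      then have tt: "t (g \<otimes> h \<otimes> x) = t (g \<otimes> ?s x)" using t_eq_iff[OF ghx] g sx by simp
      have tgc: "t (g \<otimes> ?s x) \<in> carrier G" using g sx tc by simp
      have "(g \<otimes> e h x \<otimes> inv g) \<otimes> e g (?s x) =
          g \<otimes> (h \<otimes> x) \<otimes> inv (?s x) \<otimes> (inv g \<otimes> g) \<otimes> ?s x \<otimes> inv (t (g \<otimes> ?s x))"
        unfolding e_def using g hx sx tgc by (simp add: m_assoc del: l_inv)
      also have "\<dots> = g \<otimes> (h \<otimes> x) \<otimes> (inv (?s x) \<otimes> ?s x) \<otimes> inv (t (g \<otimes> ?s x))"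
        using g hx sx tgc by (simp add: m_assoc)
      also have "\<dots> = e (g \<otimes> h) x" unfolding e_def tt using g h xc sx tgc by (simp add: m_assoc)
      finally show ?thesis ..
    qed
    have inj: "inj_on ?s T"
    proof (rule inj_onI)
      fix x y assume xy: "x \<in> T" "y \<in> T" and eq: "?s x = ?s y"
      have xc: "x \<in> carrier G" and yc: "y \<in> carrier G" using xy Tc by auto
      have "(h \<otimes> x) \<otimes> inv (h \<otimes> y) \<in> K" using eq t_eq_iff[of "h \<otimes> x" "h \<otimes> y"] xc yc h by simp
      then have "inv h \<otimes> ((h \<otimes> x) \<otimes> inv (h \<otimes> y)) \<otimes> inv (inv h) \<in> K" by (rule normal[OF inv_closed[OF h]])
      also have "inv h \<otimes> ((h \<otimes> x) \<otimes> inv (h \<otimes> y)) \<otimes> inv (inv h) = x \<otimes> inv y"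
        using h xc yc by (simp add: inv_mult_group m_assoc[symmetric]) (simp add: m_assoc)
      finally show "x = y" using t_eq_iff[OF xc yc] tid xy by metis
    qed
    have image: "?s ` T = T"
      by (rule card_subset_eq[OF finT]) (use s inj in \<open>auto simp: card_image\<close>)
    have "finprod ?M (\<lambda>x. g \<otimes> e h x \<otimes> inv g) T = g \<otimes> D h \<otimes> inv g"
      unfolding D_def using finT order_refl
    proof (induction rule: finite_subset_induct')
      case empty
      show ?case using g by simp
    next
      case (insert x S)
      have eS: "e h x \<in> K" "e h \<in> S \<rightarrow> K" using insert eK[OF h] by auto
      have cS: "g \<otimes> e h x \<otimes> inv g \<in> K" "(\<lambda>x. g \<otimes> e h x \<otimes> inv g) \<in> S \<rightarrow> K"
        using eS normal[OF g] by auto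
      have fK: "finprod ?M (e h) S \<in> K" using A.finprod_closed[of "e h" S] eS by simp
      have "finprod ?M (\<lambda>x. g \<otimes> e h x \<otimes> inv g) (insert x S) =
          (g \<otimes> e h x \<otimes> inv g) \<otimes> (g \<otimes> finprod ?M (e h) S \<otimes> inv g)"
        using A.finprod_insert[OF insert.hyps(1,4), of "\<lambda>x. g \<otimes> e h x \<otimes> inv g"] cS insert.IH by simp
      also have "\<dots> = g \<otimes> (e h x \<otimes> finprod ?M (e h) S) \<otimes> inv g"
        using eS fK by (intro conjugate_mult[OF g]) auto
      also have "e h x \<otimes> finprod ?M (e h) S = finprod ?M (e h) (insert x S)"
        using A.finprod_insert[OF insert.hyps(1,4), of "e h"] eS by simp
      finally show ?case .
    qed
    moreover have "finprod ?M (\<lambda>x. e g (?s x)) T = D g"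
      unfolding D_def using A.finprod_reindex[of "e g" ?s T] inj image eK[OF g] by auto
    moreover have "D (g \<otimes> h) = finprod ?M (\<lambda>x. (g \<otimes> e h x \<otimes> inv g) \<otimes> e g (?s x)) T"
      unfolding D_def using split s eK[OF g] normal[OF g eK[OF h]] by (intro A.finprod_cong) auto
    moreover have "finprod ?M (\<lambda>x. (g \<otimes> e h x \<otimes> inv g) \<otimes> e g (?s x)) T =
        finprod ?M (\<lambda>x. g \<otimes> e h x \<otimes> inv g) T \<otimes> finprod ?M (\<lambda>x. e g (?s x)) T"
      using A.finprod_multf[of "\<lambda>x. g \<otimes> e h x \<otimes> inv g" T "\<lambda>x. e g (?s x)"] s eK[OF g] normal[OF g eK[OF h]] by auto
    ultimately show ?thesis by simp
  qed
  have Dk: "D k = k [^] card (rcosets K)" if k: "k \<in> K" for k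
  proof -
    have "e k x = k" if x: "x \<in> T" for x
    proof -
      have xc: "x \<in> carrier G" and kc: "k \<in> carrier G" using x k Tc by auto
      have "k \<otimes> x \<otimes> inv x \<in> K" using xc kc k by (simp add: m_assoc)
      then have "t (k \<otimes> x) = x" using t_eq_iff[of "k \<otimes> x" x] xc kc tid[OF x] by simp
      then show ?thesis unfolding e_def using xc kc by (simp add: m_assoc)
    qed
    then have "D k = finprod ?M (\<lambda>x. k) T" unfolding D_def using k by (intro A.finprod_cong) auto
    also have "\<dots> = k [^] card T" using A.finprod_const[of k T] k by (simp add: nat_pow_consistent[symmetric])
    finally show ?thesis by (simp add: cardT)
  qed
  define H where "H = {g \<in> carrier G. D g = \<one>}"
  have H: "subgroup H G"
  proof (rule finite_submonoid_subgroup)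
    show "\<one> \<in> H" using Dk[OF K.one_closed] by (simp add: H_def)
    show "g \<otimes> h \<in> H" if "g \<in> H" "h \<in> H" for g h
      using that cocycle[of g h] by (auto simp: H_def)
  qed (auto simp: H_def)
  have pow_inj: "k = \<one>" if k: "k \<in> K" and "k [^] card (rcosets K) = \<one>" for k
  proof -
    have kc: "k \<in> carrier G" using k by auto
    have "k [^] card K = \<one>"
      using GK.pow_order_eq_1[of k] k by (simp add: Coset.order_def nat_pow_consistent[symmetric])
    then have "ord k dvd card K" "ord k dvd card (rcosets K)"
      using that kc by (auto simp: pow_eq_id)
    then have "ord k = 1" using coprime coprime_common_divisor_nat by blast
    then show ?thesis using kc ord_eq_1 by blast
  qed
  have "H \<inter> K = {\<one>}"
    using pow_inj Dk K.one_closed subgroup.one_closed[OF H] by (auto simp: H_def)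
  moreover have "\<exists>k\<in>K. k \<otimes> g \<in> H" if g: "g \<in> carrier G" for g
  proof -
    let ?p = "\<lambda>k. k [^] card (rcosets K)"
    have powK: "?p k \<in> K" if "k \<in> K" for k using DK[of k] Dk[OF that] that by simp
    have "inj_on ?p K"
    proof (rule inj_onI)
      fix k l assume kl: "k \<in> K" "l \<in> K" and eq: "?p k = ?p l"
      have c: "k \<in> carrier G" "l \<in> carrier G" using kl by auto
      have "?p (k \<otimes> inv l) = ?p k \<otimes> ?p (inv l)"
        by (rule pow_mult_distrib[OF comm[OF kl(1) K.m_inv_closed[OF kl(2)]] c(1) inv_closed[OF c(2)]])
      also have "\<dots> = \<one>" unfolding eq using c by (simp add: nat_pow_inv)
      finally have "k \<otimes> inv l = \<one>" using pow_inj kl by simp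
      then have "(k \<otimes> inv l) \<otimes> l = l" using c by simp
      then show "k = l" using c by (simp add: m_assoc)
    qed
    then have "?p ` K = K"
      using powK finite_subset[OF K.subset finite_carrier] by (intro card_subset_eq) (auto simp: card_image)
    then have "inv (D g) \<in> ?p ` K" using K.m_inv_closed[OF DK[OF g]] by simp
    then obtain k where k: "k \<in> K" "inv (D g) = ?p k" by blast
    have kc: "k \<in> carrier G" and Dc: "D g \<in> carrier G" using k DK[OF g] by auto
    have "D (k \<otimes> g) = (k \<otimes> D g \<otimes> inv k) \<otimes> D k" by (rule cocycle[OF kc g])
    also have "k \<otimes> D g \<otimes> inv k = D g" using comm[OF k(1) DK[OF g]] kc Dc by (simp add: m_assoc)
    finally have "D (k \<otimes> g) = \<one>" unfolding Dk[OF k(1)] k(2)[symmetric] using Dc by simp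
    then show ?thesis using k kc g by (auto simp: H_def)
  qed
  ultimately show ?thesis using H by blast
qed

section \<open>The permutation character of a Frobenius group\<close>

lemma conjugate_set_iff:
  assumes H: "subgroup H G" and g: "g \<in> carrier G" and u: "u \<in> carrier G"
  shows "u \<in> conjugate_set G g H \<longleftrightarrow> inv g \<otimes> u \<otimes> g \<in> H"
proof
  assume "u \<in> conjugate_set G g H"
  then obtain h where "h \<in> H" "u = g \<otimes> h \<otimes> inv g" by (auto simp: conjugate_set_def)
  then show "inv g \<otimes> u \<otimes> g \<in> H" using g subgroup.mem_carrier[OF H] by (simp add: m_assoc)
next
  assume h: "inv g \<otimes> u \<otimes> g \<in> H"
  have "u = g \<otimes> (inv g \<otimes> u \<otimes> g) \<otimes> inv g" using g u by (simp add: m_assoc)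
  then show "u \<in> conjugate_set G g H" unfolding conjugate_set_def using h by blast
qed

lemma l_coset_eq_iff:
  assumes H: "subgroup H G" and g: "g \<in> carrier G" and k: "k \<in> carrier G"
  shows "k <# H = g <# H \<longleftrightarrow> inv g \<otimes> k \<in> H"
proof
  assume "k <# H = g <# H"
  moreover have "k \<in> k <# H" using subgroup.one_closed[OF H] k by (force simp: l_coset_def)
  ultimately obtain h where "h \<in> H" "k = g \<otimes> h" by (auto simp: l_coset_def)
  then show "inv g \<otimes> k \<in> H" using g subgroup.mem_carrier[OF H] by simp
next
  assume h: "inv g \<otimes> k \<in> H"
  have "k = g \<otimes> (inv g \<otimes> k)" using g k by simp
  then have "k \<in> g <# H" unfolding l_coset_def using h by blast
  then show "k <# H = g <# H" using l_repr_independence[OF _ g H] by simp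
qed

lemma l_coset_fixed_iff:
  assumes H: "subgroup H G" and g: "g \<in> carrier G" and u: "u \<in> carrier G"
  shows "u <# (g <# H) = g <# H \<longleftrightarrow> u \<in> conjugate_set G g H"
  using l_coset_eq_iff[OF H g, of "u \<otimes> g"] conjugate_set_iff[OF H g u] g u
    lcos_m_assoc[OF subgroup.subset[OF H] u g] by (simp add: m_assoc)

lemma lcosetsE:
  assumes "C \<in> lcosets H" obtains g where "g \<in> carrier G" "C = g <# H"
  using assms by (auto simp: LCOSETS_def)

lemma frobenius_complementD:
  assumes "frobenius_complement G H"
  shows "subgroup H G" and "H \<noteq> {\<one>}" and "H \<noteq> carrier G"
    and "g \<in> carrier G \<Longrightarrow> g \<notin> H \<Longrightarrow> x \<in> H \<Longrightarrow> x \<in> conjugate_set G g H \<Longrightarrow> x = \<one>"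
  using assms by (auto simp: frobenius_complement_def)

text \<open>
  An element fixes the coset \<open>g H\<close> precisely if it lies in the conjugate of \<open>H\<close> by \<open>g\<close>, and
  conjugates of \<open>H\<close> that belong to distinct cosets meet trivially.
\<close>
lemma frobenius_fixed_cosets:
  assumes fc: "frobenius_complement G H" and u: "u \<in> carrier G" "u \<noteq> \<one>"
  shows "card {C \<in> lcosets H. u <# C = C} = (if u \<in> frobenius_kernel G H then 0 else 1)"
proof (cases "u \<in> frobenius_kernel G H")
  case True
  have "{C \<in> lcosets H. u <# C = C} = {}"
  proof (rule equals0I)
    fix C assume "C \<in> {C \<in> lcosets H. u <# C = C}"
    then obtain g where "g \<in> carrier G" "u <# (g <# H) = g <# H" by (auto elim: lcosetsE)
    then show False
      using True u l_coset_fixed_iff[OF frobenius_complementD(1)[OF fc]] by (auto simp: frobenius_kernel_def)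
  qed
  then show ?thesis using True by (simp only: card.empty if_True)
next
  case False
  note H = frobenius_complementD(1)[OF fc]
  obtain g where g: "g \<in> carrier G" "u \<in> conjugate_set G g H"
    using False u by (auto simp: frobenius_kernel_def)
  have "C = g <# H" if C: "C \<in> lcosets H" "u <# C = C" for C
  proof -
    obtain k where k: "k \<in> carrier G" "C = k <# H" using C(1) by (rule lcosetsE)
    then have uk: "u \<in> conjugate_set G k H" using C l_coset_fixed_iff[OF H k(1) u(1)] by simp
    let ?x = "inv g \<otimes> u \<otimes> g" and ?c = "inv g \<otimes> k"
    have c: "?c \<in> carrier G" using g k by simp
    have x: "?x \<in> H" using g conjugate_set_iff[OF H g(1) u(1)] by simp
    have xc: "?x \<in> carrier G" using g u by simp
    have "inv ?c \<otimes> ?x \<otimes> ?c = inv k \<otimes> u \<otimes> k" using g k u by (simp add: m_assoc inv_mult_group)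
    then have "?x \<in> conjugate_set G ?c H"
      using conjugate_set_iff[OF H c xc] uk conjugate_set_iff[OF H k(1) u(1)] by simp
    moreover have "?x \<noteq> \<one>"
    proof
      assume "?x = \<one>"
      then have "g \<otimes> ?x \<otimes> inv g = \<one>" using g by simp
      then show False using g u by (simp add: m_assoc)
    qed
    ultimately have "?c \<in> H" using frobenius_complementD(4)[OF fc c _ x] by blast
    then show ?thesis using l_coset_eq_iff[OF H g(1) k(1)] k by simp
  qed
  moreover have "u <# (g <# H) = g <# H" using g l_coset_fixed_iff[OF H g(1) u(1)] by simp
  moreover have "g <# H \<in> lcosets H" using g by (auto simp: LCOSETS_def)
  ultimately have "{C \<in> lcosets H. u <# C = C} = {g <# H}" by blast
  then show ?thesis using False by simp
qed

lemma finite_lcosets: "finite (lcosets H)"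
  by (simp add: LCOSETS_def)

lemma card_conjugate_set:
  assumes H: "subgroup H G" and g: "g \<in> carrier G"
  shows "card (conjugate_set G g H) = card H"
  unfolding conjugate_set_def
proof (rule card_image, rule inj_onI)
  fix x y assume "x \<in> H" "y \<in> H" and eq: "g \<otimes> x \<otimes> inv g = g \<otimes> y \<otimes> inv g"
  then show "x = y" using g subgroup.mem_carrier[OF H] by simp
qed

text \<open>
  The mean number of fixed points is the number of orbits. Here it is found by counting for each coset the
  elements that fix it, which form a conjugate of \<open>H\<close>.
\<close>
lemma sum_fixed_cosets:
  assumes H: "subgroup H G"
  shows "(\<Sum>u\<in>carrier G. card {C \<in> lcosets H. u <# C = C}) = Coset.order G"
proof -
  have "(\<Sum>u\<in>carrier G. card {C \<in> lcosets H. u <# C = C}) =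
      (\<Sum>u\<in>carrier G. \<Sum>C\<in>lcosets H. if u <# C = C then 1 else 0)"
    by (intro sum.cong) (simp_all add: finite_lcosets sum.If_cases Int_def)
  also have "\<dots> = (\<Sum>C\<in>lcosets H. card {u \<in> carrier G. u <# C = C})"
    by (subst sum.swap) (simp add: sum.If_cases Int_def)
  also have "\<dots> = (\<Sum>C\<in>lcosets H. card H)"
  proof (rule sum.cong[OF refl])
    fix C assume "C \<in> lcosets H"
    then obtain g where g: "g \<in> carrier G" "C = g <# H" by (rule lcosetsE)
    have "conjugate_set G g H \<subseteq> carrier G"
      using g subgroup.mem_carrier[OF H] by (auto simp: conjugate_set_def)
    then have "{u \<in> carrier G. u <# C = C} = conjugate_set G g H"
      using g l_coset_fixed_iff[OF H] by auto
    then show "card {u \<in> carrier G. u <# C = C} = card H" using card_conjugate_set[OF H g(1)] by simp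
  qed
  also have "\<dots> = Coset.order G" using l_lagrange[OF finite_carrier H] by simp
  finally show ?thesis .
qed

lemma frobenius_kernel_carrier: "frobenius_kernel G H \<subseteq> carrier G"
  by (auto simp: frobenius_kernel_def)

lemma l_coset_one: "subgroup H G \<Longrightarrow> C \<in> lcosets H \<Longrightarrow> \<one> <# C = C"
  using subgroup.lcosets_carrier[OF _ is_group] lcos_mult_one by blast

text \<open>
  Outside \<open>1\<close> the fixed point numbers are \<open>0\<close> on the kernel and \<open>1\<close> off it, so their sum \<open>|G|\<close> is
  the index of \<open>H\<close> plus the number of elements off the kernel.
\<close>
theorem card_frobenius_kernel:
  assumes fc: "frobenius_complement G H"
  shows "card (frobenius_kernel G H) = card (lcosets H)"
    and "Coset.order G = card (frobenius_kernel G H) * card H"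
proof -
  note H = frobenius_complementD(1)[OF fc]
  let ?N = "frobenius_kernel G H" and ?fix = "\<lambda>u. card {C \<in> lcosets H. u <# C = C}"
  have N1: "\<one> \<in> ?N" by (simp add: frobenius_kernel_def)
  have finN: "finite ?N" using frobenius_kernel_carrier finite_carrier by (rule finite_subset)
  have "{C \<in> lcosets H. \<one> <# C = C} = lcosets H" using l_coset_one[OF H] by auto
  then have fix1: "?fix \<one> = card (lcosets H)" by simp
  have "Coset.order G = ?fix \<one> + (\<Sum>u\<in>carrier G - {\<one>}. ?fix u)"
    unfolding sum_fixed_cosets[OF H, symmetric] by (rule sum.remove) auto
  also have "(\<Sum>u\<in>carrier G - {\<one>}. ?fix u) = (\<Sum>u\<in>carrier G - {\<one>}. if u \<in> ?N then 0 else 1)"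
    by (intro sum.cong) (auto simp: frobenius_fixed_cosets[OF fc])
  also have "\<dots> = card (carrier G - ?N)"
  proof -
    have "(carrier G - {\<one>}) \<inter> - ?N = carrier G - ?N" using N1 by auto
    then show ?thesis by (simp add: sum.If_cases)
  qed
  also have "card (carrier G - ?N) = Coset.order G - card ?N"
    unfolding Coset.order_def by (rule card_Diff_subset[OF finN frobenius_kernel_carrier])
  finally have "Coset.order G = card (lcosets H) + (Coset.order G - card ?N)" using fix1 by simp
  moreover have "card ?N \<le> Coset.order G"
    unfolding Coset.order_def by (rule card_mono[OF finite_carrier frobenius_kernel_carrier])
  ultimately show eq: "card ?N = card (lcosets H)" by simp
  show "Coset.order G = card ?N * card H" using l_lagrange[OF finite_carrier H] eq by simp
qed

lemma sum_list_character_norm: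
  assumes "set \<psi>s \<subseteq> Irr G"
  shows "(\<Sum>g\<in>carrier G. (\<Sum>\<psi>\<leftarrow>\<psi>s. \<psi> g) * (\<Sum>\<psi>\<leftarrow>\<psi>s. \<psi> (inv g))) =
    of_nat ((\<Sum>\<phi>\<leftarrow>\<psi>s. count_list \<psi>s \<phi>) * Coset.order G)"
proof -
  have "(\<Sum>g\<in>carrier G. (\<Sum>\<psi>\<leftarrow>\<psi>s. \<psi> g) * (\<Sum>\<phi>\<leftarrow>\<phi>s. \<phi> (inv g))) =
      of_nat ((\<Sum>\<phi>\<leftarrow>\<phi>s. count_list \<psi>s \<phi>) * Coset.order G)" if "set \<phi>s \<subseteq> Irr G" for \<phi>s
    using that
  proof (induction \<phi>s)
    case (Cons \<phi> \<phi>s)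
    then show ?case
      using sum_list_character_inner[OF assms, of \<phi>] by (simp add: distrib_left sum.distrib algebra_simps)
  qed simp
  then show ?thesis using assms .
qed

text \<open>
  The fixed point numbers \<open>\<pi>\<close> satisfy \<open>\<Sum>\<pi> = |G|\<close> and \<open>\<Sum>\<pi>\<^sup>2 = 2 |G|\<close>. So \<open>\<pi>\<close> is the sum of two distinct
  irreducible characters, one of them trivial.
\<close>
theorem doubly_transitive_character:
  assumes fc: "frobenius_complement G H" and dt: "card H = card (frobenius_kernel G H) - 1"
  obtains \<chi> where "\<chi> \<in> Irr G" "\<chi> \<one> = of_nat (card H)"
    "\<And>g. g \<in> frobenius_kernel G H \<Longrightarrow> g \<noteq> \<one> \<Longrightarrow> \<chi> g = -1"
proof -
  note H = frobenius_complementD(1)[OF fc]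
  let ?N = "frobenius_kernel G H" and ?fix = "\<lambda>u. card {C \<in> lcosets H. u <# C = C}"
  have finH: "finite H" using finite_subset[OF subgroup.subset[OF H] finite_carrier] .
  have cH: "card H > 0" using finH subgroup.one_closed[OF H] by (auto simp: card_gt_0_iff)
  define n where "n = card ?N"
  have n: "n = card H + 1" using dt cH by (simp add: n_def)
  have ord: "Coset.order G = n * (n - 1)" using card_frobenius_kernel(2)[OF fc] n by (simp add: n_def)
  have "{C \<in> lcosets H. \<one> <# C = C} = lcosets H" using l_coset_one[OF H] by auto
  then have fix1: "?fix \<one> = n" using card_frobenius_kernel(1)[OF fc] by (simp add: n_def)
  note fixu = frobenius_fixed_cosets[OF fc]
  obtain d \<rho> where rep: "matrix_rep G d \<rho>"
    and tr: "\<And>g. g \<in> carrier G \<Longrightarrow> mat_trace (\<rho> g) = of_nat (?fix g)"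
  proof (rule permutation_rep[of "lcosets H" "\<lambda>u C. u <# C"])
    fix g C assume g: "g \<in> carrier G" and C: "C \<in> lcosets H"
    obtain k where k: "k \<in> carrier G" "C = k <# H" using C by (rule lcosetsE)
    have "g <# C = (g \<otimes> k) <# H" using lcos_m_assoc[OF subgroup.subset[OF H] g k(1)] k(2) by simp
    then show "g <# C \<in> lcosets H" using g k(1) by (auto simp: LCOSETS_def)
  next
    show "(g \<otimes> h) <# C = g <# (h <# C)" if "g \<in> carrier G" "h \<in> carrier G" "C \<in> lcosets H" for g h C
      using lcos_m_assoc[OF subgroup.lcosets_carrier[OF H is_group that(3)] that(1,2)] by simp
  qed (use that finite_lcosets l_coset_one[OF H] in auto)
  obtain \<psi>s where \<psi>s: "set \<psi>s \<subseteq> Irr G"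
    and decomp: "\<forall>g\<in>carrier G. mat_trace (\<rho> g) = (\<Sum>\<psi>\<leftarrow>\<psi>s. \<psi> g)"
    using matrix_rep_trace_decomp[OF rep] by blast
  have val: "(\<Sum>\<psi>\<leftarrow>\<psi>s. \<psi> g) = of_nat (?fix g)" if "g \<in> carrier G" for g
    using decomp tr[OF that] that by simp
  let ?triv = "\<lambda>g\<in>carrier G. 1 :: complex"
  have "of_nat (count_list \<psi>s ?triv * Coset.order G) = (\<Sum>g\<in>carrier G. (\<Sum>\<psi>\<leftarrow>\<psi>s. \<psi> g) * ?triv (inv g))"
    by (rule sum_list_character_inner[OF \<psi>s trivial_character_Irr, symmetric])
  also have "\<dots> = of_nat (\<Sum>g\<in>carrier G. ?fix g)"
    unfolding of_nat_sum by (intro sum.cong refl) (simp add: val)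
  finally have "count_list \<psi>s ?triv * Coset.order G = Coset.order G"
    unfolding sum_fixed_cosets[OF H] by (simp only: of_nat_eq_iff)
  moreover have o: "Coset.order G > 0" by (simp add: order_gt_0_iff_finite)
  ultimately have triv: "count_list \<psi>s ?triv = 1" by simp
  have fix_inv: "?fix (inv u) = ?fix u" if u: "u \<in> carrier G" for u
  proof -
    have "inv u <# C = C \<longleftrightarrow> u <# C = C" if C: "C \<in> lcosets H" for C
    proof -
      have Cc: "C \<subseteq> carrier G" by (rule subgroup.lcosets_carrier[OF H is_group C])
      have "inv u <# (u <# C) = C" "u <# (inv u <# C) = C"
        using lcos_m_assoc[OF Cc] u lcos_mult_one[OF Cc] by simp_all
      then show ?thesis by metis
    qed
    then show ?thesis by (metis (no_types, lifting) Collect_cong)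
  qed
  have "(\<Sum>u\<in>carrier G. ?fix u * ?fix u) = n * n + (\<Sum>u\<in>carrier G - {\<one>}. ?fix u * ?fix u)"
    unfolding fix1[symmetric] by (rule sum.remove) auto
  also have "(\<Sum>u\<in>carrier G - {\<one>}. ?fix u * ?fix u) = (\<Sum>u\<in>carrier G - {\<one>}. ?fix u)"
    by (intro sum.cong) (auto simp: fixu)
  also have "n * n + (\<Sum>u\<in>carrier G - {\<one>}. ?fix u) = 2 * Coset.order G"
  proof -
    have "Coset.order G = n + (\<Sum>u\<in>carrier G - {\<one>}. ?fix u)"
      unfolding sum_fixed_cosets[OF H, symmetric] fix1[symmetric] by (rule sum.remove) auto
    moreover have "n * n = n * (n - 1) + n" using n by simp
    ultimately show ?thesis using ord by linarith
  qed
  finally have sq: "(\<Sum>u\<in>carrier G. ?fix u * ?fix u) = 2 * Coset.order G" .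
  have "of_nat ((\<Sum>\<phi>\<leftarrow>\<psi>s. count_list \<psi>s \<phi>) * Coset.order G) =
      (\<Sum>g\<in>carrier G. (\<Sum>\<psi>\<leftarrow>\<psi>s. \<psi> g) * (\<Sum>\<psi>\<leftarrow>\<psi>s. \<psi> (inv g)))"
    by (rule sum_list_character_norm[OF \<psi>s, symmetric])
  also have "\<dots> = of_nat (\<Sum>g\<in>carrier G. ?fix g * ?fix g)"
    unfolding of_nat_sum by (intro sum.cong refl) (simp add: val fix_inv)
  finally have "(\<Sum>\<phi>\<leftarrow>\<psi>s. count_list \<psi>s \<phi>) * Coset.order G = 2 * Coset.order G"
    unfolding sq by (simp only: of_nat_eq_iff)
  then have norm2: "(\<Sum>\<phi>\<leftarrow>\<psi>s. count_list \<psi>s \<phi>) = 2" using o by simp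
  \<comment> \<open>each listed character is counted at least once, so norm \<open>2\<close> leaves at most two of them\<close>
  have "length xs \<le> (\<Sum>x\<leftarrow>xs. count_list ys x)" if "set xs \<subseteq> set ys" for xs ys :: "('a \<Rightarrow> complex) list"
    using that
  proof (induction xs)
    case (Cons x xs)
    then have "count_list ys x \<noteq> 0" by (auto simp: count_list_0_iff)
    then show ?case using Cons by simp
  qed simp
  then have "length \<psi>s \<le> 2" using norm2 by (metis order_refl)
  moreover have "\<psi>s \<noteq> []" "\<psi>s \<noteq> [\<phi>]" for \<phi> using norm2 by auto
  ultimately obtain \<alpha> \<beta> where ab: "\<psi>s = [\<alpha>, \<beta>]"
    by (cases \<psi>s rule: list.exhaust; cases "tl \<psi>s"; cases "tl (tl \<psi>s)") auto
  obtain \<chi> where \<chi>: "\<chi> \<in> Irr G" "\<And>g. g \<in> carrier G \<Longrightarrow> of_nat (?fix g) = 1 + \<chi> g"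
  proof (cases "\<alpha> = ?triv")
    case True
    then show ?thesis using \<psi>s by (intro that[of \<beta>]) (auto simp: ab val[symmetric])
  next
    case False
    then have "\<beta> = ?triv" using triv by (auto simp: ab split: if_splits)
    then show ?thesis using \<psi>s by (intro that[of \<alpha>]) (auto simp: ab val[symmetric])
  qed
  have "1 + \<chi> \<one> = of_nat n" using \<chi>(2)[OF one_closed] fix1 by simp
  then have "\<chi> \<one> = of_nat (card H)" using n by simp
  moreover have "\<chi> g = -1" if "g \<in> ?N" "g \<noteq> \<one>" for g
  proof -
    have gc: "g \<in> carrier G" using that frobenius_kernel_carrier by auto
    have "1 + \<chi> g = 0" using \<chi>(2)[OF gc] fixu[OF gc that(2)] that(1) by simp
    then show ?thesis by (simp add: add_eq_0_iff)
  qed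
  ultimately show ?thesis using that \<chi>(1) by blast
qed

text \<open>
  A converse of \<open>common_kernel_but_value\<close>: the regular character yields
  \<open>\<Sum>\<psi>(1)(\<psi>(1) - \<psi>(g)) = 0\<close> over \<open>\<psi> \<noteq> \<chi>\<close>, where no summand has negative real part.
\<close>
lemma common_kernel_butI:
  assumes \<chi>: "\<chi> \<in> Irr G" and g: "g \<in> carrier G" "g \<noteq> \<one>"
    and val: "\<chi> \<one> * (\<chi> \<one> - \<chi> g) = of_nat (Coset.order G)"
  shows "g \<in> common_kernel_but \<chi>"
proof -
  let ?f = "\<lambda>\<psi>. Re (\<psi> \<one> * \<psi> \<one> - \<psi> \<one> * \<psi> g)"
  have "(\<Sum>\<psi>\<in>Irr G - {\<chi>}. \<psi> \<one> * \<psi> \<one> - \<psi> \<one> * \<psi> g) = 0"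
  proof -
    have "(\<Sum>\<psi>\<in>Irr G - {\<chi>}. \<psi> \<one> * \<psi> g) = - (\<chi> \<one> * \<chi> g)"
      using regular_character[OF g(1)] g(2) unfolding sum_Irr_remove[OF \<chi>] by (simp add: add_eq_0_iff)
    then show ?thesis
      unfolding sum_subtractf sum_square_degrees_but[OF \<chi>] val[symmetric] by (simp add: algebra_simps)
  qed
  then have "(\<Sum>\<psi>\<in>Irr G - {\<chi>}. ?f \<psi>) = 0" by (metis Re_sum zero_complex.sel(1))
  moreover have re: "\<exists>n>0. \<psi> \<one> = of_nat n \<and> ?f \<psi> = real n * (Re (\<psi> \<one>) - Re (\<psi> g))" if \<psi>: "\<psi> \<in> Irr G" for \<psi>
  proof -
    obtain n :: nat where "n > 0" "\<psi> \<one> = of_nat n" using Irr_degree[OF \<psi>] by metis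
    then show ?thesis by (intro exI[of _ n]) (simp add: algebra_simps)
  qed
  moreover have "?f \<psi> \<ge> 0" if \<psi>: "\<psi> \<in> Irr G - {\<chi>}" for \<psi>
  proof -
    have "Re (\<psi> g) \<le> Re (\<psi> \<one>)"
      using character_norm_le_degree[of \<psi> g] complex_Re_le_cmod[of "\<psi> g"] \<psi> g by simp
    moreover obtain n :: nat where "?f \<psi> = real n * (Re (\<psi> \<one>) - Re (\<psi> g))" using re \<psi> by blast
    ultimately show ?thesis by (metis diff_ge_0_iff_ge mult_nonneg_nonneg of_nat_0_le_iff)
  qed
  moreover have "finite (Irr G - {\<chi>})" using Irr_finite by simp
  ultimately have zero: "\<forall>\<psi>\<in>Irr G - {\<chi>}. ?f \<psi> = 0" using sum_nonneg_eq_0_iff[of "Irr G - {\<chi>}" ?f] by blast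
  have "\<psi> g = \<psi> \<one>" if \<psi>: "\<psi> \<in> Irr G" "\<psi> \<noteq> \<chi>" for \<psi>
  proof (rule character_eq_degreeI[OF \<psi>(1) g(1)])
    obtain n :: nat where n: "n > 0" "?f \<psi> = real n * (Re (\<psi> \<one>) - Re (\<psi> g))" using re[OF \<psi>(1)] by blast
    then have "real n * (Re (\<psi> \<one>) - Re (\<psi> g)) = 0" using zero \<psi> by auto
    then show "Re (\<psi> g) \<ge> Re (\<psi> \<one>)" using n(1) by simp
  qed
  then show ?thesis using g by (simp add: common_kernel_but_def)
qed

text \<open>
  The square sum of the degrees other than \<open>\<chi>(1) = |H|\<close> is \<open>|G| - |H|\<^sup>2 = |H|\<close>, so \<open>\<chi>\<close> has the
  largest degree.
\<close>
theorem doubly_transitive_imp_CD1: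
  assumes dt: "doubly_transitive_frobenius G"
  shows "\<exists>\<chi> b. CD1_data G \<chi> b \<and> \<chi> b = -1"
proof -
  obtain H where fc: "frobenius_complement G H" and cN: "card H = card (frobenius_kernel G H) - 1"
    using dt by (auto simp: doubly_transitive_frobenius_def)
  note H = frobenius_complementD(1)[OF fc]
  let ?N = "frobenius_kernel G H"
  have finH: "finite H" using finite_subset[OF subgroup.subset[OF H] finite_carrier] .
  have H2: "card H \<ge> 2"
  proof (rule ccontr)
    assume "\<not> card H \<ge> 2"
    moreover have "card H > 0" using finH subgroup.one_closed[OF H] by (auto simp: card_gt_0_iff)
    ultimately have "card H = 1" by simp
    then show False using frobenius_complementD(2)[OF fc] subgroup.one_closed[OF H] by (auto simp: card_1_singleton_iff)
  qed
  obtain \<chi> where \<chi>: "\<chi> \<in> Irr G" "\<chi> \<one> = of_nat (card H)" "\<And>g. g \<in> ?N \<Longrightarrow> g \<noteq> \<one> \<Longrightarrow> \<chi> g = -1"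
    using doubly_transitive_character[OF fc cN] by metis
  have Nn: "card ?N = card H + 1" using cN H2 by simp
  then have ord: "Coset.order G = (card H + 1) * card H" using card_frobenius_kernel(2)[OF fc] by simp
  have "\<not> ?N \<subseteq> {\<one>}"
  proof
    assume "?N \<subseteq> {\<one>}"
    then have "card ?N \<le> card {\<one>}" by (intro card_mono) auto
    then show False using Nn H2 by simp
  qed
  then obtain b where b: "b \<in> ?N" "b \<noteq> \<one>" by auto
  then have bc: "b \<in> carrier G" using frobenius_kernel_carrier by auto
  have val: "\<chi> \<one> * (\<chi> \<one> - \<chi> b) = of_nat (Coset.order G)"
    unfolding ord \<chi>(2) \<chi>(3)[OF b] by (simp add: algebra_simps)
  have bk: "b \<in> common_kernel_but \<chi>" by (rule common_kernel_butI[OF \<chi>(1) bc b(2) val])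
  have last: "last_character G \<chi>" unfolding last_character_def
  proof (intro conjI ballI \<chi>(1))
    fix \<psi> assume \<psi>: "\<psi> \<in> Irr G"
    show "Re (\<psi> \<one>) \<le> Re (\<chi> \<one>)"
    proof (cases "\<psi> = \<chi>")
      case False
      have "(\<Sum>\<psi>\<in>Irr G - {\<chi>}. Re (\<psi> \<one> * \<psi> \<one>)) = real (card H)"
        using arg_cong[OF sum_square_degrees_but[OF \<chi>(1)], of Re] unfolding ord \<chi>(2) by (simp add: algebra_simps)
      moreover have "Re (\<psi> \<one> * \<psi> \<one>) \<le> (\<Sum>\<psi>\<in>Irr G - {\<chi>}. Re (\<psi> \<one> * \<psi> \<one>))"
      proof (rule member_le_sum)
        fix \<phi> assume "\<phi> \<in> Irr G - {\<chi>} - {\<psi>}"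
        then obtain m :: nat where "\<phi> \<one> = of_nat m" using Irr_degree[of \<phi>] by auto
        then show "0 \<le> Re (\<phi> \<one> * \<phi> \<one>)" by simp
      qed (use False \<psi> Irr_finite in auto)
      ultimately have le: "Re (\<psi> \<one> * \<psi> \<one>) \<le> real (card H)" by simp
      obtain m :: nat where m: "\<psi> \<one> = of_nat m" using Irr_degree[OF \<psi>] by metis
      have "real (m * m) \<le> real (card H)" using le m by simp
      then have "m * m \<le> card H" by (simp only: of_nat_le_iff)
      then have "m \<le> card H" by (rule order_trans[OF le_square])
      then show ?thesis using m \<chi>(2) by simp
    qed simp
  qed
  have ne: "\<chi> b \<noteq> \<chi> \<one>"
  proof
    assume "\<chi> b = \<chi> \<one>"
    then have "Re (-1) = Re (of_nat (card H))" unfolding \<chi>(3)[OF b] \<chi>(2) by (rule arg_cong)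
    then show False by simp
  qed
  show ?thesis
    using last bk b(2) ne \<chi> b by (intro exI[of _ \<chi>] exI[of _ b]) (simp add: CD1_data_def columns_differ_only_at_one_iff)
qed

section \<open>Extreme groups with value \<open>-1\<close>\<close>

text \<open>
  With \<open>n = \<chi>(1)\<close> there are \<open>n + 1\<close> conjugating elements between any two nontrivial elements of \<open>K\<close>,
  which gives \<open>|K| = n + 1\<close> by counting all conjugates of \<open>b\<close>, and \<open>K\<close> as the centralizer of each of
  its nontrivial elements. If \<open>x\<close> and \<open>z\<close> are elements of the complement \<open>H\<close> with
  \<open>x = k z k\<^sup>-\<^sup>1\<close>, \<open>k \<in> K\<close>, then \<open>x\<close> and \<open>z\<close> agree modulo \<open>K\<close> and hence are equal; so \<open>x\<close> centralizes
  \<open>k\<close>, and \<open>x = 1\<close> if \<open>k \<noteq> 1\<close>.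
\<close>
theorem minus_one_imp_doubly_transitive:
  assumes \<chi>: "\<chi> \<in> Irr G" and b: "b \<in> common_kernel_but \<chi>" "b \<noteq> \<one>" and bm: "\<chi> b = -1"
    and o: "Coset.order G > 2"
  shows "doubly_transitive_frobenius G"
proof -
  define K where "K = common_kernel_but \<chi>"
  have K: "subgroup K G" unfolding K_def by (rule common_kernel_but_subgroup)
  interpret K: subgroup K G by (rule K)
  have finK: "finite K" using finite_subset[OF K.subset finite_carrier] .
  have bK: "b \<in> K" using b by (simp add: K_def)
  have bc: "b \<in> carrier G" using bK by auto
  have normal: "g \<otimes> x \<otimes> inv g \<in> K" if "g \<in> carrier G" "x \<in> K" for g x
    using that common_kernel_but_conj by (simp add: K_def)
  obtain n :: nat where n: "n > 0" "\<chi> \<one> = of_nat n" using Irr_degree[OF \<chi>] by metis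
  have "of_nat (Coset.order G) = (of_nat (n * (n + 1)) :: complex)"
    unfolding common_kernel_but_value[OF \<chi> b, symmetric] by (simp add: bm n(2) algebra_simps)
  then have ord: "Coset.order G = n * (n + 1)" by (simp only: of_nat_eq_iff)
  have n1: "n \<noteq> 1" using o ord by auto
  have conjugators: "card {c\<in>carrier G. x = c \<otimes> y \<otimes> inv c} = n + 1"
    if "x \<in> K - {\<one>}" "y \<in> K - {\<one>}" for x y
  proof -
    have "of_nat (card {c\<in>carrier G. x = c \<otimes> y \<otimes> inv c}) = (of_nat (Coset.order G) - of_nat n * of_nat n + 1 :: complex)"
      using common_kernel_but_conjugators[OF \<chi> b, of x y] that bm n(2) by (simp add: K_def)
    also have "\<dots> = of_nat (n + 1)" unfolding ord by (simp add: algebra_simps)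
    finally show ?thesis by (simp only: of_nat_eq_iff)
  qed
  have trans: "\<exists>g\<in>carrier G. y = g \<otimes> x \<otimes> inv g" if "x \<in> K - {\<one>}" "y \<in> K - {\<one>}" for x y
  proof (rule ccontr)
    assume "\<not> ?thesis"
    then have none: "{c\<in>carrier G. y = c \<otimes> x \<otimes> inv c} = {}" by auto
    show False using conjugators[OF that(2,1)] unfolding none by simp
  qed
  have cardK: "card K = n + 1"
  proof -
    have "Coset.order G = (\<Sum>c\<in>carrier G. \<Sum>x\<in>K - {\<one>}. if x = c \<otimes> b \<otimes> inv c then 1 else 0)"
    proof -
      have "(\<Sum>x\<in>K - {\<one>}. if x = c \<otimes> b \<otimes> inv c then 1 else 0) = (1::nat)" if c: "c \<in> carrier G" for c
      proof -
        have "c \<otimes> b \<otimes> inv c \<noteq> \<one>"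
        proof
          assume "c \<otimes> b \<otimes> inv c = \<one>"
          then have "inv c \<otimes> (c \<otimes> b \<otimes> inv c) \<otimes> c = \<one>" using c by simp
          then show False using c bc b(2) by (simp add: m_assoc)
        qed
        then have "c \<otimes> b \<otimes> inv c \<in> K - {\<one>}" using normal[OF c bK] by simp
        then show ?thesis using finK by simp
      qed
      then show ?thesis by (simp add: Coset.order_def)
    qed
    also have "\<dots> = (\<Sum>x\<in>K - {\<one>}. card {c\<in>carrier G. x = c \<otimes> b \<otimes> inv c})"
      by (subst sum.swap) (simp add: sum.If_cases Int_def)
    also have "\<dots> = (\<Sum>x\<in>K - {\<one>}. n + 1)"
      by (intro sum.cong refl conjugators) (use bK b in auto)
    also have "\<dots> = card (K - {\<one>}) * (n + 1)" by simp
    finally have "n * (n + 1) = card (K - {\<one>}) * (n + 1)" unfolding ord .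
    then have "card (K - {\<one>}) = n" unfolding mult_cancel2 by simp
    then show ?thesis using card.remove[OF finK K.one_closed] by linarith
  qed
  have comm: "x \<otimes> y = y \<otimes> x" if "x \<in> K" "y \<in> K" for x y
    by (rule conjugate_nontrivial_imp_commutative[OF K normal trans that])
  have centralizer: "c \<in> K" if c: "c \<in> carrier G" and k: "k \<in> K" "k \<noteq> \<one>" and ck: "c \<otimes> k \<otimes> inv c = k" for c k
  proof -
    have "K \<subseteq> {c\<in>carrier G. k = c \<otimes> k \<otimes> inv c}"
    proof
      fix u assume u: "u \<in> K"
      then have "u \<otimes> k \<otimes> inv u = k" using conjugate_eq_iff[of u k] comm[OF u k(1)] k(1) by simp
      then show "u \<in> {c\<in>carrier G. k = c \<otimes> k \<otimes> inv c}" using u by simp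
    qed
    then have "K = {c\<in>carrier G. k = c \<otimes> k \<otimes> inv c}"
      using conjugators[of k k] k cardK by (intro card_subset_eq) auto
    moreover have "c \<in> {c\<in>carrier G. k = c \<otimes> k \<otimes> inv c}" using c ck by simp
    ultimately show ?thesis by blast
  qed
  have "card (rcosets K) * (n + 1) = n * (n + 1)" using lagrange[OF K] cardK ord by simp
  then have index: "card (rcosets K) = n" unfolding mult_cancel2 by simp
  have cop: "coprime (card K) (card (rcosets K))" unfolding index cardK by simp
  have "\<exists>H. subgroup H G \<and> H \<inter> K = {\<one>} \<and> (\<forall>g\<in>carrier G. \<exists>k\<in>K. k \<otimes> g \<in> H)"
  proof (rule abelian_normal_complement[OF K _ _ cop])
    show "g \<otimes> x \<otimes> inv g \<in> K" if "g \<in> carrier G" "x \<in> K" for g x by (rule normal[OF that])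
    show "x \<otimes> y = y \<otimes> x" if "x \<in> K" "y \<in> K" for x y by (rule comm[OF that])
  qed
  then obtain H where H: "subgroup H G" and HK: "H \<inter> K = {\<one>}"
    and cover: "\<And>g. g \<in> carrier G \<Longrightarrow> \<exists>k\<in>K. k \<otimes> g \<in> H"
    by blast
  interpret H: subgroup H G by (rule H)
  have decomp: "\<exists>k\<in>K. \<exists>h\<in>H. g = k \<otimes> h" if g: "g \<in> carrier G" for g
  proof -
    obtain k where k: "k \<in> K" "k \<otimes> g \<in> H" using cover[OF g] by blast
    have kc: "k \<in> carrier G" using k(1) by auto
    have "g = inv k \<otimes> (k \<otimes> g)" using g kc by simp
    then show ?thesis using k K.m_inv_closed by blast
  qed
  have "bij_betw (\<lambda>(k, h). k \<otimes> h) (K \<times> H) (carrier G)"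
  proof (rule bij_betwI')
    fix p q assume "p \<in> K \<times> H" "q \<in> K \<times> H"
    then obtain k h k' h' where p: "p = (k, h)" "k \<in> K" "h \<in> H" and q: "q = (k', h')" "k' \<in> K" "h' \<in> H" by auto
    have c: "k \<in> carrier G" "h \<in> carrier G" "k' \<in> carrier G" "h' \<in> carrier G" using p q by auto
    show "((case p of (k, h) \<Rightarrow> k \<otimes> h) = (case q of (k, h) \<Rightarrow> k \<otimes> h)) = (p = q)"
    proof
      assume "(case p of (k, h) \<Rightarrow> k \<otimes> h) = (case q of (k, h) \<Rightarrow> k \<otimes> h)"
      then have eq: "k \<otimes> h = k' \<otimes> h'" using p q by simp
      have "inv k' \<otimes> k = inv k' \<otimes> (k \<otimes> h) \<otimes> inv h" using c by (simp add: m_assoc)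
      also have "\<dots> = h' \<otimes> inv h" unfolding eq using c by (simp add: m_assoc)
      finally have e: "inv k' \<otimes> k = h' \<otimes> inv h" .
      have "inv k' \<otimes> k \<in> K" using p q by simp
      moreover have "inv k' \<otimes> k \<in> H" unfolding e using p q by simp
      ultimately have one: "inv k' \<otimes> k = \<one>" using HK by blast
      then have "k' \<otimes> (inv k' \<otimes> k) = k'" using c by simp
      then have "k = k'" using c by simp
      then show "p = q" using eq c p q by simp
    qed simp
  next
    fix p assume "p \<in> K \<times> H" then show "(case p of (k, h) \<Rightarrow> k \<otimes> h) \<in> carrier G" by auto
  next
    fix g assume "g \<in> carrier G"
    then show "\<exists>p\<in>K \<times> H. g = (case p of (k, h) \<Rightarrow> k \<otimes> h)" using decomp by force
  qed
  then have "card (K \<times> H) = Coset.order G" unfolding Coset.order_def by (rule bij_betw_same_card)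
  then have "(n + 1) * card H = (n + 1) * n" unfolding card_cartesian_product cardK ord by (simp add: mult.commute)
  then have cardH: "card H = n" unfolding mult_cancel1 by simp
  have fc: "frobenius_complement G H" unfolding frobenius_complement_def
  proof (intro conjI ballI H)
    show "H \<noteq> {\<one>}" using cardH n1 by auto
    show "H \<noteq> carrier G"
    proof
      assume "H = carrier G"
      then have "Coset.order G = n" using cardH by (simp add: Coset.order_def)
      then show False using ord n by simp
    qed
    fix g assume g: "g \<in> carrier G - H"
    obtain k h where kh: "k \<in> K" "h \<in> H" "g = k \<otimes> h" using decomp g by blast
    have kc: "k \<in> carrier G" and hc: "h \<in> carrier G" using kh by auto
    have k1: "k \<noteq> \<one>" using g kh by auto
    have "x = \<one>" if x: "x \<in> H" "x \<in> conjugate_set G g H" for x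
    proof -
      obtain y where y: "y \<in> H" "x = g \<otimes> y \<otimes> inv g" using x by (auto simp: conjugate_set_def)
      have yc: "y \<in> carrier G" and xc: "x \<in> carrier G" using x y by auto
      define z where "z = h \<otimes> y \<otimes> inv h"
      have zH: "z \<in> H" using kh y by (simp add: z_def)
      have zc: "z \<in> carrier G" using zH by auto
      have xz: "x = k \<otimes> z \<otimes> inv k" unfolding y(2) kh(3) z_def using kc hc yc by (simp add: m_assoc inv_mult_group)
      have "x \<otimes> inv z = k \<otimes> (z \<otimes> inv k \<otimes> inv z)" unfolding xz using kc zc by (simp add: m_assoc)
      moreover have "z \<otimes> inv k \<otimes> inv z \<in> K" using normal[OF zc] kh by simp
      ultimately have "x \<otimes> inv z \<in> K" using kh by simp
      moreover have "x \<otimes> inv z \<in> H" using x zH by simp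
      ultimately have "x \<otimes> inv z = \<one>" using HK by blast
      then have "(x \<otimes> inv z) \<otimes> z = z" using zc by simp
      then have "x = z" using xc zc by (simp add: m_assoc)
      then have "k \<otimes> x \<otimes> inv k = x" using xz by simp
      then have "k \<otimes> x = x \<otimes> k" using conjugate_eq_iff[OF kc xc] by simp
      then have "x \<otimes> k \<otimes> inv x = k" using conjugate_eq_iff[OF xc kc] by simp
      then have "x \<in> K" using centralizer[OF xc kh(1) k1] by simp
      then show ?thesis using HK x by auto
    qed
    moreover have "\<one> \<in> conjugate_set G g H"
      using g by (auto simp: conjugate_set_def intro!: image_eqI[of _ _ \<one>])
    ultimately show "H \<inter> conjugate_set G g H = {\<one>}" by auto
  qed
  have "card (frobenius_kernel G H) * n = (n + 1) * n"
    using card_frobenius_kernel(2)[OF fc] ord cardH by (simp add: mult.commute)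
  then have "card (frobenius_kernel G H) = n + 1" unfolding mult_cancel2 using n(1) by simp
  then show ?thesis unfolding doubly_transitive_frobenius_def using fc cardH by auto
qed

end

theorem theorem1:
  fixes G :: "('a, 'b) monoid_scheme"
  assumes "group G" and "finite (carrier G)" and "Coset.order G > 2"
  shows "(extreme_CD1_group G \<longleftrightarrow>
            (two_group G \<and> central_type G \<and> card (group_center G) = 2) \<or>
            doubly_transitive_frobenius G)
       \<and> (two_group G \<and> central_type G \<and> card (group_center G) = 2 \<longrightarrow>
            (\<forall>\<chi> b. CD1_data G \<chi> b \<longrightarrow> \<chi> b = - \<chi> \<one>\<^bsub>G\<^esub>))
       \<and> (doubly_transitive_frobenius G \<longrightarrow>
            (\<forall>\<chi> b. CD1_data G \<chi> b \<longrightarrow> \<chi> b = -1))"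
proof -
  interpret finite_group G
    using assms by (simp add: finite_group_def finite_group_axioms_def)
  have extremeI: "extreme_CD1_group G" if "CD1_data G \<chi> b" "\<chi> b = -1 \<or> \<chi> b = - \<chi> \<one>\<^bsub>G\<^esub>" for \<chi> b
    using that assms by (auto simp: extreme_CD1_group_def CD1_group_def CD1_data_def)
  have ct: "\<exists>\<chi> b. CD1_data G \<chi> b \<and> \<chi> b = - \<chi> \<one>\<^bsub>G\<^esub>"
    if "two_group G \<and> central_type G \<and> card (group_center G) = 2"
    using that central_type_imp_CD1 assms(3) by blast
  have dt: "\<exists>\<chi> b. CD1_data G \<chi> b \<and> \<chi> b = -1" if "doubly_transitive_frobenius G"
    using that by (rule doubly_transitive_imp_CD1)
  have "(two_group G \<and> central_type G \<and> card (group_center G) = 2) \<or> doubly_transitive_frobenius G"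
    if extreme: "extreme_CD1_group G"
  proof -
    obtain \<chi> b where data: "CD1_data G \<chi> b" and val: "\<chi> b = -1 \<or> \<chi> b = - \<chi> \<one>\<^bsub>G\<^esub>"
      using extreme by (auto simp: extreme_CD1_group_def)
    then have \<chi>: "\<chi> \<in> Irr G" and b: "b \<in> common_kernel_but \<chi>" "b \<noteq> \<one>\<^bsub>G\<^esub>"
      by (auto simp: CD1_data_def columns_differ_only_at_one_iff)
    from val show ?thesis
    proof
      assume "\<chi> b = -1"
      then show ?thesis using minus_one_imp_doubly_transitive[OF \<chi> b _ assms(3)] by blast
    next
      assume "\<chi> b = - \<chi> \<one>\<^bsub>G\<^esub>"
      then show ?thesis using minus_degree_imp_central_type[OF \<chi> b] by blast
    qed
  qed
  moreover have "\<chi> b = - \<chi> \<one>\<^bsub>G\<^esub>"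
    if c: "two_group G \<and> central_type G \<and> card (group_center G) = 2" and data: "CD1_data G \<chi> b" for \<chi> b
  proof -
    obtain \<chi>' b' where "CD1_data G \<chi>' b'" "\<chi>' b' = - \<chi>' \<one>\<^bsub>G\<^esub>" using ct[OF c] by blast
    then show ?thesis using CD1_data_value_unique[OF data] by metis
  qed
  moreover have "\<chi> b = -1" if d: "doubly_transitive_frobenius G" and data: "CD1_data G \<chi> b" for \<chi> b
  proof -
    obtain \<chi>' b' where "CD1_data G \<chi>' b'" "\<chi>' b' = -1" using dt[OF d] by blast
    then show ?thesis using CD1_data_value_unique(2)[OF data] by metis
  qed
  ultimately show ?thesis using ct dt extremeI by blast
qed

end
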